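(* Let $\gamma>2$, $n\in\mathbb{N}$ with $n\ge\gamma$, and let $(u,\mu)$ be a weak conservative solution of the Hunter--Saxton equation with $\int_{\mathbb{R}}(1+|x|^\gamma)d\mu(0,x)<\infty$; let $T>0$. Then $\mathcal{P}(t,\cdot)$ satisfies, for almost all $t$, the differential equation $$\mathcal{P}_t(t,\eta)+h(t,\eta)\mathcal{P}_\eta(t,\eta)=\mathcal{R}(t,\eta)$$ in $L^\gamma([0,B+C])\cap L^\infty([0,B+C])$, where $h(t,\eta)=\mathcal{U}\mathcal{P}(t,\eta)-\int_0^{B+C}\mathcal{U}(t,\tilde\eta)K(\chi(t,\eta)-\chi(t,\tilde\eta))(1-\mathcal{P}\chi_\eta(t,\tilde\eta))d\tilde\eta$ and $\mathcal{R}(t,\eta)=-\int_0^{B+C}\mathcal{U}(t,\tilde\eta)K'(\chi(t,\eta)-\chi(t,\tilde\eta))(1-\mathcal{P}\chi_\eta(t,\tilde\eta))d\tilde\eta+\mathcal{U}(t,\eta)\int_0^{B+C}K'(\chi(t,\eta)-\chi(t,\tilde\eta))(1-\mathcal{P}\chi_\eta(t,\tilde\eta))d\tilde\eta$. Furthermore, the map $t\mapsto\mathcal{P}(t,\cdot)$ is continuous from $[0,T]$ into $L^\gamma([0,B+C])$.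
   Context: The Hunter--Saxton equation is $u_t+uu_x=\tfrac14\big(\int_{-\infty}^x d\mu(t,z)-\int_x^{\infty}d\mu(t,z)\big)$, $\mu_t+(u\mu)_x=0$. Fix $\psi^\pm\in C^\infty(\mathbb{R})$ with $\psi^++\psi^-\equiv1$, $0\le\psi^\pm\le1$, $\operatorname{supp}\psi^-\subset(-\infty,1)$, $\operatorname{supp}\psi^+\subset(-1,\infty)$. $E_1=\{\bar f+a\psi^+:\bar f\in H^1,a\in\mathbb{R}\}$, $E_2=\{\bar f+a\psi^++b\psi^-:\bar f\in H^1,a,b\in\mathbb{R}\}$; $E_1^0,E_2^0$ analogously with $\bar f\in L^2$, normed by $(\|\bar f\|_{L^2}^2+a^2)^{1/2}$ resp. $(\|\bar f\|_{L^2}^2+a^2+b^2)^{1/2}$. $\mathcal{D}$: pairs $(u,\mu)$, $u\in E_2$, $\mu$ positive finite Radon measure, $\mu((-\infty,\cdot))\in E_1^0$, $d\mu_{\rm ac}=u_x^2dx$. A weak conservative solution with initial data in $\mathcal{D}$ is a pair $(u,\mu)$ with: (i) $u(t,\cdot)\in E_2$; (ii) $\mu(t,(-\infty,\cdot))\in E_1^0$, $d\mu_{\rm ac}(t)=u_x^2(t,\cdot)dx$; (iii) for all $\phi\in C_c^\infty([0,\infty)\times\mathbb{R})$: $\int_0^\infty\!\int[u\phi_t+\tfrac12u^2\phi_x+\tfrac14(\int_{-\infty}^xd\mu(t)-\int_x^\infty d\mu(t))\phi]dxdt=-\int u\phi|_{t=0}dx$ and $\int_0^\infty\!\int(\phi_t+u\phi_x)d\mu(t)dt=-\int\phi|_{t=0}d\mu(0)$;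 (iv) for every $T>0$, $u$ Hölder continuous on $[0,T]\times\mathbb{R}$ and $t\mapsto u(t,\cdot)$ Lipschitz $[0,T]\to E_2^0$; (v) for a.e. $t$, $\mu(t)$ absolutely continuous with density $u_x^2(t,\cdot)$; (vi) $t\mapsto\mu(t)$ weakly continuous. $C=\mu(t,\mathbb{R})$ (independent of $t$). $K(x)=(1+x^2)^{-n}$, $p(t,x)=\int K(x-y)d\mu(t,y)$, $B=\int_{\mathbb{R}}p(t,x)dx$ (independent of $t$), $G(t,x)=\int_{-\infty}^xp(t,y)dy+\mu(t,(-\infty,x))$, $\chi(t,\eta)=\sup\{x\mid G(t,x)<\eta\}$ for $\eta\in[0,B+C]$, $\mathcal{U}(t,\eta)=u(t,\chi(t,\eta))$, $\mathcal{P}(t,\eta)=p(t,\chi(t,\eta))$; $\chi_\eta,\mathcal{P}_\eta$ denote a.e. derivatives in $\eta$. *)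

theory Defs
  imports "HOL-Analysis.Analysis"
begin

definition sq_int :: "(real \<Rightarrow> real) \<Rightarrow> bool" where
  "sq_int f \<longleftrightarrow> f \<in> borel_measurable borel \<and> integrable lborel (\<lambda>x. (f x)\<^sup>2)"

definition L2_norm :: "(real \<Rightarrow> real) \<Rightarrow> real" where
  "L2_norm f = sqrt (\<integral>x. (f x)\<^sup>2 \<partial>lborel)"

definition smooth_fun :: "(real \<Rightarrow> real) \<Rightarrow> bool" where
  "smooth_fun f \<longleftrightarrow> (\<forall>k x. ((deriv ^^ k) f) differentiable (at x))"

definition test_fun :: "(real \<Rightarrow> real) \<Rightarrow> bool" where
  "test_fun \<phi> \<longleftrightarrow> smooth_fun \<phi> \<and> bounded {x. \<phi> x \<noteq> 0}"

definition weak_deriv :: "(real \<Rightarrow> real) \<Rightarrow> (real \<Rightarrow> real) \<Rightarrow> bool" where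
  "weak_deriv f g \<longleftrightarrow> g \<in> borel_measurable borel \<and>
     (\<forall>\<phi>. test_fun \<phi> \<longrightarrow>
        integrable lborel (\<lambda>x. f x * deriv \<phi> x) \<and> integrable lborel (\<lambda>x. g x * \<phi> x) \<and>
        (\<integral>x. f x * deriv \<phi> x \<partial>lborel) = - (\<integral>x. g x * \<phi> x \<partial>lborel))"

definition H1 :: "(real \<Rightarrow> real) \<Rightarrow> bool" where
  "H1 f \<longleftrightarrow> sq_int f \<and> (\<exists>g. weak_deriv f g \<and> sq_int g)"

definition cutoff_pair :: "(real \<Rightarrow> real) \<Rightarrow> (real \<Rightarrow> real) \<Rightarrow> bool" where
  "cutoff_pair \<psi>p \<psi>m \<longleftrightarrow> smooth_fun \<psi>p \<and> smooth_fun \<psi>m \<and>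
     (\<forall>x. \<psi>p x + \<psi>m x = 1) \<and>
     (\<forall>x. 0 \<le> \<psi>p x \<and> \<psi>p x \<le> 1 \<and> 0 \<le> \<psi>m x \<and> \<psi>m x \<le> 1) \<and>
     closure {x. \<psi>m x \<noteq> 0} \<subseteq> {..<1} \<and> closure {x. \<psi>p x \<noteq> 0} \<subseteq> {-1<..}"

definition E1 :: "(real \<Rightarrow> real) \<Rightarrow> (real \<Rightarrow> real) \<Rightarrow> bool" where
  "E1 \<psi>p f \<longleftrightarrow> (\<exists>fb a. H1 fb \<and> f = (\<lambda>x. fb x + a * \<psi>p x))"

definition E2 :: "(real \<Rightarrow> real) \<Rightarrow> (real \<Rightarrow> real) \<Rightarrow> (real \<Rightarrow> real) \<Rightarrow> bool" where
  "E2 \<psi>p \<psi>m f \<longleftrightarrow> (\<exists>fb a b. H1 fb \<and> f = (\<lambda>x. fb x + a * \<psi>p x + b * \<psi>m x))"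

definition E1_0 :: "(real \<Rightarrow> real) \<Rightarrow> (real \<Rightarrow> real) \<Rightarrow> bool" where
  "E1_0 \<psi>p f \<longleftrightarrow> (\<exists>fb a. sq_int fb \<and> f = (\<lambda>x. fb x + a * \<psi>p x))"

definition E2_0 :: "(real \<Rightarrow> real) \<Rightarrow> (real \<Rightarrow> real) \<Rightarrow> (real \<Rightarrow> real) \<Rightarrow> bool" where
  "E2_0 \<psi>p \<psi>m f \<longleftrightarrow> (\<exists>fb a b. sq_int fb \<and> f = (\<lambda>x. fb x + a * \<psi>p x + b * \<psi>m x))"

text \<open>Norm of E_2^0 (the decomposition is unique, so the set below is a singleton).\<close>
definition E2_0_norm :: "(real \<Rightarrow> real) \<Rightarrow> (real \<Rightarrow> real) \<Rightarrow> (real \<Rightarrow> real) \<Rightarrow> real" where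
  "E2_0_norm \<psi>p \<psi>m f = Inf {sqrt ((L2_norm fb)\<^sup>2 + a\<^sup>2 + b\<^sup>2) | fb a b.
       sq_int fb \<and> f = (\<lambda>x. fb x + a * \<psi>p x + b * \<psi>m x)}"

text \<open>C-infinity functions of two real variables: continuous, with partial derivatives
  of all orders existing and continuous (a family closed under partial differentiation).\<close>
definition smooth2 :: "(real \<Rightarrow> real \<Rightarrow> real) \<Rightarrow> bool" where
  "smooth2 \<phi> \<longleftrightarrow> (\<exists>S. \<phi> \<in> S \<and> (\<forall>\<psi>\<in>S.
      continuous_on UNIV (\<lambda>(t, x). \<psi> t x) \<and>
      (\<exists>\<psi>t\<in>S. \<forall>t x. ((\<lambda>s. \<psi> s x) has_real_derivative \<psi>t t x) (at t)) \<and>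
      (\<exists>\<psi>x\<in>S. \<forall>t x. ((\<lambda>y. \<psi> t y) has_real_derivative \<psi>x t x) (at x))))"

text \<open>Test functions on [0,inf) x R (restrictions of compactly supported smooth functions).\<close>
definition test_fun2 :: "(real \<Rightarrow> real \<Rightarrow> real) \<Rightarrow> bool" where
  "test_fun2 \<phi> \<longleftrightarrow> smooth2 \<phi> \<and> bounded {(t, x). \<phi> t x \<noteq> 0}"

definition dt :: "(real \<Rightarrow> real \<Rightarrow> real) \<Rightarrow> real \<Rightarrow> real \<Rightarrow> real" where
  "dt \<phi> t x = deriv (\<lambda>s. \<phi> s x) t"

definition dx :: "(real \<Rightarrow> real \<Rightarrow> real) \<Rightarrow> real \<Rightarrow> real \<Rightarrow> real" where
  "dx \<phi> t x = deriv (\<lambda>y. \<phi> t y) x"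

definition holder_on :: "(real \<times> real) set \<Rightarrow> (real \<times> real \<Rightarrow> real) \<Rightarrow> bool" where
  "holder_on S f \<longleftrightarrow> (\<exists>\<alpha> L. 0 < \<alpha> \<and> \<alpha> \<le> 1 \<and>
      (\<forall>p\<in>S. \<forall>q\<in>S. \<bar>f p - f q\<bar> \<le> L * dist p q powr \<alpha>))"

definition finite_borel_measure :: "real measure \<Rightarrow> bool" where
  "finite_borel_measure M \<longleftrightarrow> sets M = sets borel \<and> emeasure M UNIV < \<infinity>"

definition ac_part_density :: "real measure \<Rightarrow> (real \<Rightarrow> real) \<Rightarrow> bool" where
  "ac_part_density M f \<longleftrightarrow> (\<exists>N\<in>sets borel. emeasure lborel N = 0 \<and>
      (\<forall>A\<in>sets borel. emeasure M A =
         (\<integral>\<^sup>+x\<in>A. ennreal (f x) \<partial>lborel) + emeasure M (A \<inter> N)))"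

definition abs_cont_density :: "real measure \<Rightarrow> (real \<Rightarrow> real) \<Rightarrow> bool" where
  "abs_cont_density M f \<longleftrightarrow> (\<forall>A\<in>sets borel. emeasure M A = (\<integral>\<^sup>+x\<in>A. ennreal (f x) \<partial>lborel))"

definition HS_weak_conservative ::
  "(real \<Rightarrow> real) \<Rightarrow> (real \<Rightarrow> real) \<Rightarrow> (real \<Rightarrow> real \<Rightarrow> real) \<Rightarrow> (real \<Rightarrow> real measure) \<Rightarrow> bool" where
  "HS_weak_conservative \<psi>p \<psi>m u \<mu> \<longleftrightarrow>
    \<comment> \<open>(i)\<close>
    (\<forall>t\<ge>0. E2 \<psi>p \<psi>m (u t)) \<and>
    \<comment> \<open>(ii), together with: mu(t) positive finite (Radon) Borel measure\<close>
    (\<forall>t\<ge>0. finite_borel_measure (\<mu> t) \<and>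
        E1_0 \<psi>p (\<lambda>x. measure (\<mu> t) {..<x}) \<and>
        (\<exists>g. weak_deriv (u t) g \<and> ac_part_density (\<mu> t) (\<lambda>x. (g x)\<^sup>2))) \<and>
    \<comment> \<open>(iii)\<close>
    (\<forall>\<phi>. test_fun2 \<phi> \<longrightarrow>
        (LINT t:{0..}|lborel. (\<integral>x. u t x * dt \<phi> t x + (1/2) * (u t x)\<^sup>2 * dx \<phi> t x
            + (1/4) * (measure (\<mu> t) {..<x} - measure (\<mu> t) {x..}) * \<phi> t x \<partial>lborel))
          = - (\<integral>x. u 0 x * \<phi> 0 x \<partial>lborel) \<and>
        (LINT t:{0..}|lborel. (\<integral>x. dt \<phi> t x + u t x * dx \<phi> t x \<partial>(\<mu> t)))
          = - (\<integral>x. \<phi> 0 x \<partial>(\<mu> 0))) \<and>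
    \<comment> \<open>(iv)\<close>
    (\<forall>T>0. holder_on ({0..T} \<times> UNIV) (\<lambda>(t, x). u t x) \<and>
        (\<exists>L. \<forall>t\<in>{0..T}. \<forall>s\<in>{0..T}. E2_0 \<psi>p \<psi>m (\<lambda>x. u t x - u s x) \<and>
             E2_0_norm \<psi>p \<psi>m (\<lambda>x. u t x - u s x) \<le> L * \<bar>t - s\<bar>)) \<and>
    \<comment> \<open>(v)\<close>
    (AE t in lborel. t \<ge> 0 \<longrightarrow>
        (\<exists>g. weak_deriv (u t) g \<and> abs_cont_density (\<mu> t) (\<lambda>x. (g x)\<^sup>2))) \<and>
    \<comment> \<open>(vi) weak continuity of t \<mapsto> mu(t)\<close>
    (\<forall>f::real \<Rightarrow> real. continuous_on UNIV f \<and> bounded (range f) \<longrightarrow>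
        continuous_on {0..} (\<lambda>t. \<integral>x. f x \<partial>(\<mu> t)))"

definition Kn :: "nat \<Rightarrow> real \<Rightarrow> real" where
  "Kn n x = 1 / (1 + x\<^sup>2) ^ n"

definition pp :: "nat \<Rightarrow> (real \<Rightarrow> real measure) \<Rightarrow> real \<Rightarrow> real \<Rightarrow> real" where
  "pp n \<mu> t x = (\<integral>y. Kn n (x - y) \<partial>(\<mu> t))"

text \<open>B + C (both independent of t; we take their values at t = 0).\<close>
definition BC :: "nat \<Rightarrow> (real \<Rightarrow> real measure) \<Rightarrow> real" where
  "BC n \<mu> = (\<integral>x. pp n \<mu> 0 x \<partial>lborel) + measure (\<mu> 0) UNIV"

definition GG :: "nat \<Rightarrow> (real \<Rightarrow> real measure) \<Rightarrow> real \<Rightarrow> real \<Rightarrow> real" where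
  "GG n \<mu> t x = (LINT y:{..x}|lborel. pp n \<mu> t y) + measure (\<mu> t) {..<x}"

definition chi :: "nat \<Rightarrow> (real \<Rightarrow> real measure) \<Rightarrow> real \<Rightarrow> real \<Rightarrow> real" where
  "chi n \<mu> t \<eta> = Sup {x. GG n \<mu> t x < \<eta>}"

definition UU :: "nat \<Rightarrow> (real \<Rightarrow> real \<Rightarrow> real) \<Rightarrow> (real \<Rightarrow> real measure) \<Rightarrow> real \<Rightarrow> real \<Rightarrow> real" where
  "UU n u \<mu> t \<eta> = u t (chi n \<mu> t \<eta>)"

definition PP :: "nat \<Rightarrow> (real \<Rightarrow> real measure) \<Rightarrow> real \<Rightarrow> real \<Rightarrow> real" where
  "PP n \<mu> t \<eta> = pp n \<mu> t (chi n \<mu> t \<eta>)"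

definition hh :: "nat \<Rightarrow> (real \<Rightarrow> real \<Rightarrow> real) \<Rightarrow> (real \<Rightarrow> real measure) \<Rightarrow> real \<Rightarrow> real \<Rightarrow> real" where
  "hh n u \<mu> t \<eta> = UU n u \<mu> t \<eta> * PP n \<mu> t \<eta>
     - (LINT \<eta>':{0..BC n \<mu>}|lborel. UU n u \<mu> t \<eta>' * Kn n (chi n \<mu> t \<eta> - chi n \<mu> t \<eta>')
           * (1 - PP n \<mu> t \<eta>' * deriv (chi n \<mu> t) \<eta>'))"

definition RR :: "nat \<Rightarrow> (real \<Rightarrow> real \<Rightarrow> real) \<Rightarrow> (real \<Rightarrow> real measure) \<Rightarrow> real \<Rightarrow> real \<Rightarrow> real" where
  "RR n u \<mu> t \<eta> =
     - (LINT \<eta>':{0..BC n \<mu>}|lborel. UU n u \<mu> t \<eta>' * deriv (Kn n) (chi n \<mu> t \<eta> - chi n \<mu> t \<eta>')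
           * (1 - PP n \<mu> t \<eta>' * deriv (chi n \<mu> t) \<eta>'))
     + UU n u \<mu> t \<eta> * (LINT \<eta>':{0..BC n \<mu>}|lborel. deriv (Kn n) (chi n \<mu> t \<eta> - chi n \<mu> t \<eta>')
           * (1 - PP n \<mu> t \<eta>' * deriv (chi n \<mu> t) \<eta>'))"

definition Lp_on :: "real set \<Rightarrow> real \<Rightarrow> (real \<Rightarrow> real) \<Rightarrow> bool" where
  "Lp_on S \<gamma> f \<longleftrightarrow> set_borel_measurable lborel S f \<and>
     (\<integral>\<^sup>+x\<in>S. ennreal (\<bar>f x\<bar> powr \<gamma>) \<partial>lborel) < \<infinity>"

definition Linf_on :: "real set \<Rightarrow> (real \<Rightarrow> real) \<Rightarrow> bool" where
  "Linf_on S f \<longleftrightarrow> set_borel_measurable lborel S f \<and> (\<exists>M. AE x in lborel. x \<in> S \<longrightarrow> \<bar>f x\<bar> \<le> M)"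

definition Lp_dist_pow :: "real set \<Rightarrow> real \<Rightarrow> (real \<Rightarrow> real) \<Rightarrow> (real \<Rightarrow> real) \<Rightarrow> ennreal" where
  "Lp_dist_pow S \<gamma> f g = (\<integral>\<^sup>+x\<in>S. ennreal (\<bar>f x - g x\<bar> powr \<gamma>) \<partial>lborel)"

end

theory Submission
  imports Defs
begin

text \<open>
  Only the transport of the measures by the bounded continuous field \<open>u\<close> matters: for \<open>f\<close> bounded
  with bounded continuous derivative, \<open>t \<mapsto> \<integral>f d\<mu>(t)\<close> has derivative \<open>\<integral>u f' d\<mu>(t)\<close>. Write
  \<open>\<rho>(t) = p(t) dx + \<mu>(t)\<close>, so that \<open>G(t, \<cdot>)\<close> is the distribution function of \<open>\<rho>(t)\<close> and
  \<open>\<chi>(t, \<cdot>)\<close> pushes Lebesgue measure on \<open>(0, B + C)\<close> forward to \<open>\<rho>(t)\<close>.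

  Testing with decreasing functions that move with speed \<open>sup |u|\<close> shows that \<open>\<chi>(\<cdot>, \<eta>)\<close> is Lipschitz,
  uniformly in \<open>\<eta>\<close>. As \<open>p\<close> is Lipschitz in \<open>t\<close> and \<open>x\<close>, so is \<open>\<P>(\<cdot>, \<eta>)\<close>, which gives
  the continuity into \<open>L\<^sup>\<gamma>\<close> and a uniform bound on the difference quotients in time. By Lebesgue's theorem and
  Fubini, for almost every \<open>t\<close> the derivative \<open>\<chi>\<^sub>t(t, \<eta>)\<close> exists for almost every \<open>\<eta>\<close>.
  Differentiating \<open>\<integral>f(\<chi>(t, \<eta>)) d\<eta> = \<integral>f d\<rho>(t)\<close> in two ways identifies it as
  \<open>\<chi>\<^sub>t = \<U> - h \<chi>\<^sub>\<eta>\<close> whenever \<open>\<mu>(t)\<close> has no atoms. The chain rule for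
  \<open>\<P> = p(t, \<chi>)\<close> then gives the equation pointwise, and dominated convergence gives it in \<open>L\<^sup>\<gamma>\<close>.
\<close>

section \<open>Almost everywhere differentiability of Lipschitz functions\<close>

text \<open>\<open>u\<close> is only Hoelder continuous and \<open>\<mu> t\<close> only a measure,
  so \<open>\<chi>\<close> can be differentiated neither along characteristics nor by
  differentiating \<open>G\<close>. Existence and value of its time derivative are therefore
  obtained separately: the Lipschitz bound yields existence without a formula, and the weak identity
  yields the formula only after integration against functions of \<open>\<chi>(t, \<eta>)\<close>.
  Without atoms this loses nothing, because then \<open>G(t, \<chi>(t, \<eta>)) = \<eta>\<close> and
  every Borel set of \<open>\<eta>\<close> is a preimage under \<open>\<chi>(t, .)\<close>.

  Adding \<open>p dx\<close> to the measure is what makes the inverse regular: the kernel is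
  strictly positive, so \<open>G\<close> increases at least at the rate \<open>p > 0\<close> and
  \<open>\<chi>\<close> is continuous and locally Lipschitz in \<open>\<eta>\<close>. Being
  integrable, \<open>p\<close> has no positive lower bound on the line, so the Lipschitz estimates
  in \<open>\<eta>\<close> stay local in the open interval. The estimates in time, by contrast, are
  uniform in \<open>\<eta>\<close>.\<close>

text \<open>Points enclosed by arbitrarily short intervals with slope above \<open>s\<close> and others with slope
  below \<open>r < s\<close>. Taking the enclosing intervals open makes the sets \<open>steep\<close> open, hence
  \<open>nondiff\<close> Borel, also jointly in a parameter.\<close>

definition steep :: "(real \<Rightarrow> real) \<Rightarrow> real \<Rightarrow> real \<Rightarrow> real set" where
  "steep f s d = {x. \<exists>a b. a < x \<and> x < b \<and> b - a < d \<and> s * (b - a) < f b - f a}"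

definition nondiff :: "(real \<Rightarrow> real) \<Rightarrow> real set" where
  "nondiff f = (\<Union>r\<in>\<rat>. \<Union>s\<in>{s\<in>\<rat>. r < s}. \<Inter>n.
     steep f s (1 / Suc n) \<inter> steep (\<lambda>x. - f x) (- r) (1 / Suc n))"

lemma open_steep: "open (steep f s d)"
proof -
  have "steep f s d = \<Union> {{a<..<b} |a b. b - a < d \<and> s * (b - a) < f b - f a}"
    (is "_ = \<Union> ?R")
  proof (intro equalityI subsetI)
    fix x assume "x \<in> steep f s d"
    then obtain a b where "a < x" "x < b" "b - a < d" "s * (b - a) < f b - f a"
      unfolding steep_def by blast
    then have "x \<in> {a<..<b}" "{a<..<b} \<in> ?R" by auto
    then show "x \<in> \<Union> ?R" by (rule UnionI[rotated])
  next
    fix x assume "x \<in> \<Union> ?R"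
    then show "x \<in> steep f s d" unfolding steep_def by clarsimp blast
  qed
  moreover have "open (\<Union> ?R)" by (rule open_Union) auto
  ultimately show ?thesis by simp
qed

lemma countable_Rats_above: "countable {s\<in>\<rat>. (r::real) < s}"
  by (rule countable_subset[OF _ countable_rat]) auto

lemma nondiff_borel [measurable]: "nondiff f \<in> sets borel"
  unfolding nondiff_def
  by (intro sets.countable_UN'' countable_rat countable_Rats_above sets.countable_INT'' )
     (auto intro!: borel_open open_Int open_steep)

text \<open>Closed intervals are closed balls about their midpoints, so the Vitali covering theorem
  applies. The covering hypothesis provides arbitrarily short intervals, and those leaving
  \<open>U\<close> can be discarded.\<close>

lemma Vitali_interval_cover:
  fixes E U :: "real set"
  assumes "open U" "E \<subseteq> U"
    and cov: "\<And>x d. x \<in> E \<Longrightarrow> 0 < d \<Longrightarrow> \<exists>a b. a < x \<and> x < b \<and> b - a < d \<and> P a b"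
  obtains C where "countable C" "\<And>a b. (a, b) \<in> C \<Longrightarrow> a < b \<and> P a b \<and> {a..b} \<subseteq> U"
    "disjoint_family_on (\<lambda>(a, b). {a..b}) C" "negligible (E - (\<Union>(a, b)\<in>C. {a..b}))"
proof -
  define K where "K = {(a, b). a < b \<and> P a b \<and> {a..b} \<subseteq> U}"
  define c where "c = (\<lambda>(a::real, b). (a + b) / 2)"
  define r where "r = (\<lambda>(a::real, b). (b - a) / 2)"
  have cb: "cball (c i) (r i) = (case i of (a, b) \<Rightarrow> {a..b})" for i
    by (cases i) (auto simp: c_def r_def cball_def dist_real_def abs_if field_simps split: if_splits)
  obtain C where C: "countable C" "C \<subseteq> K"
     "pairwise (\<lambda>i j. disjnt (cball (c i) (r i)) (cball (c j) (r j))) C"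
     "negligible (E - (\<Union>i \<in> C. cball (c i) (r i)))"
  proof (rule Vitali_covering_theorem_cballs[of K r E c])
    show "0 < r i" if "i \<in> K" for i using that by (auto simp: K_def r_def)
    fix x d :: real assume x: "x \<in> E" "0 < d"
    then obtain e where e: "e > 0" "ball x e \<subseteq> U" using assms openE by blast
    obtain a b where ab: "a < x" "x < b" "b - a < min d e" "P a b"
      using cov[OF x(1), of "min d e"] x e by auto
    have "{a..b} \<subseteq> ball x e" using ab by (auto simp: ball_def dist_real_def)
    then have "(a, b) \<in> K" using ab e by (auto simp: K_def)
    moreover have "x \<in> cball (c (a, b)) (r (a, b))" using ab unfolding cb by auto
    moreover have "r (a, b) < d" using ab by (auto simp: r_def)
    ultimately show "\<exists>i. i \<in> K \<and> x \<in> cball (c i) (r i) \<and> r i < d" by blast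
  qed
  show thesis
  proof (rule that[of C])
    show "disjoint_family_on (\<lambda>(a, b). {a..b}) C"
      using C(3) unfolding cb disjoint_family_on_def pairwise_def disjnt_def by (auto split: prod.splits)
    show "negligible (E - (\<Union>(a, b)\<in>C. {a..b}))" using C(4) unfolding cb .
  qed (use C in \<open>auto simp: K_def\<close>)
qed

lemma emeasure_mono_negligible:
  assumes "negligible (A - B)" "A \<in> sets borel" "B \<in> sets borel"
  shows "emeasure lborel A \<le> emeasure lborel B"
proof -
  have "A - B \<in> null_sets lborel"
    using assms by (auto simp: negligible_iff_null_sets null_sets_completion_iff)
  then have "emeasure lborel (B \<union> (A - B)) = emeasure lborel B"
    by (rule emeasure_Un_null_set[rotated]) (use assms in auto)
  moreover have "emeasure lborel A \<le> emeasure lborel (B \<union> (A - B))"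
    using assms by (intro emeasure_mono) auto
  ultimately show ?thesis by simp
qed

text \<open>Two Vitali coverings: intervals of slope below \<open>r\<close> inside an open set that is hardly larger
  than the exceptional set, then intervals of slope above \<open>s\<close> inside those. Comparing the total
  increment of \<open>f\<close> over both families forces the measure to vanish.\<close>

lemma steep_oscillation_null:
  fixes f :: "real \<Rightarrow> real"
  assumes "mono f" and cont: "continuous_on UNIV f" and rs: "r < s"
  shows "(\<Inter>n. steep f s (1 / Suc n) \<inter> steep (\<lambda>x. - f x) (- r) (1 / Suc n)) \<in> null_sets lborel"
    (is "?E \<in> _")
proof -
  have mono: "f x \<le> f y" if "x \<le> y" for x y using that \<open>mono f\<close> by (simp add: mono_def)
  \<comment> \<open>The Stieltjes measure turns the sum of the increments of \<open>f\<close> over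
    disjoint intervals into the measure of their union; by continuity of \<open>f\<close> a closed
    interval has measure exactly \<open>f b - f a\<close>.\<close>
  define D where "D = interval_measure f"
  have D_Icc: "emeasure D {a..b} = ennreal (f b - f a)" if "a < b" for a b
    unfolding D_def using that by (intro emeasure_interval_measure_Icc mono cont) auto
  have setsD [measurable_cong, simp]: "sets D = sets borel" by (simp add: D_def)
  have small: "\<exists>n. 1 / Suc n < d" if "0 < d" for d :: real
    by (rule nat_approx_posE[OF that]) blast
  have covs: "\<exists>a b. a < x \<and> x < b \<and> b - a < d \<and> s * (b - a) < f b - f a"
    if "x \<in> ?E" "0 < d" for x d
  proof -
    have "\<exists>n. 1 / Suc n < d" using small \<open>0 < d\<close> by blast
    then obtain n where "1 / Suc n < d" ..
    moreover have "x \<in> steep f s (1 / Suc n)" using that by auto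
    ultimately show ?thesis unfolding steep_def by fastforce
  qed
  have covr: "\<exists>a b. a < x \<and> x < b \<and> b - a < d \<and> f b - f a < r * (b - a)"
    if "x \<in> ?E" "0 < d" for x d
  proof -
    have "\<exists>n. 1 / Suc n < d" using small \<open>0 < d\<close> by blast
    then obtain n where "1 / Suc n < d" ..
    moreover have "x \<in> steep (\<lambda>x. - f x) (- r) (1 / Suc n)" using that by auto
    ultimately show ?thesis unfolding steep_def by fastforce
  qed
  have Eb [measurable]: "?E \<in> sets borel"
    by (intro sets.countable_INT'') (auto intro!: borel_open open_Int open_steep)
  show ?thesis
  proof (cases "r > 0")
    \<comment> \<open>A monotone function has no interval of negative slope. With this case gone,
      \<open>r\<close> and \<open>s\<close> are positive and can multiply values in
      \<open>ennreal\<close>.\<close>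
    case False
    have "?E = {}"
    proof (rule equals0I)
      fix x assume "x \<in> ?E"
      then obtain a b where ab: "a < x" "x < b" "f b - f a < r * (b - a)"
        using covr[of x 1] by auto
      have "r * (b - a) \<le> 0" using False ab by (intro mult_nonpos_nonneg) auto
      then show False using mono[of a b] ab by linarith
    qed
    then show ?thesis by (metis null_sets.empty_sets)
  next
    case True
    \<comment> \<open>Bounded pieces have finite measure, so that \<open>s * e \<le> r * e\<close>
      forces \<open>e = 0\<close>.\<close>
    have N0: "emeasure lborel (?E \<inter> {-real N<..<real N}) = 0" for N :: nat
    proof -
      define F where "F = ?E \<inter> {-real N<..<real N}"
      have FE: "F \<subseteq> ?E" by (auto simp: F_def)
      have Fb [measurable]: "F \<in> sets borel" unfolding F_def by measurable
      have fin: "emeasure lborel F < \<infinity>"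
        by (rule le_less_trans[OF emeasure_mono[of _ "{-real N<..<real N}"]]) (auto simp: F_def)
      define e where "e = measure lborel F"
      have e: "emeasure lborel F = ennreal e" "0 \<le> e"
        using fin unfolding e_def by (auto simp: emeasure_eq_ennreal_measure)
      \<comment> \<open>The chain is \<open>s |F| \<le> s |W'| \<le> D W' \<le> D W \<le> r |W|
        \<le> r |U|\<close>, with \<open>W'\<close> made of intervals of slope above
        \<open>s\<close> inside \<open>V\<close>, and \<open>W\<close> of intervals of slope below
        \<open>r\<close> inside \<open>U\<close>.\<close>
      have *: "s * e \<le> r * (e + \<epsilon>)" if "\<epsilon> > 0" for \<epsilon>
      proof -
        obtain U where U: "open U" "F \<subseteq> U" "emeasure lborel (U - F) < ennreal \<epsilon>"
          by (rule outer_regular_lborel[OF Fb \<open>\<epsilon> > 0\<close>])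
        have [measurable]: "U \<in> sets borel" using U by auto
        have "emeasure lborel U = emeasure lborel (U - F) + emeasure lborel F"
          using U by (subst plus_emeasure) (auto intro!: arg_cong2[of _ _ _ _ emeasure])
        also have "\<dots> \<le> ennreal \<epsilon> + ennreal e" unfolding e(1) using U by (intro add_mono) auto
        finally have Ue: "emeasure lborel U \<le> ennreal (e + \<epsilon>)"
          using e \<open>\<epsilon> > 0\<close> by (simp add: ennreal_plus[symmetric] add.commute del: ennreal_plus)
        have covF: "\<exists>a b. a < x \<and> x < b \<and> b - a < d \<and> f b - f a < r * (b - a)"
          if "x \<in> F" "0 < d" for x d
          using covr that FE by blast
        obtain C where C: "countable C" "\<And>a b. (a, b) \<in> C \<Longrightarrow> a < b \<and> f b - f a < r * (b - a) \<and> {a..b} \<subseteq> U"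
          "disjoint_family_on (\<lambda>(a, b). {a..b}) C" "negligible (F - (\<Union>(a, b)\<in>C. {a..b}))"
          using Vitali_interval_cover[of U F "\<lambda>a b. f b - f a < r * (b - a)", OF U(1,2) covF] by blast
        \<comment> \<open>The second covering must live in an open set, so the end points of the
          first family are dropped; they are countably many.\<close>
        define V where "V = (\<Union>(a, b)\<in>C. {a<..<b})"
        define W where "W = (\<Union>(a, b)\<in>C. {a..b})"
        have WU: "W \<subseteq> U" using C(2) unfolding W_def by fastforce
        have Wb [measurable]: "W \<in> sets borel" unfolding W_def using C(1) by (intro sets.countable_UN'') auto
        have Vo: "open V" unfolding V_def by auto
        have VW: "V \<subseteq> W" unfolding V_def W_def by fastforce
        have "W - V \<subseteq> (\<Union>(a, b)\<in>C. {a, b})" unfolding V_def W_def by force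
        moreover have "countable (\<Union>(a, b)\<in>C. {a, b})" using C(1) by (intro countable_UN) auto
        ultimately have "countable (W - V)" by (rule countable_subset)
        then have "negligible (W - V)"
          by (simp add: countable_imp_null_set_lborel negligible_iff_null_sets null_sets_completionI)
        then have FV: "negligible (F - V)"
          using C(4) unfolding W_def[symmetric]
          by (rule negligible_subset[OF negligible_Un]) auto
        have "\<exists>a b. a < x \<and> x < b \<and> b - a < d \<and> s * (b - a) < f b - f a"
          if "x \<in> F \<inter> V" "0 < d" for x d
          using covs that FE by blast
        then obtain C' where C': "countable C'"
          "\<And>a b. (a, b) \<in> C' \<Longrightarrow> a < b \<and> s * (b - a) < f b - f a \<and> {a..b} \<subseteq> V"
          "disjoint_family_on (\<lambda>(a, b). {a..b}) C'" "negligible (F \<inter> V - (\<Union>(a, b)\<in>C'. {a..b}))"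
          using Vitali_interval_cover[of V "F \<inter> V" "\<lambda>a b. s * (b - a) < f b - f a", OF Vo] by blast
        define W' where "W' = (\<Union>(a, b)\<in>C'. {a..b})"
        have W'b [measurable]: "W' \<in> sets borel" unfolding W'_def using C'(1) by (intro sets.countable_UN'') auto
        have W'V: "W' \<subseteq> V" using C'(2) unfolding W'_def by fastforce
        have "negligible (F - W')"
          by (rule negligible_subset[OF negligible_Un[OF C'(4) FV]]) (auto simp: W'_def)
        then have "emeasure lborel F \<le> emeasure lborel W'"
          by (intro emeasure_mono_negligible) auto
        then have "ennreal s * emeasure lborel F \<le> ennreal s * emeasure lborel W'"
          by (intro mult_left_mono) auto
        also have "emeasure lborel W' = (\<integral>\<^sup>+i. emeasure lborel (case i of (a, b) \<Rightarrow> {a..b}) \<partial>count_space C')"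
          unfolding W'_def by (rule emeasure_UN_countable) (use C' in auto)
        also have "ennreal s * \<dots> = (\<integral>\<^sup>+i. ennreal s * emeasure lborel (case i of (a, b) \<Rightarrow> {a..b}) \<partial>count_space C')"
          by (subst nn_integral_cmult) auto
        also have "\<dots> \<le> (\<integral>\<^sup>+i. emeasure D (case i of (a, b) \<Rightarrow> {a..b}) \<partial>count_space C')"
        proof (intro nn_integral_mono, clarsimp)
          fix a b assume "(a, b) \<in> C'"
          from C'(2)[OF this] show "ennreal s * emeasure lborel {a..b} \<le> emeasure D {a..b}"
            using True rs by (auto simp: D_Icc ennreal_mult[symmetric] intro!: ennreal_leI)
        qed
        also have "\<dots> = emeasure D W'"
          unfolding W'_def by (rule emeasure_UN_countable[symmetric]) (use C' in auto)
        also have "\<dots> \<le> emeasure D W"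
          using W'V VW by (intro emeasure_mono) auto
        also have "\<dots> = (\<integral>\<^sup>+i. emeasure D (case i of (a, b) \<Rightarrow> {a..b}) \<partial>count_space C)"
          unfolding W_def by (rule emeasure_UN_countable) (use C in auto)
        also have "\<dots> \<le> (\<integral>\<^sup>+i. ennreal r * emeasure lborel (case i of (a, b) \<Rightarrow> {a..b}) \<partial>count_space C)"
        proof (intro nn_integral_mono, clarsimp)
          fix a b assume "(a, b) \<in> C"
          from C(2)[OF this] show "emeasure D {a..b} \<le> ennreal r * emeasure lborel {a..b}"
            using True rs by (auto simp: D_Icc ennreal_mult[symmetric] intro!: ennreal_leI)
        qed
        also have "\<dots> = ennreal r * (\<integral>\<^sup>+i. emeasure lborel (case i of (a, b) \<Rightarrow> {a..b}) \<partial>count_space C)"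
          by (subst nn_integral_cmult) auto
        also have "(\<integral>\<^sup>+i. emeasure lborel (case i of (a, b) \<Rightarrow> {a..b}) \<partial>count_space C) = emeasure lborel W"
          unfolding W_def by (rule emeasure_UN_countable[symmetric]) (use C in auto)
        also have "ennreal r * emeasure lborel W \<le> ennreal r * ennreal (e + \<epsilon>)"
          using WU by (intro mult_left_mono order_trans[OF emeasure_mono Ue]) auto
        finally show ?thesis
          using e True rs \<open>\<epsilon> > 0\<close>
          by (simp add: ennreal_mult[symmetric] ennreal_plus[symmetric] del: ennreal_plus)
      qed
      have "s * e \<le> r * e + \<epsilon>" if "\<epsilon> > 0" for \<epsilon>
        using *[of "\<epsilon> / r"] True that by (simp add: distrib_left)
      then have "s * e \<le> r * e" by (rule field_le_epsilon)
      then have "(s - r) * e \<le> 0" by (simp add: algebra_simps)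
      then have "e = 0" using rs e(2) by (simp add: mult_le_0_iff)
      then show ?thesis using e unfolding F_def by simp
    qed
    have "(\<Union>N. ?E \<inter> {-real N<..<real N}) \<in> null_sets lborel"
      by (intro null_sets_UN null_setsI sets.Int N0) (use Eb in simp_all)
    moreover have "(\<Union>N. ?E \<inter> {-real N<..<real N}) = ?E"
    proof -
      have "\<exists>N. x \<in> {-real N<..<real N}" for x
        using reals_Archimedean2[of "\<bar>x\<bar>"] by (auto simp: abs_less_iff) (smt (verit))
      then show ?thesis by blast
    qed
    ultimately show ?thesis by simp
  qed
qed

lemma mono_nondiff_null:
  assumes "mono f" "continuous_on UNIV f"
  shows "nondiff f \<in> null_sets lborel"
  unfolding nondiff_def
  by (intro null_sets_UN' countable_rat countable_Rats_above) (use steep_oscillation_null[OF assms] in auto)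

text \<open>Let \<open>\<beta>\<close> be the infimum of the slopes \<open>s\<close> for which
  \<open>x\<close> fails to be steep at some scale. Short intervals around \<open>x\<close> then
  have slope at most \<open>\<beta> + e\<close>. For slopes below \<open>\<beta>\<close> the point
  is steep at every scale, so lying outside \<open>nondiff f\<close> bounds the slopes of short
  intervals from below by \<open>\<beta> - e\<close>. Hence \<open>\<beta>\<close> is the
  derivative; the Lipschitz bound keeps it finite.\<close>

lemma not_nondiff_differentiable:
  assumes lip: "L-lipschitz_on UNIV f" and x: "x \<notin> nondiff f"
  shows "f differentiable (at x)"
proof -
  have cont: "isCont f y" for y
    using lipschitz_on_continuous_on[OF lip] by (simp add: continuous_on_eq_continuous_at)
  have L: "\<bar>f y - f z\<bar> \<le> L * \<bar>y - z\<bar>" for y z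
    using lipschitz_onD[OF lip, of y z] by (simp add: dist_real_def)
  define S where "S = {s. \<exists>n::nat. x \<notin> steep f s (1 / Suc n)}"
  have "x \<notin> steep f L 1"
  proof
    assume "x \<in> steep f L 1"
    then obtain a b where "a < x" "x < b" "L * (b - a) < f b - f a"
      unfolding steep_def by blast
    then show False using L[of b a] by auto
  qed
  then have "L \<in> S" unfolding S_def by (auto intro!: exI[of _ 0])
  have low: "-L \<le> s" if "s \<in> S" for s
  proof -
    from that obtain n where n: "x \<notin> steep f s (1 / Suc n)" unfolding S_def by auto
    define d where "d = 1 / (4 * real (Suc n))"
    have d: "d > 0" "2 * d < 1 / Suc n" by (auto simp: d_def field_simps)
    then have "f (x + d) - f (x - d) \<le> s * (2 * d)"
    proof -
      have "\<not> (x - d < x \<and> x < x + d \<and> (x + d) - (x - d) < 1 / Suc n \<and> s * ((x + d) - (x - d)) < f (x + d) - f (x - d))"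
        using n unfolding steep_def by blast
      then show ?thesis using d by simp
    qed
    moreover have "- (L * (2 * d)) \<le> f (x + d) - f (x - d)"
      using L[of "x + d" "x - d"] d by auto
    ultimately have "(- L) * (2 * d) \<le> s * (2 * d)" by linarith
    then show ?thesis using d by (auto simp only: mult_le_cancel_right)
  qed
  define \<beta> where "\<beta> = Inf S"
  have bdd: "bdd_below S" using low by (auto simp: bdd_below_def)
  \<comment> \<open>\<open>steep\<close> only speaks of intervals with \<open>x\<close> in their
    interior, while a difference quotient has \<open>x\<close> as an end point: widen by
    \<open>h\<close> on both sides and let \<open>h\<close> tend to 0.\<close>
  have key: "f b - f a \<le> s * (b - a)"
    if n: "x \<notin> steep f s d" and ab: "a \<le> x" "x \<le> b" "a < b" "b - a < d"
      and cf: "\<And>y. isCont f y" for f :: "real \<Rightarrow> real" and s d a b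
  proof -
    have "\<forall>\<^sub>F h in at_right 0. f (b + h) - f (a - h) \<le> s * (b + h - (a - h))"
    proof -
      have "\<forall>\<^sub>F h in at_right 0. 0 < h \<and> 2 * h < d - (b - a)"
        using ab by (auto simp: eventually_at_right_field intro!: exI[of _ "(d - (b - a)) / 2"])
      then show ?thesis
      proof eventually_elim
        case (elim h)
        then have "a - h < x" "x < b + h" "(b + h) - (a - h) < d" using ab by auto
        then have "\<not> s * ((b + h) - (a - h)) < f (b + h) - f (a - h)"
          using n unfolding steep_def by blast
        then show ?case by simp
      qed
    qed
    moreover have "((\<lambda>h. f (b + h) - f (a - h)) \<longlongrightarrow> f (b + 0) - f (a - 0)) (at_right 0)"
      by (intro tendsto_diff isCont_tendsto_compose[OF cf] tendsto_intros)
    moreover have "((\<lambda>h. s * (b + h - (a - h))) \<longlongrightarrow> s * (b + 0 - (a - 0))) (at_right 0)"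
      by (intro tendsto_intros)
    ultimately show ?thesis
      using tendsto_le[of "at_right (0::real)"] by fastforce
  qed
  have "(f has_field_derivative \<beta>) (at x)"
    unfolding has_field_derivative_def has_derivative_at_within
  proof (intro conjI bounded_linear_mult_right)
    have near: "\<exists>d>0. \<forall>y. \<bar>y - x\<bar> < d \<longrightarrow> \<bar>f y - f x - \<beta> * (y - x)\<bar> \<le> e * \<bar>y - x\<bar>"
      if "e > 0" for e
    proof -
      obtain s where s: "s \<in> S" "s < \<beta> + e"
        using cInf_lessD[of S "\<beta> + e"] \<open>L \<in> S\<close> \<open>e > 0\<close> unfolding \<beta>_def by force
      then obtain n where n: "x \<notin> steep f s (1 / Suc n)" unfolding S_def by auto
      \<comment> \<open>\<open>nondiff\<close> ranges over rational thresholds, hence two rationals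
        strictly between \<open>\<beta> - e\<close> and \<open>\<beta>\<close>.\<close>
      obtain s' where s': "s' \<in> \<rat>" "\<beta> - e < s'" "s' < \<beta>" using Rats_dense_in_real[of "\<beta> - e" \<beta>] \<open>e > 0\<close> by auto
      obtain r where r: "r \<in> \<rat>" "\<beta> - e < r" "r < s'" using Rats_dense_in_real[OF s'(2)] by auto
      have "s' \<notin> S" using s'(3) cInf_lower[OF _ bdd] unfolding \<beta>_def by force
      then have "\<And>n. x \<in> steep f s' (1 / Suc n)" unfolding S_def by auto
      then obtain m where m: "x \<notin> steep (\<lambda>x. - f x) (- r) (1 / Suc m)"
        using x r s' unfolding nondiff_def by (auto simp del: of_nat_Suc) blast
      define d where "d = min (1 / real (Suc n)) (1 / real (Suc m))"
      have up: "f b - f a \<le> s * (b - a)" if "a \<le> x" "x \<le> b" "a < b" "b - a < d" for a b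
        using key[OF n that(1-3) _ cont] that(4) unfolding d_def by auto
      have dn: "r * (b - a) \<le> f b - f a" if "a \<le> x" "x \<le> b" "a < b" "b - a < d" for a b
        using key[OF m that(1-3)] that(4) cont unfolding d_def by auto
      have "\<bar>f y - f x - \<beta> * (y - x)\<bar> \<le> e * \<bar>y - x\<bar>" if "\<bar>y - x\<bar> < d" for y
      proof -
        have *: "\<bar>f b - f a - \<beta> * (b - a)\<bar> \<le> e * (b - a)" if "a \<le> x" "x \<le> b" "a < b" "b - a < d" for a b
        proof -
          have "s * (b - a) \<le> (\<beta> + e) * (b - a)" "(\<beta> - e) * (b - a) \<le> r * (b - a)"
            using s r that by (auto intro!: mult_right_mono)
          then show ?thesis using up[OF that] dn[OF that] by (simp add: algebra_simps abs_le_iff)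
        qed
        consider "y = x" | "y < x" | "x < y" by linarith
        then show ?thesis
        proof cases
          case 2
          then show ?thesis using *[of y x] that by (simp add: abs_if algebra_simps split: if_splits)
        next
          case 3
          then show ?thesis using *[of x y] that by (simp add: abs_if algebra_simps split: if_splits)
        qed simp
      qed
      moreover have "d > 0" by (simp add: d_def)
      ultimately show ?thesis by blast
    qed
    show "((\<lambda>y. (f y - f x - \<beta> * (y - x)) /\<^sub>R norm (y - x)) \<longlongrightarrow> 0) (at x)"
    proof (rule tendstoI)
      fix e :: real assume "e > 0"
      then obtain d where d: "d > 0" "\<And>y. \<bar>y - x\<bar> < d \<Longrightarrow> \<bar>f y - f x - \<beta> * (y - x)\<bar> \<le> (e/2) * \<bar>y - x\<bar>"
        using near[of "e / 2"] by auto
      have "dist ((f y - f x - \<beta> * (y - x)) /\<^sub>R norm (y - x)) 0 < e" if "y \<noteq> x" "dist y x < d" for y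
      proof -
        have "\<bar>f y - f x - \<beta> * (y - x)\<bar> \<le> (e/2) * \<bar>y - x\<bar>" using d that by (auto simp: dist_real_def)
        also have "\<dots> < e * \<bar>y - x\<bar>" using that \<open>e > 0\<close> by auto
        finally show ?thesis using that by (simp add: field_simps abs_mult)
      qed
      then show "\<forall>\<^sub>F y in at x. dist ((f y - f x - \<beta> * (y - x)) /\<^sub>R norm (y - x)) 0 < e"
        unfolding eventually_at using d(1) by blast
    qed
  qed
  then show ?thesis using real_differentiable_def by blast
qed

text \<open>Intervals that shrink to \<open>x\<close> and contain it have slopes converging to the
  derivative \<open>l\<close>. With the margin \<open>e = (s - r) / 2\<close> the two kinds of
  intervals give \<open>s < l + e\<close> and \<open>l - e < r\<close>, a contradiction.\<close>

lemma nondiff_not_differentiable: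
  assumes "x \<in> nondiff f"
  shows "\<not> f differentiable (at x)"
proof
  assume "f differentiable (at x)"
  then obtain l where l: "(f has_field_derivative l) (at x)" using real_differentiable_def by blast
  from assms obtain r s where rs: "r < s" and
    st: "\<And>n. x \<in> steep f s (1 / Suc n)" "\<And>n. x \<in> steep (\<lambda>x. - f x) (- r) (1 / Suc n)"
    unfolding nondiff_def by auto
  define e where "e = (s - r) / 2"
  have e: "e > 0" using rs by (simp add: e_def)
  obtain d where d: "d > 0" "\<And>y. norm (y - x) < d \<Longrightarrow> norm (f y - f x - l * (y - x)) \<le> e * norm (y - x)"
    using l e unfolding has_field_derivative_def has_derivative_at_alt by blast
  obtain n where n: "1 / Suc n < d" using nat_approx_posE[OF d(1)] by metis
  have *: "\<bar>f b - f a - l * (b - a)\<bar> \<le> e * (b - a)" if "a < x" "x < b" "b - a < 1 / Suc n" for a b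
  proof -
    have "\<bar>f b - f x - l * (b - x)\<bar> \<le> e * (b - x)" "\<bar>f a - f x - l * (a - x)\<bar> \<le> e * (x - a)"
      using d(2)[of a] d(2)[of b] that n by auto
    then show ?thesis by (simp add: algebra_simps abs_le_iff)
  qed
  obtain a b where ab: "a < x" "x < b" "b - a < 1 / Suc n" "s * (b - a) < f b - f a"
    using st(1)[of n] unfolding steep_def by auto
  have "s * (b - a) < (l + e) * (b - a)" using *[OF ab(1-3)] ab(4) by (simp add: algebra_simps abs_le_iff)
  then have 1: "s < l + e" using ab by (simp add: mult_less_cancel_right)
  obtain a b where ab: "a < x" "x < b" "b - a < 1 / Suc n" "f b - f a < r * (b - a)"
    using st(2)[of n] unfolding steep_def by auto
  have "(l - e) * (b - a) < r * (b - a)" using *[OF ab(1-3)] ab(4) by (simp add: algebra_simps abs_le_iff)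
  then have "l - e < r" using ab by (simp add: mult_less_cancel_right)
  then show False using 1 by (simp add: e_def field_simps)
qed

text \<open>Adding \<open>L * x\<close> makes the function monotone. The exceptional sets of both
  functions are compared through differentiability and not through slopes, because a shift by
  \<open>L\<close> need not keep thresholds rational.\<close>

theorem lipschitz_nondiff_null:
  assumes lip: "L-lipschitz_on UNIV f"
  shows "nondiff f \<in> null_sets lborel"
proof -
  define g where "g = (\<lambda>x. f x + L * x)"
  have L0: "L \<ge> 0" using lip lipschitz_on_nonneg by blast
  have L: "\<bar>f y - f z\<bar> \<le> L * \<bar>y - z\<bar>" for y z
    using lipschitz_onD[OF lip, of y z] by (simp add: dist_real_def)
  have "mono g"
  proof (rule monoI)
    fix x y :: real assume "x \<le> y"
    then show "g x \<le> g y" using L[of x y] by (simp add: g_def algebra_simps abs_if split: if_splits)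
  qed
  have glip: "(L + L)-lipschitz_on UNIV g"
    unfolding g_def
    by (intro lipschitz_on_add lip)
       (use L0 in \<open>auto simp: lipschitz_on_def dist_real_def abs_mult[symmetric] right_diff_distrib[symmetric] abs_mult\<close>)
  have "nondiff g \<in> null_sets lborel"
    using \<open>mono g\<close> lipschitz_on_continuous_on[OF glip] by (rule mono_nondiff_null)
  moreover have "nondiff f \<subseteq> nondiff g"
  proof
    fix x assume "x \<in> nondiff f"
    then have nd: "\<not> f differentiable (at x)" by (rule nondiff_not_differentiable)
    show "x \<in> nondiff g"
    proof (rule ccontr)
      assume "x \<notin> nondiff g"
      then have "g differentiable (at x)" using glip not_nondiff_differentiable by blast
      then have "(\<lambda>x. g x - L * x) differentiable (at x)" by (intro derivative_intros) auto
      then show False using nd by (simp add: g_def)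
    qed
  qed
  ultimately show ?thesis using null_sets_subset[of "nondiff g" lborel "nondiff f"] by auto
qed

text \<open>\<open>deriv\<close> is a choice from the empty predicate, hence one fixed constant, wherever the
  derivative does not exist.\<close>

lemma borel_measurable_deriv_lipschitz:
  fixes f :: "real \<Rightarrow> real"
  assumes lip: "L-lipschitz_on UNIV f"
  shows "deriv f \<in> borel_measurable borel"
proof -
  have [measurable]: "f \<in> borel_measurable borel"
    using lipschitz_on_continuous_on[OF lip] by (rule borel_measurable_continuous_onI)
  define c where "c = (SOME D::real. False)"
  define g where "g k x = (if x \<in> nondiff f then c else real (Suc k) * (f (x + 1 / real (Suc k)) - f x))" for k x
  show ?thesis
  proof (rule borel_measurable_LIMSEQ_real)
    show "g k \<in> borel_measurable borel" for k unfolding g_def by measurable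
    fix x :: real
    show "(\<lambda>k. g k x) \<longlonglongrightarrow> deriv f x"
    proof (cases "x \<in> nondiff f")
      case True
      then have "\<not> (f has_field_derivative D) (at x)" for D
        using nondiff_not_differentiable real_differentiable_def by blast
      then have "deriv f x = c" unfolding deriv_def c_def by simp
      then show ?thesis using True by (simp add: g_def)
    next
      case False
      then have "(f has_field_derivative deriv f x) (at x)"
        using not_nondiff_differentiable[OF lip] DERIV_deriv_iff_real_differentiable by blast
      then have "((\<lambda>h. (f (x + h) - f x) / h) \<longlongrightarrow> deriv f x) (at 0)"
        by (simp add: has_field_derivative_def field_has_derivative_at DERIV_def)
      then have "(\<lambda>k. (f (x + 1 / real (Suc k)) - f x) / (1 / real (Suc k))) \<longlonglongrightarrow> deriv f x"
        by (rule filterlim_compose)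
           (use LIMSEQ_Suc[OF lim_1_over_n[where 'a=real]] in \<open>auto simp: filterlim_at\<close>)
      then show ?thesis using False by (simp add: g_def mult.commute)
    qed
  qed
qed

section \<open>Smooth test functions\<close>

text \<open>\<open>smooth_fun\<close> constrains all iterated derivatives, so closure under products
  would call for a Leibniz formula. A class given by generators and closed under a single
  differentiation avoids it, and turns out to be \<open>smooth_fun\<close> itself.\<close>

inductive smooth_alg :: "(real \<Rightarrow> real) \<Rightarrow> bool" where
  smooth: "smooth_fun f \<Longrightarrow> smooth_alg f"
| const: "smooth_alg (\<lambda>x. c)"
| ident: "smooth_alg (\<lambda>x. x)"
| add: "smooth_alg f \<Longrightarrow> smooth_alg g \<Longrightarrow> smooth_alg (\<lambda>x. f x + g x)"
| mult: "smooth_alg f \<Longrightarrow> smooth_alg g \<Longrightarrow> smooth_alg (\<lambda>x. f x * g x)"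
| affine: "smooth_alg f \<Longrightarrow> smooth_alg (\<lambda>x. f (a * x + b))"

lemma smooth_fun_DERIV: "smooth_fun f \<Longrightarrow> (f has_real_derivative deriv f x) (at x)"
  unfolding smooth_fun_def
  by (drule spec[of _ 0]) (auto simp: DERIV_deriv_iff_real_differentiable)

lemma smooth_fun_deriv: "smooth_fun f \<Longrightarrow> smooth_fun (deriv f)"
  unfolding smooth_fun_def by (metis comp_apply funpow_Suc_right)

lemma smooth_fun_continuous: "smooth_fun f \<Longrightarrow> continuous_on S f"
  by (meson DERIV_isCont continuous_at_imp_continuous_on smooth_fun_DERIV)

lemma smooth_alg_DERIV:
  assumes "smooth_alg f"
  shows "\<exists>f'. smooth_alg f' \<and> (\<forall>x. (f has_real_derivative f' x) (at x))"
  using assms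
proof induction
  case (smooth f)
  then show ?case using smooth_fun_DERIV smooth_fun_deriv smooth_alg.smooth by blast
next
  case (const c)
  show ?case by (intro exI[of _ "\<lambda>x. 0"]) (auto intro: smooth_alg.const)
next
  case ident
  show ?case by (intro exI[of _ "\<lambda>x. 1"]) (auto intro: smooth_alg.const)
next
  case (add f g)
  then obtain f' g' where "smooth_alg f'" "\<And>x. (f has_real_derivative f' x) (at x)"
    "smooth_alg g'" "\<And>x. (g has_real_derivative g' x) (at x)" by blast
  then show ?case
    by (intro exI[of _ "\<lambda>x. f' x + g' x"]) (auto intro: smooth_alg.add DERIV_add)
next
  case (mult f g)
  then obtain f' g' where "smooth_alg f'" "\<And>x. (f has_real_derivative f' x) (at x)"
    "smooth_alg g'" "\<And>x. (g has_real_derivative g' x) (at x)" by blast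
  with mult show ?case
    by (intro exI[of _ "\<lambda>x. f' x * g x + g' x * f x"]) (auto intro: smooth_alg.add smooth_alg.mult DERIV_mult)
next
  case (affine f a b)
  then obtain f' where f': "smooth_alg f'" "\<And>x. (f has_real_derivative f' x) (at x)" by blast
  have "((\<lambda>x. f (a * x + b)) has_real_derivative f' (a * x + b) * a) (at x)" for x
    by (rule DERIV_chain2[OF f'(2)]) (auto intro!: derivative_eq_intros)
  with f' show ?case
    by (intro exI[of _ "\<lambda>x. f' (a * x + b) * a"]) (auto intro: smooth_alg.intros)
qed

lemma smooth_alg_smooth_fun:
  assumes "smooth_alg f"
  shows "smooth_fun f"
proof -
  have "smooth_alg ((deriv ^^ k) f)" for k
  proof (induction k)
    case (Suc k)
    then obtain g where g: "smooth_alg g" "\<And>x. ((deriv ^^ k) f has_real_derivative g x) (at x)"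
      using smooth_alg_DERIV by blast
    have "deriv ((deriv ^^ k) f) = g" using DERIV_imp_deriv[OF g(2)] by auto
    then show ?case using g by simp
  qed (use assms in simp)
  then show ?thesis
    unfolding smooth_fun_def using smooth_alg_DERIV real_differentiable_def by blast
qed

lemma smooth_fun_iff: "smooth_fun f \<longleftrightarrow> smooth_alg f"
  using smooth_alg_smooth_fun smooth_alg.smooth by blast

lemma smooth_alg_sum: "(\<And>i. i \<in> A \<Longrightarrow> smooth_alg (f i)) \<Longrightarrow> smooth_alg (\<lambda>x. \<Sum>i\<in>A. f i x)"
  by (induction A rule: infinite_finite_induct) (auto intro: smooth_alg.intros)

lemma smooth_alg_power: "smooth_alg (\<lambda>x. x ^ k)"
  by (induction k) (auto intro: smooth_alg.intros)

text \<open>Products of smooth functions of one variable form a family closed under both partial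
  derivatives, which is the witness that \<open>smooth2\<close> asks for.\<close>

lemma smooth2_prod:
  assumes "smooth_fun a" "smooth_fun b"
  shows "smooth2 (\<lambda>t x. a t * b x)"
  unfolding smooth2_def
proof (intro exI[of _ "{\<lambda>t x. a t * b x |a b. smooth_fun a \<and> smooth_fun b}"] conjI ballI)
  fix \<psi> :: "real \<Rightarrow> real \<Rightarrow> real" assume "\<psi> \<in> {\<lambda>t x. a t * b x |a b. smooth_fun a \<and> smooth_fun b}"
  then obtain a b where ab: "\<psi> = (\<lambda>t x. a t * b x)" "smooth_fun a" "smooth_fun b" by blast
  have "continuous_on UNIV (\<lambda>p. a (fst p))" "continuous_on UNIV (\<lambda>p. b (snd p))"
    by (rule continuous_on_compose2[OF smooth_fun_continuous[OF ab(2), of UNIV] continuous_on_fst[OF continuous_on_id]],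
        simp, rule continuous_on_compose2[OF smooth_fun_continuous[OF ab(3), of UNIV] continuous_on_snd[OF continuous_on_id]], simp)
  then show "continuous_on UNIV (\<lambda>(t, x). \<psi> t x)"
    unfolding ab(1) case_prod_unfold by (intro continuous_intros)
  show "\<exists>\<psi>t\<in>{\<lambda>t x. a t * b x |a b. smooth_fun a \<and> smooth_fun b}.
      \<forall>t x. ((\<lambda>s. \<psi> s x) has_real_derivative \<psi>t t x) (at t)"
    using ab smooth_fun_deriv[OF ab(2)]
    by (intro bexI[of _ "\<lambda>t x. deriv a t * b x"])
       (auto intro!: DERIV_cmult_right smooth_fun_DERIV)
  show "\<exists>\<psi>x\<in>{\<lambda>t x. a t * b x |a b. smooth_fun a \<and> smooth_fun b}.
      \<forall>t x. ((\<lambda>y. \<psi> t y) has_real_derivative \<psi>x t x) (at x)"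
    using ab smooth_fun_deriv[OF ab(3)]
    by (intro bexI[of _ "\<lambda>t x. a t * deriv b x"])
       (auto intro!: DERIV_cmult smooth_fun_DERIV)
qed (use assms in blast)

lemma continuous_Icc_bounded:
  fixes f :: "real \<Rightarrow> real"
  assumes "continuous_on {a..b} f"
  obtains B where "B > 0" "\<And>x. a \<le> x \<Longrightarrow> x \<le> b \<Longrightarrow> \<bar>f x\<bar> \<le> B"
proof -
  have "bounded (f ` {a..b})"
    using assms by (intro compact_imp_bounded compact_continuous_image) auto
  then obtain B where "B > 0" "\<forall>y\<in>f ` {a..b}. norm y \<le> B" unfolding bounded_pos by blast
  then show thesis using that[of B] by auto
qed

section \<open>Cutoffs, mollification and approximation by test functions\<close>

locale cutoffs =
  fixes \<psi>p \<psi>m :: "real \<Rightarrow> real"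
  assumes psi: "cutoff_pair \<psi>p \<psi>m"
begin

lemma psi_range: "0 \<le> \<psi>p x" "\<psi>p x \<le> 1" "0 \<le> \<psi>m x" "\<psi>m x \<le> 1"
  using psi by (auto simp: cutoff_pair_def)

lemma psi_left: "x \<le> -1 \<Longrightarrow> \<psi>p x = 0"
  using psi closure_subset[of "{x. \<psi>p x \<noteq> 0}"] by (force simp: cutoff_pair_def)

lemma psim_right: "x \<ge> 1 \<Longrightarrow> \<psi>m x = 0"
  using psi closure_subset[of "{x. \<psi>m x \<noteq> 0}"] by (force simp: cutoff_pair_def)

lemma psi_sum: "\<psi>p x + \<psi>m x = 1"
  using psi by (auto simp: cutoff_pair_def)

lemma psi_right: "x \<ge> 1 \<Longrightarrow> \<psi>p x = 1"
  using psi_sum[of x] psim_right by simp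

lemma psim_left: "x \<le> -1 \<Longrightarrow> \<psi>m x = 1"
  using psi_sum[of x] psi_left by simp

lemma psi_smooth: "smooth_fun \<psi>p" "smooth_fun \<psi>m"
  using psi by (auto simp: cutoff_pair_def)

lemma deriv_psi_0:
  assumes "\<bar>x\<bar> > 1"
  shows "deriv \<psi>p x = 0"
proof (cases "x > 1")
  case True
  have "(\<psi>p has_field_derivative 0) (at x)"
    by (rule has_field_derivative_transform_within_open[of "\<lambda>_. 1" _ _ "{1<..}"])
       (use True psi_right in auto)
  then show ?thesis by (rule DERIV_imp_deriv)
next
  case False
  have "(\<psi>p has_field_derivative 0) (at x)"
    by (rule has_field_derivative_transform_within_open[of "\<lambda>_. 0" _ _ "{..<-1}"])
       (use False assms psi_left in auto)
  then show ?thesis by (rule DERIV_imp_deriv)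
qed

lemma deriv_psim: "deriv \<psi>m x = - deriv \<psi>p x"
proof (rule DERIV_imp_deriv)
  have "\<psi>m = (\<lambda>x. 1 - \<psi>p x)" using psi_sum by (auto simp: algebra_simps)
  then show "(\<psi>m has_real_derivative - deriv \<psi>p x) (at x)"
    by (auto intro!: derivative_eq_intros smooth_fun_DERIV psi_smooth)
qed

lemma deriv_psi_bounded: obtains B where "B > 0" "\<And>x. \<bar>deriv \<psi>p x\<bar> \<le> B"
proof -
  obtain B where B: "B > 0" "\<And>x. -1 \<le> x \<Longrightarrow> x \<le> 1 \<Longrightarrow> \<bar>deriv \<psi>p x\<bar> \<le> B"
    by (rule continuous_Icc_bounded[of "-1" 1 "deriv \<psi>p"])
       (use smooth_fun_continuous smooth_fun_deriv psi_smooth in auto)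
  have "\<bar>deriv \<psi>p x\<bar> \<le> B" for x
    using B deriv_psi_0[of x] by (cases "\<bar>x\<bar> > 1") (auto simp: abs_le_iff)
  with B show thesis using that by blast
qed

lemma integral_deriv_psi: "(\<integral>x. deriv \<psi>p x * c \<partial>lborel) = c"
proof -
  have "(\<integral>x. deriv \<psi>p x * indicator {-1..1} x \<partial>lborel) = \<psi>p 1 - \<psi>p (-1)"
    by (rule integral_FTC_Icc_real)
       (auto intro: smooth_fun_DERIV psi_smooth DERIV_isCont smooth_fun_deriv)
  moreover have "(\<lambda>x. deriv \<psi>p x * indicator {-1..1} x) = deriv \<psi>p"
    using deriv_psi_0 by (force simp: indicator_def abs_le_iff not_less)
  ultimately have "(\<integral>x. deriv \<psi>p x \<partial>lborel) = 1"
    using psi_left[of "-1"] psi_right[of 1] by simp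
  then show ?thesis by simp
qed

text \<open>\<open>deriv \<psi>p\<close> has integral 1 and vanishes off \<open>[-1, 1]\<close>, so
  its rescalings are an approximate identity. It may change sign, but dominated convergence only
  asks for a bound.\<close>

lemma mollified_step:
  fixes m :: "real \<Rightarrow> real"
  assumes m: "continuous_on UNIV m"
  shows "(\<lambda>j. \<integral>r. deriv \<psi>p (real (Suc j) * r + - (real (Suc j) * s)) * real (Suc j) * m r \<partial>lborel) \<longlonglongrightarrow> m s"
proof -
  obtain B where B: "B > 0" "\<And>x. \<bar>deriv \<psi>p x\<bar> \<le> B" by (rule deriv_psi_bounded) blast
  obtain A where A: "A > 0" "\<And>x. s - 1 \<le> x \<Longrightarrow> x \<le> s + 1 \<Longrightarrow> \<bar>m x\<bar> \<le> A"
    by (rule continuous_Icc_bounded[of "s - 1" "s + 1" m]) (use continuous_on_subset[OF m] in auto)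
  have [measurable]: "deriv \<psi>p \<in> borel_measurable borel" "m \<in> borel_measurable borel"
    by (auto intro!: borel_measurable_continuous_onI m smooth_fun_continuous smooth_fun_deriv psi_smooth)
  have eq: "(\<integral>r. deriv \<psi>p (real (Suc j) * r + - (real (Suc j) * s)) * real (Suc j) * m r \<partial>lborel) =
      (\<integral>x. deriv \<psi>p x * m (s + x / real (Suc j)) \<partial>lborel)" for j
    by (subst lborel_integral_real_affine[where c = "1 / real (Suc j)" and t = s])
       (auto simp: distrib_left integral_mult_right_zero[symmetric] simp del: of_nat_Suc)
  have "(\<lambda>j. \<integral>x. deriv \<psi>p x * m (s + x / real (Suc j)) \<partial>lborel) \<longlonglongrightarrow> (\<integral>x. deriv \<psi>p x * m s \<partial>lborel)"
  proof (rule integral_dominated_convergence[where w = "\<lambda>x. indicator {-1..1} x * (B * A)"])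
    show "integrable lborel (\<lambda>x. indicator {-1..1::real} x * (B * A))"
      by (intro integrable_real_mult_indicator[simplified mult.commute] integrable_mult_left) auto
    show "AE x in lborel. (\<lambda>j. deriv \<psi>p x * m (s + x / real (Suc j))) \<longlonglongrightarrow> deriv \<psi>p x * m s"
    proof (rule AE_I2)
      fix x
      have "(\<lambda>j. s + x / real (Suc j)) \<longlonglongrightarrow> s + 0"
        by (intro tendsto_add tendsto_const LIMSEQ_Suc[OF lim_const_over_n])
      then have "(\<lambda>j. m (s + x / real (Suc j))) \<longlonglongrightarrow> m s"
        using m by (intro isCont_tendsto_compose[of _ m]) (auto simp: continuous_on_eq_continuous_at)
      then show "(\<lambda>j. deriv \<psi>p x * m (s + x / real (Suc j))) \<longlonglongrightarrow> deriv \<psi>p x * m s"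
        by (intro tendsto_intros)
    qed
    show "AE x in lborel. norm (deriv \<psi>p x * m (s + x / real (Suc j))) \<le> indicator {-1..1} x * (B * A)" for j
    proof (rule AE_I2)
      fix x :: real
      show "norm (deriv \<psi>p x * m (s + x / real (Suc j))) \<le> indicator {-1..1} x * (B * A)"
      proof (cases "\<bar>x\<bar> \<le> 1")
        case True
        then have "\<bar>x\<bar> / real (Suc j) \<le> 1" by (simp add: divide_le_eq)
        then have "\<bar>x / real (Suc j)\<bar> \<le> 1" by (simp add: abs_divide)
        then have "\<bar>m (s + x / real (Suc j))\<bar> \<le> A" by (intro A; linarith)
        then have "\<bar>deriv \<psi>p x\<bar> * \<bar>m (s + x / real (Suc j))\<bar> \<le> B * A"
          using B by (intro mult_mono) auto
        then show ?thesis using True by (simp add: abs_mult indicator_def abs_le_iff)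
      next
        case False
        then show ?thesis using A B by (simp add: deriv_psi_0)
      qed
    qed
  qed (auto simp: borel_measurable_continuous_onI)
  then show ?thesis unfolding eq integral_deriv_psi .
qed

text \<open>The weak equation speaks of compactly supported smooth functions, while constants, the
  kernel and arctan profiles have to be tested. A polynomial close to \<open>f'\<close> is
  integrated from the value \<open>f 0\<close> and cut off. The bounds on \<open>g\<close> and
  \<open>deriv g\<close> do not depend on \<open>k\<close>, as dominated convergence
  demands.\<close>

lemma C1_approx:
  fixes f f' :: "real \<Rightarrow> real"
  assumes f: "\<And>x. (f has_real_derivative f' x) (at x)" and f'c: "continuous_on UNIV f'"
    and fb: "\<And>x. \<bar>f x\<bar> \<le> A" and f'b: "\<And>x. \<bar>f' x\<bar> \<le> A'"
    and B: "B > 0" "\<And>x. \<bar>deriv \<psi>p x\<bar> \<le> B"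
  shows "\<exists>g. test_fun g \<and> (\<forall>x. \<bar>g x\<bar> \<le> A + 1) \<and> (\<forall>x. \<bar>deriv g x\<bar> \<le> A' + 1 + (A + 1) * (2 * B)) \<and>
     (\<forall>x. \<bar>x\<bar> \<le> real k \<longrightarrow> \<bar>g x - f x\<bar> \<le> 1 / Suc k \<and> \<bar>deriv g x - f' x\<bar> \<le> 1 / Suc k)"
proof -
  \<comment> \<open>With this radius the cutoff \<open>c\<close> is 1 with vanishing derivative on
    \<open>[-k, k]\<close>, where \<open>deriv_psi_0\<close> asks for a strict inequality, and it is
    0 beyond \<open>R + 1\<close>.\<close>
  define R where "R = real k + 2"
  \<comment> \<open>The factor \<open>R + 2\<close> absorbs the length \<open>R + 1\<close> over
    which the error of \<open>q\<close> is integrated.\<close>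
  define e where "e = 1 / real (Suc k) / (R + 2)"
  have R: "R \<ge> 2" by (simp add: R_def)
  have e: "e > 0" using R by (auto simp: e_def intro!: divide_pos_pos mult_pos_pos)
  have "e * (R + 2) = 1 / Suc k" using R by (simp add: e_def)
  moreover have "e * (R + 1) \<le> e * (R + 2)" "e * 1 \<le> e * (R + 2)"
    using e R by (intro mult_left_mono; simp)+
  ultimately have eR: "e * (R + 1) \<le> 1 / Suc k" "e \<le> 1 / Suc k" by simp_all
  obtain q where q: "real_polynomial_function q" "\<And>x. x \<in> {-(R+1)..R+1} \<Longrightarrow> \<bar>f' x - q x\<bar> < e"
    using Stone_Weierstrass_real_polynomial_function[of "{-(R+1)..R+1}" f' e]
      continuous_on_subset[OF f'c] e by auto
  then obtain a n where qa: "q = (\<lambda>x. \<Sum>i\<le>n. a i * x ^ i)"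
    using real_polynomial_function_iff_sum[of q] by auto
  define Q where "Q x = f 0 + (\<Sum>i\<le>n. a i / real (Suc i) * x ^ Suc i)" for x
  have Q': "(Q has_real_derivative q x) (at x)" for x
  proof -
    have "((\<lambda>x. a i / real (Suc i) * x ^ Suc i) has_real_derivative a i / real (Suc i) * (real (Suc i) * x ^ i)) (at x)" for i
      using DERIV_pow[of "Suc i" x] by (intro DERIV_cmult) simp
    then have "(Q has_real_derivative 0 + (\<Sum>i\<le>n. a i / real (Suc i) * (real (Suc i) * x ^ i))) (at x)"
      unfolding Q_def[abs_def] by (intro DERIV_add DERIV_const DERIV_sum)
    then show ?thesis unfolding qa by (simp del: of_nat_Suc)
  qed
  have Qs: "smooth_alg Q"
    unfolding Q_def[abs_def]
    by (intro smooth_alg.add smooth_alg_sum smooth_alg.mult smooth_alg_power smooth_alg.const)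
  have Qf: "\<bar>Q x - f x\<bar> \<le> 1 / Suc k" if x: "\<bar>x\<bar> \<le> R + 1" for x
  proof -
    have "norm ((\<lambda>x. Q x - f x) x - (\<lambda>x. Q x - f x) 0) \<le> e * norm (x - 0)"
    proof (rule field_differentiable_bound[of "{-(R+1)..R+1}"])
      fix z assume z: "z \<in> {-(R+1)..R+1}"
      show "((\<lambda>x. Q x - f x) has_field_derivative q z - f' z) (at z within {- (R + 1)..R + 1})"
        using Q' f by (auto intro!: DERIV_diff intro: has_field_derivative_at_within)
      show "norm (q z - f' z) \<le> e" using q(2)[OF z] by auto
    qed (use x R in auto)
    also have "\<dots> \<le> e * (R + 1)" using x e by (intro mult_left_mono) auto
    finally show ?thesis using eR by (simp add: Q_def)
  qed
  define c where "c x = \<psi>p (1 * x + R) * \<psi>m (1 * x + - R)" for x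
  define c' where "c' x = deriv \<psi>p (1 * x + R) * \<psi>m (1 * x + - R) - \<psi>p (1 * x + R) * deriv \<psi>p (1 * x + - R)" for x
  have cs: "smooth_alg c" unfolding c_def[abs_def] by (intro smooth_alg.mult smooth_alg.affine smooth_alg.smooth psi_smooth)
  have cD: "(c has_real_derivative c' x) (at x)" for x
    unfolding c_def[abs_def] c'_def
    by (auto intro!: derivative_eq_intros DERIV_chain2[OF smooth_fun_DERIV] psi_smooth simp: deriv_psim)
  have c01: "0 \<le> c x" "c x \<le> 1" for x
    unfolding c_def using psi_range by (auto intro: mult_le_one)
  have c0: "c x = 0" "c' x = 0" if "\<bar>x\<bar> > R + 1" for x
    using that R by (auto simp: c_def c'_def abs_if psi_left psim_right deriv_psi_0 split: if_splits)
  have c1: "c x = 1" "c' x = 0" if "\<bar>x\<bar> \<le> real k" for x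
    using that by (auto simp: c_def c'_def R_def psi_right psim_left deriv_psi_0 abs_le_iff)
  have c'b: "\<bar>c' x\<bar> \<le> 2 * B" for x
  proof -
    have "\<bar>c' x\<bar> \<le> \<bar>deriv \<psi>p (1 * x + R) * \<psi>m (1 * x + - R)\<bar> + \<bar>\<psi>p (1 * x + R) * deriv \<psi>p (1 * x + - R)\<bar>"
      unfolding c'_def by (rule abs_triangle_ineq4)
    also have "\<dots> \<le> B * 1 + 1 * B"
      unfolding abs_mult using B psi_range by (intro add_mono mult_mono) auto
    finally show ?thesis by simp
  qed
  define g where "g x = Q x * c x" for x
  have gs: "smooth_fun g"
    unfolding smooth_fun_iff g_def[abs_def] by (intro smooth_alg.mult Qs cs)
  have g': "deriv g x = q x * c x + Q x * c' x" for x
    unfolding g_def[abs_def]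
    by (rule DERIV_imp_deriv) (auto intro!: derivative_eq_intros Q' cD)
  have k1: "1 / real (Suc k) \<le> 1" by simp
  have QA: "\<bar>Q x\<bar> \<le> A + 1" if "\<bar>x\<bar> \<le> R + 1" for x
    using Qf[OF that] fb[of x] k1 by linarith
  have qA: "\<bar>q x\<bar> \<le> A' + 1" if "\<bar>x\<bar> \<le> R + 1" for x
  proof -
    have "\<bar>f' x - q x\<bar> < e" using that by (intro q) (auto simp: abs_le_iff)
    then show ?thesis using f'b[of x] k1 eR(2) by linarith
  qed
  have A: "A \<ge> 0" "A' \<ge> 0" using fb[of 0] f'b[of 0] by auto
  show ?thesis
  proof (intro exI[of _ g] conjI allI impI)
    have "{x. g x \<noteq> 0} \<subseteq> {-(R+1)..R+1}" using c0 by (force simp: g_def abs_le_iff not_less)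
    then show "test_fun g" using gs bounded_subset[OF bounded_closed_interval] by (auto simp: test_fun_def)
    show "\<bar>g x\<bar> \<le> A + 1" for x
    proof (cases "\<bar>x\<bar> \<le> R + 1")
      case True
      have "\<bar>Q x\<bar> * \<bar>c x\<bar> \<le> (A + 1) * 1" using QA[OF True] c01[of x] by (intro mult_mono) auto
      then show ?thesis by (simp add: g_def abs_mult)
    qed (use c0 A in \<open>auto simp: g_def\<close>)
    show "\<bar>deriv g x\<bar> \<le> A' + 1 + (A + 1) * (2 * B)" for x
    proof (cases "\<bar>x\<bar> \<le> R + 1")
      case True
      have "\<bar>q x * c x + Q x * c' x\<bar> \<le> \<bar>q x\<bar> * \<bar>c x\<bar> + \<bar>Q x\<bar> * \<bar>c' x\<bar>"
        by (metis abs_mult abs_triangle_ineq)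
      also have "\<dots> \<le> (A' + 1) * 1 + (A + 1) * (2 * B)"
        using QA[OF True] qA[OF True] c01[of x] c'b[of x] A by (intro add_mono mult_mono) auto
      finally show ?thesis by (simp add: g')
    qed (use c0 A B in \<open>auto simp: g'\<close>)
    fix x assume x: "\<bar>x\<bar> \<le> real k"
    show "\<bar>g x - f x\<bar> \<le> 1 / real (Suc k)" using Qf[of x] x c1[OF x] by (auto simp: g_def R_def)
    show "\<bar>deriv g x - f' x\<bar> \<le> 1 / real (Suc k)"
      using q(2)[of x] x c1[OF x] eR by (auto simp: g' R_def abs_le_iff)
  qed
qed

end

section \<open>Transport of the measures\<close>

lemma finite_measure_integrable_bounded:
  fixes f :: "'a \<Rightarrow> real"
  assumes "finite_measure M" "f \<in> borel_measurable M" "\<And>x. \<bar>f x\<bar> \<le> B"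
  shows "integrable M f"
  using assms by (intro finite_measure.integrable_const_bound[where B = B]) auto

lemma finite_measure_integral_bound:
  fixes f :: "'a \<Rightarrow> real"
  assumes "finite_measure M" "f \<in> borel_measurable M" "\<And>x. \<bar>f x\<bar> \<le> B"
  shows "\<bar>\<integral>x. f x \<partial>M\<bar> \<le> B * measure M (space M)"
proof -
  interpret finite_measure M by fact
  have i: "integrable M f" by (rule finite_measure_integrable_bounded[OF assms])
  have "\<bar>\<integral>x. f x \<partial>M\<bar> \<le> (\<integral>x. \<bar>f x\<bar> \<partial>M)" by (rule integral_abs_bound)
  also have "\<dots> \<le> (\<integral>x. B \<partial>M)" using i assms(3) by (intro integral_mono) auto
  finally show ?thesis by (simp add: mult.commute)
qed

text \<open>What the transport argument takes from a solution: continuity of \<open>u\<close> in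
  space, a bound on every time strip, continuity in time that is uniform in space, and weak
  continuity of the measures.\<close>

locale weak_flow =
  fixes u :: "real \<Rightarrow> real \<Rightarrow> real" and \<mu> :: "real \<Rightarrow> real measure"
  assumes sets_mu: "0 \<le> t \<Longrightarrow> sets (\<mu> t) = sets borel"
    and finite_mu: "0 \<le> t \<Longrightarrow> finite_measure (\<mu> t)"
    and weak_cont: "\<And>f :: real \<Rightarrow> real. continuous_on UNIV f \<Longrightarrow> bounded (range f) \<Longrightarrow> continuous_on {0..} (\<lambda>t. \<integral>x. f x \<partial>\<mu> t)"
    and u_cont: "0 \<le> t \<Longrightarrow> continuous_on UNIV (u t)"
    and u_bdd: "\<exists>M\<ge>0. \<forall>t\<in>{0..T}. \<forall>x. \<bar>u t x\<bar> \<le> M"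
    and u_time: "0 \<le> t \<Longrightarrow> 0 < e \<Longrightarrow> \<exists>d>0. \<forall>s\<ge>0. \<bar>s - t\<bar> < d \<longrightarrow> (\<forall>x. \<bar>u s x - u t x\<bar> \<le> e)"
begin

lemma u_bdd_at:
  assumes "0 \<le> t"
  obtains M where "\<And>x. \<bar>u t x\<bar> \<le> M"
  using u_bdd[of t] assms by (meson atLeastAtMost_iff order_refl)

lemma space_mu [simp]: "0 \<le> t \<Longrightarrow> space (\<mu> t) = UNIV"
  using sets_eq_imp_space_eq[OF sets_mu] by simp

lemma meas_mu: "0 \<le> t \<Longrightarrow> f \<in> borel_measurable borel \<Longrightarrow> f \<in> borel_measurable (\<mu> t)"
  using measurable_cong_sets[OF sets_mu refl] by blast

lemma integrable_mu:
  fixes f :: "real \<Rightarrow> real"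
  assumes "0 \<le> t" "f \<in> borel_measurable borel" "\<And>x. \<bar>f x\<bar> \<le> B"
  shows "integrable (\<mu> t) f"
  using assms by (intro finite_measure_integrable_bounded[of _ _ B] finite_mu meas_mu) auto

lemma mass_cont: "continuous_on {0..} (\<lambda>t. measure (\<mu> t) UNIV)"
proof -
  have "continuous_on {0..} (\<lambda>t. \<integral>x. (1::real) \<partial>\<mu> t)" by (intro weak_cont) auto
  then show ?thesis by (rule continuous_on_cong[THEN iffD1, rotated -1]) auto
qed

lemma integral_mu_bound:
  fixes f :: "real \<Rightarrow> real"
  assumes "0 \<le> t" "f \<in> borel_measurable borel" "\<And>x. \<bar>f x\<bar> \<le> B"
  shows "\<bar>\<integral>x. f x \<partial>\<mu> t\<bar> \<le> B * measure (\<mu> t) UNIV"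
  using finite_measure_integral_bound[OF finite_mu meas_mu, of t f B] assms by simp

text \<open>Integrand and measure move at once. Freezing \<open>u\<close> at time \<open>t\<close>
  leaves a fixed bounded continuous function, for which weak continuity applies; the error is at
  most the uniform distance of \<open>u s\<close> and \<open>u t\<close> times \<open>B\<close> and
  the mass.\<close>

lemma flux_cont:
  fixes g :: "real \<Rightarrow> real"
  assumes g: "continuous_on UNIV g" "\<And>x. \<bar>g x\<bar> \<le> B"
  shows "continuous_on {0..} (\<lambda>t. \<integral>x. u t x * g x \<partial>\<mu> t)"
  unfolding continuous_on_def
proof (intro ballI)
  fix t :: real assume "t \<in> {0..}"
  then have t: "0 \<le> t" by simp
  have B: "B \<ge> 0" using g(2)[of 0] by auto
  have [measurable]: "g \<in> borel_measurable borel" "\<And>s. 0 \<le> s \<Longrightarrow> u s \<in> borel_measurable borel"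
    by (auto intro!: borel_measurable_continuous_onI g u_cont)
  obtain M where M: "\<And>x. \<bar>u t x\<bar> \<le> M" by (rule u_bdd_at[OF t]) blast
  have ugb: "bounded (range (\<lambda>x. u t x * g x))"
    by (rule boundedI[of _ "M * B"]) (use M g(2) in \<open>auto simp: abs_mult intro!: mult_mono order_trans[OF abs_ge_zero M]\<close>)
  have 1: "((\<lambda>s. \<integral>x. u t x * g x \<partial>\<mu> s) \<longlongrightarrow> (\<integral>x. u t x * g x \<partial>\<mu> t)) (at t within {0..})"
  proof -
    have "continuous_on UNIV (\<lambda>x. u t x * g x)" using t g by (intro continuous_on_mult u_cont)
    from weak_cont[OF this ugb] show ?thesis using t by (auto simp: continuous_on_def)
  qed
  have 2: "((\<lambda>s. (\<integral>x. u s x * g x \<partial>\<mu> s) - (\<integral>x. u t x * g x \<partial>\<mu> s)) \<longlongrightarrow> 0) (at t within {0..})"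
  proof (rule tendstoI)
    fix e :: real assume e: "e > 0"
    define m where "m = measure (\<mu> t) UNIV"
    have m: "m \<ge> 0" by (simp add: m_def)
    have ml: "\<forall>\<^sub>F s in at t within {0..}. measure (\<mu> s) UNIV < m + 1"
      using mass_cont t unfolding continuous_on_def m_def by (intro order_tendstoD) auto
    \<comment> \<open>The summands 1 guard against \<open>B = 0\<close> and
      \<open>m = 0\<close>.\<close>
    define e' where "e' = e / 2 / ((B + 1) * (m + 1))"
    have e': "e' > 0" using e B m by (simp add: e'_def)
    obtain d where d: "d > 0" "\<And>s x. 0 \<le> s \<Longrightarrow> \<bar>s - t\<bar> < d \<Longrightarrow> \<bar>u s x - u t x\<bar> \<le> e'"
      using u_time[OF t e'] by blast
    have "\<forall>\<^sub>F s in at t within {0..}. s \<in> {0..} \<and> \<bar>s - t\<bar> < d"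
      unfolding eventually_at using d(1) by (intro exI[of _ d]) (auto simp: dist_real_def)
    with ml show "\<forall>\<^sub>F s in at t within {0..}. dist ((\<integral>x. u s x * g x \<partial>\<mu> s) - (\<integral>x. u t x * g x \<partial>\<mu> s)) 0 < e"
    proof eventually_elim
      case (elim s)
      then have s: "0 \<le> s" by simp
      obtain Ms where Ms: "\<And>x. \<bar>u s x\<bar> \<le> Ms" by (rule u_bdd_at[OF s]) blast
      have i: "integrable (\<mu> s) (\<lambda>x. u s x * g x)" "integrable (\<mu> s) (\<lambda>x. u t x * g x)"
        subgoal using s t Ms g B
          by (intro integrable_mu[of _ _ "Ms * B"]) (auto simp: abs_mult intro!: mult_mono order_trans[OF abs_ge_zero Ms])
        subgoal using s t M g B
          by (intro integrable_mu[of _ _ "M * B"]) (auto simp: abs_mult intro!: mult_mono order_trans[OF abs_ge_zero M])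
        done
      have "\<bar>\<integral>x. (u s x - u t x) * g x \<partial>\<mu> s\<bar> \<le> (e' * B) * measure (\<mu> s) UNIV"
        using d(2)[OF s] elim s t B g(2) e'
        by (intro integral_mu_bound) (auto simp: abs_mult intro!: mult_mono)
      also have "\<dots> \<le> (e' * (B + 1)) * (m + 1)"
        using elim e' B m by (intro mult_mono) auto
      also have "\<dots> = e' * ((B + 1) * (m + 1))" by simp
      also have "\<dots> = e / 2"
        unfolding e'_def using B m by (intro nonzero_eq_divide_eq[THEN iffD1, OF _ refl]) (auto simp: mult_eq_0_iff)
      also have "\<dots> < e" using e by simp
      finally show ?case using i by (simp add: left_diff_distrib)
    qed
  qed
  show "((\<lambda>s. \<integral>x. u s x * g x \<partial>\<mu> s) \<longlongrightarrow> (\<integral>x. u t x * g x \<partial>\<mu> t)) (at t within {0..})"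
    using tendsto_add[OF 2 1] by simp
qed

end

locale weak_solution = weak_flow u \<mu> + cutoffs \<psi>p \<psi>m for u \<mu> \<psi>p \<psi>m +
  assumes weak_eq: "test_fun2 \<phi> \<Longrightarrow>
    (LINT t:{0..}|lborel. (\<integral>x. dt \<phi> t x + u t x * dx \<phi> t x \<partial>(\<mu> t))) = - (\<integral>x. \<phi> 0 x \<partial>(\<mu> 0))"
begin

text \<open>The weak equation is tested with \<open>(A j s - A j t) \<cdot> g\<close>, where \<open>A j c\<close> is the cutoff
  \<open>\<psi>p\<close> rescaled to a transition of width \<open>1 / (j + 1)\<close> at \<open>c\<close>.\<close>

lemma transport_test:
  assumes g: "test_fun g" and st: "0 < s" "s < t"
  shows "(\<integral>x. g x \<partial>\<mu> t) - (\<integral>x. g x \<partial>\<mu> s) = (LINT r:{s..t}|lborel. (\<integral>x. u r x * deriv g x \<partial>\<mu> r))"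
proof -
  have gs: "smooth_fun g" and gb: "bounded {x. g x \<noteq> 0}" using g by (auto simp: test_fun_def)
  obtain R where R: "R > 0" "\<And>x. g x \<noteq> 0 \<Longrightarrow> \<bar>x\<bar> \<le> R" using gb unfolding bounded_pos by auto
  have gc: "continuous_on S g" "continuous_on S (deriv g)" for S
    using gs smooth_fun_continuous smooth_fun_deriv by blast+
  have g0: "g x = 0" "deriv g x = 0" if "\<bar>x\<bar> > R" for x
  proof -
    show "g x = 0" using R(2)[of x] that by force
    have "(g has_field_derivative 0) (at x)"
      by (rule has_field_derivative_transform_within_open[of "\<lambda>_. 0" _ _ "- {-R..R}"])
         (use that R(2) in \<open>force simp: abs_le_iff\<close>)+
    then show "deriv g x = 0" by (rule DERIV_imp_deriv)
  qed
  obtain B1 where B1: "B1 > 0" "\<And>x. -R \<le> x \<Longrightarrow> x \<le> R \<Longrightarrow> \<bar>g x\<bar> \<le> B1"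
    by (rule continuous_Icc_bounded[of "-R" R g]) (use gc in auto)
  obtain B2 where B2: "B2 > 0" "\<And>x. -R \<le> x \<Longrightarrow> x \<le> R \<Longrightarrow> \<bar>deriv g x\<bar> \<le> B2"
    by (rule continuous_Icc_bounded[of "-R" R "deriv g"]) (use gc in auto)
  have gB: "\<bar>g x\<bar> \<le> B1" "\<bar>deriv g x\<bar> \<le> B2" for x
    using g0[of x] B1(1) B1(2)[of x] B2(1) B2(2)[of x] by (cases "\<bar>x\<bar> > R"; force)+
  \<comment> \<open>\<open>max 0 r\<close> extends both functions continuously to negative times, so
    that integrals over the whole line make sense.\<close>
  define m where "m r = (\<integral>x. g x \<partial>\<mu> (max 0 r))" for r
  define k where "k r = (\<integral>x. u (max 0 r) x * deriv g x \<partial>\<mu> (max 0 r))" for r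
  have "bounded (range g)" by (rule boundedI[of _ B1]) (use gB in auto)
  then have mc: "continuous_on UNIV m"
    unfolding m_def by (intro continuous_on_compose2[OF weak_cont[OF gc(1)[of UNIV]]] continuous_intros) auto
  have kc: "continuous_on UNIV k"
    unfolding k_def by (intro continuous_on_compose2[OF flux_cont[OF gc(2)[of UNIV] gB(2)]] continuous_intros) auto
  have [measurable]: "m \<in> borel_measurable borel" "k \<in> borel_measurable borel"
    "deriv \<psi>p \<in> borel_measurable borel" "\<psi>p \<in> borel_measurable borel"
    by (auto intro!: borel_measurable_continuous_onI mc kc smooth_fun_continuous smooth_fun_deriv psi_smooth)
  \<comment> \<open>From index \<open>J\<close> on the cutoffs centred at \<open>s\<close> and at
    \<open>t\<close> vanish up to time 0. Then the initial term drops out, and the integral over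
    \<open>{0..}\<close> is one over the line.\<close>
  define J where "J = nat \<lceil>max (1 / s) 1\<rceil>"
  have J: "1 \<le> s * real (Suc (j + J))" for j
  proof -
    have "1 / s \<le> real J" unfolding J_def by linarith
    then have "1 \<le> s * real J" using st by (simp add: field_simps)
    also have "\<dots> \<le> s * real (Suc (j + J))" using st by (intro mult_left_mono) auto
    finally show ?thesis .
  qed
  define A where "A j c r = \<psi>p (real (Suc j) * r + - (real (Suc j) * c))" for j c r
  define A' where "A' j c r = deriv \<psi>p (real (Suc j) * r + - (real (Suc j) * c)) * real (Suc j)" for j c r
  have As: "smooth_alg (A j c)" for j c
    unfolding A_def[abs_def] by (intro smooth_alg.affine smooth_alg.smooth psi_smooth)
  have AD: "(A j c has_real_derivative A' j c r) (at r)" for j c r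
    unfolding A_def[abs_def] A'_def
    by (rule DERIV_chain2[OF smooth_fun_DERIV[OF psi_smooth(1)]]) (auto intro!: derivative_eq_intros)
  have [measurable]: "A j c \<in> borel_measurable borel" "A' j c \<in> borel_measurable borel" for j c
    unfolding A_def[abs_def] A'_def[abs_def] by measurable
  have AB: "0 \<le> A j c r" "A j c r \<le> 1" for j c r unfolding A_def using psi_range by auto
  obtain B where B: "B > 0" "\<And>x. \<bar>deriv \<psi>p x\<bar> \<le> B" by (rule deriv_psi_bounded) blast
  have A'z: "A' j c r = 0" if "\<bar>r - c\<bar> > 1" for j c r
  proof -
    have "\<bar>real (Suc j) * r + - (real (Suc j) * c)\<bar> = real (Suc j) * \<bar>r - c\<bar>"
      by (simp add: abs_mult right_diff_distrib[symmetric] del: of_nat_Suc)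
    moreover have "1 * \<bar>r - c\<bar> \<le> real (Suc j) * \<bar>r - c\<bar>" by (intro mult_right_mono) auto
    then have "1 < real (Suc j) * \<bar>r - c\<bar>" using that by simp
    ultimately have "\<bar>real (Suc j) * r + - (real (Suc j) * c)\<bar> > 1" by simp
    then show ?thesis by (simp add: A'_def deriv_psi_0)
  qed
  have A0: "A j c r = 0" if "r < c - 1" for j c r
  proof -
    have "1 * (c - r) \<le> real (Suc j) * (c - r)" using that by (intro mult_right_mono) auto
    then show ?thesis unfolding A_def using that by (intro psi_left) (simp add: algebra_simps)
  qed
  have A1: "A j c r = 1" if "r > c + 1" for j c r
  proof -
    have "1 * (r - c) \<le> real (Suc j) * (r - c)" using that by (intro mult_right_mono) auto
    then show ?thesis unfolding A_def using that by (intro psi_right) (simp add: algebra_simps)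
  qed
  have Aneg: "A (j + J) c r = 0" "A' (j + J) c r = 0" if "r < 0" "s \<le> c" for j c r
  proof -
    define N where "N = real (Suc (j + J))"
    have "N > 0" by (simp add: N_def)
    then have "s * N \<le> c * N" "r * N < 0"
      using that st by (auto intro!: mult_right_mono simp: mult_less_0_iff)
    then have "N * r + - (N * c) < -1" using J[of j] unfolding N_def[symmetric] by (simp only: mult.commute)
    then have "real (Suc (j + J)) * r + - (real (Suc (j + J)) * c) < -1" unfolding N_def .
    then show "A (j + J) c r = 0" "A' (j + J) c r = 0" 
      by (auto simp: A_def A'_def psi_left deriv_psi_0)
  qed
  have A00: "A (j + J) c 0 = 0" if "s \<le> c" for j c
  proof -
    define N where "N = real (Suc (j + J))"
    have "s * N \<le> c * N"
      using that by (intro mult_right_mono) (auto simp: N_def)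
    then have "N * 0 + - (N * c) \<le> -1" using J[of j] unfolding N_def[symmetric] by (simp add: mult.commute)
    then have "real (Suc (j + J)) * 0 + - (real (Suc (j + J)) * c) \<le> -1" unfolding N_def .
    then show "A (j + J) c 0 = 0" unfolding A_def by (rule psi_left)
  qed
  have intA': "integrable lborel (\<lambda>r. A' j c r * m r)" for j c
  proof -
    obtain Mm where Mm: "Mm > 0" "\<And>x. c - 1 \<le> x \<Longrightarrow> x \<le> c + 1 \<Longrightarrow> \<bar>m x\<bar> \<le> Mm"
      by (rule continuous_Icc_bounded[of "c - 1" "c + 1" m]) (use continuous_on_subset[OF mc] in auto)
    show ?thesis
    proof (rule Bochner_Integration.integrable_bound[where f = "\<lambda>r. indicator {c-1..c+1} r * (B * real (Suc j) * Mm)"])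
      show "integrable lborel (\<lambda>r. indicator {c-1..c+1} r * (B * real (Suc j) * Mm))"
        by (intro integrable_mult_left) auto
      have "\<bar>A' j c r * m r\<bar> \<le> indicator {c-1..c+1} r * (B * real (Suc j) * Mm)" for r
      proof (cases "\<bar>r - c\<bar> > 1")
        case False
        have "\<bar>A' j c r\<bar> * \<bar>m r\<bar> \<le> (B * real (Suc j)) * Mm"
          using False B Mm unfolding A'_def by (intro mult_mono) (auto simp: abs_mult abs_le_iff)
        moreover have "r \<in> {c - 1..c + 1}" using False by auto
        ultimately show ?thesis by (simp add: abs_mult)
      qed (use B Mm in \<open>simp add: A'z\<close>)
      then show "AE r in lborel. norm (A' j c r * m r) \<le> norm (indicator {c-1..c+1} r * (B * real (Suc j) * Mm))"
        by (intro AE_I2) (simp add: order_trans[OF _ abs_ge_self])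
    qed measurable
  qed
  obtain Mk where Mk: "Mk > 0" "\<And>x. s - 1 \<le> x \<Longrightarrow> x \<le> t + 1 \<Longrightarrow> \<bar>k x\<bar> \<le> Mk"
    by (rule continuous_Icc_bounded[of "s - 1" "t + 1" k]) (use continuous_on_subset[OF kc] in auto)
  have AkB: "\<bar>(A j s r - A j t r) * k r\<bar> \<le> indicator {s-1..t+1} r * Mk" for j r
  proof (cases "s - 1 \<le> r \<and> r \<le> t + 1")
    case True
    have "\<bar>A j s r - A j t r\<bar> \<le> 1" using AB[of j s r] AB[of j t r] by linarith
    then have "\<bar>A j s r - A j t r\<bar> * \<bar>k r\<bar> \<le> 1 * Mk" using Mk True by (intro mult_mono) auto
    then show ?thesis using True by (simp add: abs_mult)
  next
    case False
    then have "A j s r - A j t r = 0" using A0 A1 st by (cases "r < s - 1") auto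
    then show ?thesis using False by simp
  qed
  have intw: "integrable lborel (\<lambda>r. indicator {s-1..t+1} r * Mk)"
    using st by (intro integrable_mult_left integrable_real_indicator) auto
  have intA: "integrable lborel (\<lambda>r. (A j s r - A j t r) * k r)" for j
    by (rule Bochner_Integration.integrable_bound[OF intw]) (use AkB in \<open>auto intro!: AE_I2 order_trans[OF _ abs_ge_self]\<close>)
  \<comment> \<open>For a test function \<open>a r * g x\<close> the weak equation says that the
    integrals of \<open>a' m\<close> and of \<open>a k\<close> add up to 0; \<open>a'\<close> is the
    difference of two approximate point masses at \<open>s\<close> and \<open>t\<close>.\<close>
  have weak: "(\<integral>r. A' (j + J) s r * m r \<partial>lborel) - (\<integral>r. A' (j + J) t r * m r \<partial>lborel)
      + (\<integral>r. (A (j + J) s r - A (j + J) t r) * k r \<partial>lborel) = 0" for j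
  proof -
    define a where "a r = A (j + J) s r + (-1) * A (j + J) t r" for r
    have as: "smooth_fun a"
      unfolding smooth_fun_iff a_def[abs_def] by (intro smooth_alg.add smooth_alg.mult smooth_alg.const As)
    have a': "deriv a r = A' (j + J) s r - A' (j + J) t r" for r
      unfolding a_def[abs_def] by (rule DERIV_imp_deriv) (auto intro!: derivative_eq_intros AD)
    define \<phi> where "\<phi> r x = a r * g x" for r x
    have a0: "a r \<noteq> 0 \<Longrightarrow> s - 1 \<le> r \<and> r \<le> t + 1" for r
      using A0[of r s "j + J"] A0[of r t "j + J"] A1[of s r "j + J"] A1[of t r "j + J"] st
      by (force simp: a_def not_le)
    have "{(r, x). \<phi> r x \<noteq> 0} \<subseteq> {s-1..t+1} \<times> {-R..R}"
      using a0 R(2) by (force simp: \<phi>_def abs_le_iff)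
    then have "test_fun2 \<phi>"
      unfolding test_fun2_def \<phi>_def[abs_def]
      using smooth2_prod[OF as gs] bounded_subset[OF bounded_Times[OF bounded_closed_interval bounded_closed_interval]]
      by auto
    from weak_eq[OF this]
    have W: "(LINT r:{0..}|lborel. (\<integral>x. dt \<phi> r x + u r x * dx \<phi> r x \<partial>(\<mu> r))) = 0"
      using st A00[of s] A00[of t] by (simp add: \<phi>_def a_def)
    have dt: "dt \<phi> r x = deriv a r * g x" for r x
      unfolding dt_def \<phi>_def by (rule DERIV_imp_deriv) (auto intro!: DERIV_cmult_right smooth_fun_DERIV as)
    have dx: "dx \<phi> r x = a r * deriv g x" for r x
      unfolding dx_def \<phi>_def by (rule DERIV_imp_deriv) (auto intro!: DERIV_cmult smooth_fun_DERIV gs)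
    have in1: "(\<integral>x. dt \<phi> r x + u r x * dx \<phi> r x \<partial>(\<mu> r)) = deriv a r * m r + a r * k r" if r: "0 \<le> r" for r
    proof -
      obtain Mr where Mr: "\<And>x. \<bar>u r x\<bar> \<le> Mr" by (rule u_bdd_at[OF r]) blast
      have [measurable]: "u r \<in> borel_measurable borel" "g \<in> borel_measurable borel" "deriv g \<in> borel_measurable borel"
        using that by (auto intro!: borel_measurable_continuous_onI gc u_cont)
      have i1: "integrable (\<mu> r) g" using that gB by (intro integrable_mu[of _ _ B1]) auto
      have i2: "integrable (\<mu> r) (\<lambda>x. u r x * deriv g x)"
        using that gB Mr B2(1) by (intro integrable_mu[of _ _ "Mr * B2"])
          (auto simp: abs_mult intro!: mult_mono order_trans[OF abs_ge_zero Mr])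
      have "(\<integral>x. dt \<phi> r x + u r x * dx \<phi> r x \<partial>(\<mu> r)) = (\<integral>x. deriv a r * g x + a r * (u r x * deriv g x) \<partial>(\<mu> r))"
        by (simp add: dt dx mult_ac)
      also have "\<dots> = deriv a r * (\<integral>x. g x \<partial>\<mu> r) + a r * (\<integral>x. u r x * deriv g x \<partial>\<mu> r)"
        using i1 i2 by simp
      finally show ?thesis using that by (simp add: m_def k_def max_def)
    qed
    have "(LINT r:{0..}|lborel. (\<integral>x. dt \<phi> r x + u r x * dx \<phi> r x \<partial>(\<mu> r)))
        = (\<integral>r. deriv a r * m r + a r * k r \<partial>lborel)"
      unfolding set_lebesgue_integral_def
    proof (rule Bochner_Integration.integral_cong[OF refl])
      fix r :: real
      show "indicat_real {0..} r *\<^sub>R (\<integral>x. dt \<phi> r x + u r x * dx \<phi> r x \<partial>(\<mu> r)) = deriv a r * m r + a r * k r"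
        using in1[of r] Aneg[of r s j] Aneg[of r t j] st by (cases "0 \<le> r") (auto simp: a' a_def)
    qed
    also have "\<dots> = (\<integral>r. (A' (j + J) s r * m r - A' (j + J) t r * m r) + (A (j + J) s r - A (j + J) t r) * k r \<partial>lborel)"
      by (simp add: a' a_def algebra_simps)
    also have "\<dots> = (\<integral>r. A' (j + J) s r * m r \<partial>lborel) - (\<integral>r. A' (j + J) t r * m r \<partial>lborel)
      + (\<integral>r. (A (j + J) s r - A (j + J) t r) * k r \<partial>lborel)"
      using intA' intA by simp
    finally show ?thesis using W by simp
  qed
  have lim1: "(\<lambda>j. \<integral>r. A' (j + J) c r * m r \<partial>lborel) \<longlonglongrightarrow> m c" for c
    using LIMSEQ_ignore_initial_segment[OF mollified_step[OF mc, of c], of J] unfolding A'_def by simp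
  \<comment> \<open>The cutoffs converge off their centres, hence almost everywhere, and
    \<open>AkB\<close> bounds the integrands on one fixed compact interval.\<close>
  have lim2: "(\<lambda>j. \<integral>r. (A j s r - A j t r) * k r \<partial>lborel) \<longlonglongrightarrow> (\<integral>r. indicator {s..t} r * k r \<partial>lborel)"
  proof (rule integral_dominated_convergence[OF _ _ intw])
    show "AE r in lborel. (\<lambda>j. (A j s r - A j t r) * k r) \<longlonglongrightarrow> indicat_real {s..t} r * k r"
    proof -
      have "AE r in lborel. r \<noteq> s \<and> r \<noteq> t" using AE_lborel_singleton[of s] AE_lborel_singleton[of t] by eventually_elim auto
      then show ?thesis
      proof eventually_elim
        case (elim r)
        have AA: "(\<lambda>j. A j c r) \<longlonglongrightarrow> (if c \<le> r then 1 else 0)" if "r \<noteq> c" for c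
        proof -
          have "\<forall>\<^sub>F j in sequentially. 1 / \<bar>r - c\<bar> < real j"
            using filterlim_real_sequentially[THEN filterlim_at_top_dense[THEN iffD1]] by auto
          then have "\<forall>\<^sub>F j in sequentially. A j c r = (if c \<le> r then 1 else 0)"
          proof eventually_elim
            case (elim j)
            then have 1: "1 < real j * \<bar>r - c\<bar>" using that by (simp add: field_simps)
            have 2: "real j * \<bar>r - c\<bar> \<le> real (Suc j) * \<bar>r - c\<bar>" by (intro mult_right_mono) auto
            show ?case
            proof (cases "c \<le> r")
              case True
              then have "1 \<le> real (Suc j) * r + - (real (Suc j) * c)"
                using 1 2 by (simp add: right_diff_distrib del: of_nat_Suc)
              then show ?thesis using True by (simp add: A_def psi_right)
            next
              case False
              then have "real (Suc j) * r + - (real (Suc j) * c) \<le> -1"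
                using 1 2 by (simp add: right_diff_distrib del: of_nat_Suc)
              then show ?thesis using False by (simp add: A_def psi_left)
            qed
          qed
          then show ?thesis by (rule tendsto_eventually)
        qed
        have "(\<lambda>j. (A j s r - A j t r) * k r) \<longlonglongrightarrow> ((if s \<le> r then 1 else 0) - (if t \<le> r then 1 else 0)) * k r"
          using elim by (intro tendsto_intros AA) auto
        moreover have "((if s \<le> r then 1 else 0) - (if t \<le> r then 1 else 0)) = indicat_real {s..t} r"
          using elim st by (auto simp: indicator_def)
        ultimately show ?case by simp
      qed
    qed
  qed (use AkB in auto)
  have "(\<lambda>j. (\<integral>r. A' (j + J) s r * m r \<partial>lborel) - (\<integral>r. A' (j + J) t r * m r \<partial>lborel)
      + (\<integral>r. (A (j + J) s r - A (j + J) t r) * k r \<partial>lborel)) \<longlonglongrightarrow> m s - m t + (\<integral>r. indicator {s..t} r * k r \<partial>lborel)"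
    by (intro tendsto_add tendsto_diff lim1 LIMSEQ_ignore_initial_segment[OF lim2])
  then have "m s - m t + (\<integral>r. indicator {s..t} r * k r \<partial>lborel) = 0"
    unfolding weak using LIMSEQ_unique tendsto_const by metis
  moreover have "(\<integral>r. indicator {s..t} r * k r \<partial>lborel) = (LINT r:{s..t}|lborel. (\<integral>x. u r x * deriv g x \<partial>\<mu> r))"
    unfolding set_lebesgue_integral_def using st
    by (intro Bochner_Integration.integral_cong refl) (auto simp: indicator_def k_def)
  ultimately show ?thesis using st by (simp add: m_def)
qed

text \<open>Dominated convergence along the approximations of \<open>C1_approx\<close>, first in
  space at each time and then in time. Locally uniform convergence suffices because the measures are
  finite and the approximations are uniformly bounded.\<close>

lemma transport_C1:
  fixes f f' :: "real \<Rightarrow> real"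
  assumes f: "\<And>x. (f has_real_derivative f' x) (at x)" and f'c: "continuous_on UNIV f'"
    and fb: "\<And>x. \<bar>f x\<bar> \<le> A" and f'b: "\<And>x. \<bar>f' x\<bar> \<le> A'" and st: "0 < s" "s < t"
  shows "(\<integral>x. f x \<partial>\<mu> t) - (\<integral>x. f x \<partial>\<mu> s) = (LINT r:{s..t}|lborel. (\<integral>x. u r x * f' x \<partial>\<mu> r))"
proof -
  obtain B where B: "B > 0" "\<And>x. \<bar>deriv \<psi>p x\<bar> \<le> B" by (rule deriv_psi_bounded) blast
  define D where "D = A' + 1 + (A + 1) * (2 * B)"
  obtain g where g: "\<And>k. test_fun (g k)" "\<And>k x. \<bar>g k x\<bar> \<le> A + 1" "\<And>k x. \<bar>deriv (g k) x\<bar> \<le> D"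
    "\<And>k x. \<bar>x\<bar> \<le> real k \<Longrightarrow> \<bar>g k x - f x\<bar> \<le> 1 / Suc k" "\<And>k x. \<bar>x\<bar> \<le> real k \<Longrightarrow> \<bar>deriv (g k) x - f' x\<bar> \<le> 1 / Suc k"
    using C1_approx[OF f f'c fb f'b B] unfolding D_def by metis
  have D: "D \<ge> 0" using g(3)[of 0 0] by linarith
  have fc: "continuous_on UNIV f" using f DERIV_isCont continuous_at_imp_continuous_on by blast
  have gc: "continuous_on UNIV (g k)" "continuous_on UNIV (deriv (g k))" for k
    using g(1)[of k] smooth_fun_continuous smooth_fun_deriv unfolding test_fun_def by blast+
  have [measurable]: "f \<in> borel_measurable borel" "f' \<in> borel_measurable borel"
     "g k \<in> borel_measurable borel" "deriv (g k) \<in> borel_measurable borel" for k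
    by (auto intro!: borel_measurable_continuous_onI fc f'c gc)
  have conv: "(\<lambda>k. a k x) \<longlonglongrightarrow> b x" if "\<And>k x. \<bar>x\<bar> \<le> real k \<Longrightarrow> \<bar>a k x - b x\<bar> \<le> 1 / Suc k"
    for a :: "nat \<Rightarrow> real \<Rightarrow> real" and b x
  proof -
    have "\<forall>\<^sub>F k in sequentially. \<bar>x\<bar> < real k"
      using filterlim_real_sequentially[THEN filterlim_at_top_dense[THEN iffD1]] by auto
    then have "\<forall>\<^sub>F k in sequentially. norm (a k x - b x) \<le> 1 / real (Suc k)"
      by eventually_elim (use that in auto)
    then have "(\<lambda>k. a k x - b x) \<longlonglongrightarrow> 0"
      by (rule Lim_null_comparison[OF _ LIMSEQ_Suc[OF lim_1_over_n]])
    then show ?thesis by (simp add: LIM_zero_iff)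
  qed
  have 1: "(\<lambda>k. \<integral>x. g k x \<partial>\<mu> r) \<longlonglongrightarrow> (\<integral>x. f x \<partial>\<mu> r)" if "0 \<le> r" for r
  proof -
    interpret finite_measure "\<mu> r" using finite_mu that .
    show ?thesis
      by (rule integral_dominated_convergence[where w = "\<lambda>_. A + 1"])
         (use that g conv[of g f, OF g(4)] in \<open>auto intro!: meas_mu\<close>)
  qed
  have 2: "(\<lambda>k. \<integral>x. u r x * deriv (g k) x \<partial>\<mu> r) \<longlonglongrightarrow> (\<integral>x. u r x * f' x \<partial>\<mu> r)" if r: "0 \<le> r" for r
  proof -
    interpret finite_measure "\<mu> r" using finite_mu that .
    obtain Mr where Mr: "\<And>x. \<bar>u r x\<bar> \<le> Mr" by (rule u_bdd_at[OF r]) blast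
    have [measurable]: "u r \<in> borel_measurable borel"
      using r by (auto intro!: borel_measurable_continuous_onI u_cont)
    show ?thesis
    proof (rule integral_dominated_convergence[where w = "\<lambda>_. Mr * D"])
      show "AE x in \<mu> r. norm (u r x * deriv (g i) x) \<le> Mr * D" for i
        using Mr g(3) D by (intro AE_I2) (auto simp: abs_mult intro!: mult_mono order_trans[OF abs_ge_zero Mr])
      show "AE x in \<mu> r. (\<lambda>i. u r x * deriv (g i) x) \<longlonglongrightarrow> u r x * f' x"
        by (intro AE_I2 tendsto_intros conv g(5))
    qed (use r in \<open>auto intro!: meas_mu\<close>)
  qed
  obtain M where M: "M \<ge> 0" "\<And>r x. 0 \<le> r \<Longrightarrow> r \<le> t \<Longrightarrow> \<bar>u r x\<bar> \<le> M" using u_bdd[of t] by auto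
  obtain m where m: "m > 0" "\<And>r. 0 \<le> r \<Longrightarrow> r \<le> t \<Longrightarrow> \<bar>measure (\<mu> r) UNIV\<bar> \<le> m"
    by (rule continuous_Icc_bounded[of 0 t "\<lambda>r. measure (\<mu> r) UNIV"]) (use continuous_on_subset[OF mass_cont] in auto)
  have fl: "continuous_on {s..t} (\<lambda>r. \<integral>x. u r x * h x \<partial>\<mu> r)" if "continuous_on UNIV h" "\<And>x. \<bar>h x\<bar> \<le> b"
    for h b using continuous_on_subset[OF flux_cont[OF that]] st by auto
  have flm: "(\<lambda>r. indicator {s..t} r *\<^sub>R (\<integral>x. u r x * h x \<partial>\<mu> r)) \<in> borel_measurable lborel"
    if "continuous_on UNIV h" "\<And>x. \<bar>h x\<bar> \<le> b" for h b
    using borel_measurable_continuous_on_indicator[OF _ fl[OF that]] by simp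
  have 3: "(\<lambda>k. LINT r:{s..t}|lborel. (\<integral>x. u r x * deriv (g k) x \<partial>\<mu> r)) \<longlonglongrightarrow>
      (LINT r:{s..t}|lborel. (\<integral>x. u r x * f' x \<partial>\<mu> r))"
    unfolding set_lebesgue_integral_def
  proof (rule integral_dominated_convergence[where w = "\<lambda>r. indicator {s..t} r * (M * D * m)"])
    show "integrable lborel (\<lambda>r. indicator {s..t} r * (M * D * m))"
      using st by (intro integrable_mult_left integrable_real_indicator) auto
    show "AE r in lborel. (\<lambda>k. indicat_real {s..t} r *\<^sub>R (\<integral>x. u r x * deriv (g k) x \<partial>\<mu> r)) \<longlonglongrightarrow>
        indicat_real {s..t} r *\<^sub>R (\<integral>x. u r x * f' x \<partial>\<mu> r)"
      using 2 st by (intro AE_I2) (auto simp: indicator_def)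
    show "AE r in lborel. norm (indicat_real {s..t} r *\<^sub>R (\<integral>x. u r x * deriv (g k) x \<partial>\<mu> r)) \<le>
        indicator {s..t} r * (M * D * m)" for k
    proof (rule AE_I2)
      fix r :: real
      show "norm (indicat_real {s..t} r *\<^sub>R (\<integral>x. u r x * deriv (g k) x \<partial>\<mu> r)) \<le> indicator {s..t} r * (M * D * m)"
      proof (cases "r \<in> {s..t}")
        case True
        have [measurable]: "u r \<in> borel_measurable borel"
          using True st by (auto intro!: borel_measurable_continuous_onI u_cont)
        have "\<bar>\<integral>x. u r x * deriv (g k) x \<partial>\<mu> r\<bar> \<le> (M * D) * measure (\<mu> r) UNIV"
          using True st M g(3) D by (intro integral_mu_bound) (auto simp: abs_mult intro!: mult_mono)
        also have "\<dots> \<le> (M * D) * m" using m(2)[of r] True st M D by (intro mult_left_mono) auto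
        finally show ?thesis using True by simp
      qed simp
    qed
  qed (use flm[OF f'c f'b] flm[OF gc(2) g(3)] in auto)
  have "(\<lambda>k. (\<integral>x. g k x \<partial>\<mu> t) - (\<integral>x. g k x \<partial>\<mu> s)) \<longlonglongrightarrow> (\<integral>x. f x \<partial>\<mu> t) - (\<integral>x. f x \<partial>\<mu> s)"
    using st by (intro tendsto_diff 1) auto
  then show ?thesis
    unfolding transport_test[OF g(1) st] by (rule LIMSEQ_unique[OF _ 3])
qed

text \<open>The flux is continuous in time, so the integrated identity can be differentiated. The
  base point \<open>t / 2\<close> is positive, as \<open>transport_C1\<close> requires.\<close>

lemma transport_DERIV:
  fixes f f' :: "real \<Rightarrow> real"
  assumes f: "\<And>x. (f has_real_derivative f' x) (at x)" and f'c: "continuous_on UNIV f'"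
    and fb: "\<And>x. \<bar>f x\<bar> \<le> A" and f'b: "\<And>x. \<bar>f' x\<bar> \<le> A'" and t: "0 < t"
  shows "((\<lambda>t. \<integral>x. f x \<partial>\<mu> t) has_real_derivative (\<integral>x. u t x * f' x \<partial>\<mu> t)) (at t)"
proof -
  define s where "s = t / 2"
  have s: "0 < s" "s < t" using t by (auto simp: s_def)
  have kc: "continuous_on {s..t+1} (\<lambda>r. \<integral>x. u r x * f' x \<partial>\<mu> r)"
    using continuous_on_subset[OF flux_cont[OF f'c f'b]] s by auto
  have "((\<lambda>r. integral {s..r} (\<lambda>r. \<integral>x. u r x * f' x \<partial>\<mu> r)) has_real_derivative (\<integral>x. u t x * f' x \<partial>\<mu> t)) (at t within {s..t+1})"
    by (rule integral_has_real_derivative[OF kc]) (use s in auto)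
  then have "((\<lambda>r. (\<integral>x. f x \<partial>\<mu> s) + integral {s..r} (\<lambda>r. \<integral>x. u r x * f' x \<partial>\<mu> r)) has_real_derivative (\<integral>x. u t x * f' x \<partial>\<mu> t)) (at t within {s..t+1})"
    by (auto intro!: derivative_eq_intros)
  then have "((\<lambda>r. (\<integral>x. f x \<partial>\<mu> s) + integral {s..r} (\<lambda>r. \<integral>x. u r x * f' x \<partial>\<mu> r)) has_real_derivative (\<integral>x. u t x * f' x \<partial>\<mu> t)) (at t)"
    using s by (subst (asm) at_within_Icc_at) auto
  then show ?thesis
  proof (rule has_field_derivative_transform_within_open[where S = "{s<..<t+1}"])
    fix r assume r: "r \<in> {s<..<t+1}"
    have "set_integrable lborel {s..r} (\<lambda>r. \<integral>x. u r x * f' x \<partial>\<mu> r)"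
      using continuous_on_subset[OF kc] r by (intro borel_integrable_atLeastAtMost') auto
    then have "(LINT r:{s..r}|lborel. (\<integral>x. u r x * f' x \<partial>\<mu> r)) = integral {s..r} (\<lambda>r. \<integral>x. u r x * f' x \<partial>\<mu> r)"
      by (rule set_borel_integral_eq_integral(2))
    then show "(\<integral>x. f x \<partial>\<mu> s) + integral {s..r} (\<lambda>r. \<integral>x. u r x * f' x \<partial>\<mu> r) = (\<integral>x. f x \<partial>\<mu> r)"
      using transport_C1[OF f f'c fb f'b, of s r] s r by simp
  qed (use s in auto)
qed

end

section \<open>Sums of measures and the kernel\<close>

definition msum :: "'a measure \<Rightarrow> 'a measure \<Rightarrow> 'a measure" where
  "msum M N = measure_of (space M) (sets M) (\<lambda>X. emeasure M X + emeasure N X)"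

lemma sets_msum [simp, measurable_cong]: "sets (msum M N) = sets M"
  by (simp add: msum_def)

lemma space_msum [simp]: "space (msum M N) = space M"
  by (simp add: msum_def)

lemma emeasure_msum:
  assumes "sets N = sets M" "X \<in> sets M"
  shows "emeasure (msum M N) X = emeasure M X + emeasure N X"
proof (rule emeasure_measure_of[OF msum_def])
  show "countably_additive (sets (msum M N)) (\<lambda>X. emeasure M X + emeasure N X)"
    unfolding countably_additive_def
  proof (intro allI impI)
    fix A :: "nat \<Rightarrow> 'a set"
    assume A: "range A \<subseteq> sets (msum M N)" "disjoint_family A"
    have "(\<Sum>i. emeasure M (A i) + emeasure N (A i)) = (\<Sum>i. emeasure M (A i)) + (\<Sum>i. emeasure N (A i))"
      by (intro suminf_add[symmetric] summableI)
    also have "\<dots> = emeasure M (\<Union>i. A i) + emeasure N (\<Union>i. A i)"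
      using A assms(1) by (subst (1 2) suminf_emeasure) auto
    finally show "(\<Sum>i. emeasure M (A i) + emeasure N (A i)) = emeasure M (\<Union>i. A i) + emeasure N (\<Union>i. A i)" .
  qed
qed (use assms sets.space_closed in \<open>auto simp: positive_def\<close>)

lemma nn_integral_msum:
  assumes sets: "sets N = sets M" and f: "f \<in> borel_measurable M"
  shows "(\<integral>\<^sup>+x. f x \<partial>msum M N) = (\<integral>\<^sup>+x. f x \<partial>M) + (\<integral>\<^sup>+x. f x \<partial>N)"
  using f
proof (induction rule: borel_measurable_induct)
  case (cong f g)
  then show ?case
    using sets_eq_imp_space_eq[OF sets] by (simp cong: nn_integral_cong_simp)
next
  case (set A)
  then show ?case using sets by (simp add: emeasure_msum)
next
  case (mult u c)
  moreover have "u \<in> borel_measurable N" using mult sets by (simp cong: measurable_cong_sets)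
  ultimately show ?case by (simp add: nn_integral_cmult distrib_left measurable_cong_sets[OF sets_msum refl])
next
  case (add u v)
  moreover have "u \<in> borel_measurable N" "v \<in> borel_measurable N" using add sets by (simp_all cong: measurable_cong_sets)
  ultimately show ?case by (simp add: nn_integral_add ac_simps measurable_cong_sets[OF sets_msum refl])
next
  case (seq U)
  have UN: "U i \<in> borel_measurable N" for i using seq sets by (simp cong: measurable_cong_sets)
  have "(\<integral>\<^sup>+x. (SUP i. U i x) \<partial>K) = (SUP i. \<integral>\<^sup>+x. U i x \<partial>K)" if "\<And>i. U i \<in> borel_measurable K" for K
    using that \<open>incseq U\<close> by (intro nn_integral_monotone_convergence_SUP)
  note S = this
  have "(SUP i. (\<integral>\<^sup>+x. U i x \<partial>M) + (\<integral>\<^sup>+x. U i x \<partial>N)) = (SUP i. \<integral>\<^sup>+x. U i x \<partial>M) + (SUP i. \<integral>\<^sup>+x. U i x \<partial>N)"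
    using \<open>incseq U\<close>
    by (intro ennreal_SUP_add) (auto simp: incseq_def le_fun_def intro!: nn_integral_mono)
  then show ?case
    using seq UN by (simp add: Sup_apply image_comp comp_def S measurable_cong_sets[OF sets_msum refl])
qed

lemma integral_msum:
  fixes f :: "'a \<Rightarrow> real"
  assumes sets: "sets N = sets M" and M: "integrable M f" and N: "integrable N f"
  shows "integrable (msum M N) f" "integral\<^sup>L (msum M N) f = integral\<^sup>L M f + integral\<^sup>L N f"
proof -
  have [measurable]: "f \<in> borel_measurable M" using M by auto
  have fin: "(\<integral>\<^sup>+x. ennreal (s * f x) \<partial>K) < \<infinity>" if "integrable K f" "\<bar>s\<bar> = 1" for K and s :: real
    using that by (auto simp: abs_if real_integrable_def top.not_eq_extremum split: if_splits)
  show i: "integrable (msum M N) f"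
    unfolding real_integrable_def
    using fin[OF M, of 1] fin[OF M, of "-1"] fin[OF N, of 1] fin[OF N, of "-1"]
    by (auto simp: nn_integral_msum[OF sets] measurable_cong_sets[OF sets_msum refl])
  show "integral\<^sup>L (msum M N) f = integral\<^sup>L M f + integral\<^sup>L N f"
    using fin[OF M, of 1] fin[OF M, of "-1"] fin[OF N, of 1] fin[OF N, of "-1"]
    by (simp add: real_lebesgue_integral_def[OF i] real_lebesgue_integral_def[OF M] real_lebesgue_integral_def[OF N]
        nn_integral_msum[OF sets] enn2real_plus)
qed

section \<open>The kernel and its first two derivatives\<close>

definition Kd :: "nat \<Rightarrow> real \<Rightarrow> real" where
  "Kd n x = - (2 * real n * x) / (1 + x\<^sup>2) ^ Suc n"

definition Kdd :: "nat \<Rightarrow> real \<Rightarrow> real" where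
  "Kdd n x = - (2 * real n) / (1 + x\<^sup>2) ^ Suc n + 4 * real n * real (Suc n) * x\<^sup>2 / (1 + x\<^sup>2) ^ Suc (Suc n)"

lemma sq_pos: "(0::real) < 1 + x\<^sup>2"
  by (simp add: add_pos_nonneg)

lemma Kn_DERIV: "(Kn n has_real_derivative Kd n x) (at x)"
proof -
  have "((\<lambda>x. inverse ((1 + x\<^sup>2) ^ n)) has_real_derivative
      - (inverse ((1 + x\<^sup>2) ^ n) * (real n * (1 + x\<^sup>2) ^ (n - 1) * (2 * x)) * inverse ((1 + x\<^sup>2) ^ n))) (at x)"
    using sq_pos[of x] by (auto intro!: derivative_eq_intros)
  moreover have "- (inverse (D ^ n) * (real n * D ^ (n - 1) * (2 * x)) * inverse (D ^ n)) = - (2 * real n * x) / D ^ Suc n"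
    if "D \<noteq> 0" for D
    using that by (cases n) (simp_all add: field_simps del: of_nat_Suc)
  then have "- (inverse ((1 + x\<^sup>2) ^ n) * (real n * (1 + x\<^sup>2) ^ (n - 1) * (2 * x)) * inverse ((1 + x\<^sup>2) ^ n)) = Kd n x"
    using sq_pos[of x] unfolding Kd_def by (metis less_irrefl)
  ultimately show ?thesis by (simp add: Kn_def[abs_def] inverse_eq_divide)
qed

lemma deriv_Kn: "deriv (Kn n) = Kd n"
  using DERIV_imp_deriv[OF Kn_DERIV] by auto

lemma Kd_DERIV: "(Kd n has_real_derivative Kdd n x) (at x)"
proof -
  have "Kd n = (\<lambda>x. - (2 * real n) * x * Kn (Suc n) x)" by (auto simp: Kd_def Kn_def)
  then have "(Kd n has_real_derivative - (2 * real n) * Kn (Suc n) x + - (2 * real n) * x * Kd (Suc n) x) (at x)"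
    by (auto intro!: derivative_eq_intros Kn_DERIV)
  moreover have "- (2 * c) * (1 / P) + - (2 * c) * x * (- (2 * d * x) / Q) = - (2 * c) / P + 4 * c * d * x\<^sup>2 / Q"
    for c d P Q :: real
    by (simp add: algebra_simps power2_eq_square)
  ultimately show ?thesis unfolding Kdd_def Kn_def Kd_def by metis
qed

lemma Kn_pos: "0 < Kn n x"
  using sq_pos[of x] by (simp add: Kn_def)

lemma Kn_le_1: "Kn n x \<le> 1"
  using sq_pos[of x] by (simp add: Kn_def one_le_power)

lemma Kn_abs_le: "\<bar>Kn n x\<bar> \<le> 1"
  using less_imp_le[OF Kn_pos[of n x]] Kn_le_1[of n x] by simp

lemma Kn_minus: "Kn n (- x) = Kn n x"
  by (simp add: Kn_def)

lemma Kn_diff_commute: "Kn n (x - y) = Kn n (y - x)"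
  using Kn_minus[of n "x - y"] by simp

lemma Kd_diff_commute: "Kd n (x - y) = - Kd n (y - x)"
  by (simp add: Kd_def power2_commute[of x y] minus_divide_left algebra_simps)

lemma abs_2x_le: "\<bar>2 * x\<bar> \<le> 1 + (x::real)\<^sup>2"
  using zero_le_power2[of "x - 1"] zero_le_power2[of "x + 1"]
  by (auto simp: power2_eq_square algebra_simps abs_le_iff)

lemma Kd_bound: "\<bar>Kd n x\<bar> \<le> real n"
proof -
  have "\<bar>Kd n x\<bar> = real n * (\<bar>2 * x\<bar> / (1 + x\<^sup>2)) / (1 + x\<^sup>2) ^ n"
    using sq_pos[of x] by (simp add: Kd_def abs_mult abs_divide power_abs)
  also have "\<dots> \<le> real n * 1 / 1"
    using abs_2x_le[of x] sq_pos[of x]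
    by (intro frac_le mult_mono mult_left_mono) (auto simp: one_le_power divide_le_eq)
  finally show ?thesis by simp
qed

lemma Kdd_bound: "\<bar>Kdd n x\<bar> \<le> 2 * real n + 4 * real n * real (Suc n)"
proof -
  have 1: "\<bar>- (2 * real n) / (1 + x\<^sup>2) ^ Suc n\<bar> \<le> 2 * real n / 1"
    using sq_pos[of x] by (simp only: abs_divide) (intro frac_le; simp add: one_le_power del: power_Suc)
  have "\<bar>4 * real n * real (Suc n) * x\<^sup>2 / (1 + x\<^sup>2) ^ Suc (Suc n)\<bar>
      = 4 * real n * real (Suc n) * (x\<^sup>2 / (1 + x\<^sup>2)) / (1 + x\<^sup>2) ^ Suc n"
    using sq_pos[of x] by (simp add: abs_mult abs_divide)
  also have "\<dots> \<le> 4 * real n * real (Suc n) * 1 / 1"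
    using sq_pos[of x] by (intro frac_le mult_left_mono) (auto simp: one_le_power simp del: power_Suc of_nat_Suc)
  finally show ?thesis
    using 1 unfolding Kdd_def by (intro order_trans[OF abs_triangle_ineq]) simp
qed

lemma Kn_continuous: "continuous_on S (Kn n)"
  by (meson DERIV_isCont continuous_at_imp_continuous_on Kn_DERIV)

lemma Kd_continuous: "continuous_on S (Kd n)"
  by (meson DERIV_isCont continuous_at_imp_continuous_on Kd_DERIV)

lemma Kn_measurable [measurable]: "Kn n \<in> borel_measurable borel"
  by (intro borel_measurable_continuous_onI Kn_continuous)

lemma Kd_measurable [measurable]: "Kd n \<in> borel_measurable borel"
  by (intro borel_measurable_continuous_onI Kd_continuous)

lemma lipschitz_of_bounded_deriv:
  fixes f :: "real \<Rightarrow> real"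
  assumes "\<And>x. (f has_real_derivative f' x) (at x)" "\<And>x. \<bar>f' x\<bar> \<le> L"
  shows "\<bar>f x - f y\<bar> \<le> L * \<bar>x - y\<bar>"
  using field_differentiable_bound[of UNIV f f' L x y] assms by auto

lemma lipschitz_cont:
  fixes f :: "real \<Rightarrow> real"
  assumes "\<And>x y. \<bar>f x - f y\<bar> \<le> L * \<bar>x - y\<bar>"
  shows "continuous_on S f"
proof -
  have "L-lipschitz_on UNIV f"
    using assms[of 1 0] by (auto simp: lipschitz_on_def dist_real_def assms)
  then show ?thesis using lipschitz_on_continuous_on continuous_on_subset by blast
qed

lemma Kn_lipschitz: "\<bar>Kn n x - Kn n y\<bar> \<le> real n * \<bar>x - y\<bar>"
  by (rule lipschitz_of_bounded_deriv[OF Kn_DERIV Kd_bound])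

lemma Kd_lipschitz: "\<bar>Kd n x - Kd n y\<bar> \<le> (2 * real n + 4 * real n * real (Suc n)) * \<bar>x - y\<bar>"
  by (rule lipschitz_of_bounded_deriv[OF Kd_DERIV Kdd_bound])

text \<open>For \<open>n \<ge> 1\<close> the kernel lies below \<open>1 / (1 + x^2)\<close>, whose
  primitive \<open>arctan\<close> is bounded.\<close>

lemma Kn_integrable:
  assumes "n \<ge> 1"
  shows "integrable lborel (Kn n)"
proof -
  have half: "(\<integral>\<^sup>+x. ennreal (1 / (1 + x\<^sup>2)) * indicator {0..} x \<partial>lborel) = ennreal (pi / 2 - arctan 0)"
    by (rule nn_integral_FTC_atLeast)
       (auto intro!: derivative_eq_intros tendsto_arctan_at_top sq_pos less_imp_le simp: field_simps)
  have "(\<integral>\<^sup>+x. ennreal (1 / (1 + x\<^sup>2)) * indicator {..0} x \<partial>lborel)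
      = (\<integral>\<^sup>+x. ennreal (1 / (1 + x\<^sup>2)) * indicator {0..} x \<partial>lborel)"
    by (subst nn_integral_real_affine[where c = "-1" and t = 0]) (auto simp: indicator_def intro!: nn_integral_cong)
  then have fin: "(\<integral>\<^sup>+x. ennreal (1 / (1 + x\<^sup>2)) * indicator {..0} x + ennreal (1 / (1 + x\<^sup>2)) * indicator {0..} x \<partial>lborel) < \<infinity>"
    by (subst nn_integral_add) (auto simp: half)
  have "Kn n x \<le> 1 / (1 + x\<^sup>2)" for x
  proof -
    have "(1 + x\<^sup>2) ^ 1 \<le> (1 + x\<^sup>2) ^ n" using assms by (intro power_increasing) auto
    then show ?thesis using sq_pos[of x] unfolding Kn_def by (intro frac_le) auto
  qed
  then have "(\<integral>\<^sup>+x. ennreal (Kn n x) \<partial>lborel)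
    \<le> (\<integral>\<^sup>+x. ennreal (1 / (1 + x\<^sup>2)) * indicator {..0} x + ennreal (1 / (1 + x\<^sup>2)) * indicator {0..} x \<partial>lborel)"
  proof (intro nn_integral_mono)
    fix x :: real
    have "ennreal (Kn n x) \<le> ennreal (1 / (1 + x\<^sup>2))" using \<open>Kn n x \<le> 1 / (1 + x\<^sup>2)\<close> by (rule ennreal_leI)
    also have "\<dots> \<le> ennreal (1 / (1 + x\<^sup>2)) * indicator {..0} x + ennreal (1 / (1 + x\<^sup>2)) * indicator {0..} x"
      by (cases "x \<le> 0") (auto intro: add_increasing2)
    finally show "ennreal (Kn n x) \<le> ennreal (1 / (1 + x\<^sup>2)) * indicator {..0} x + ennreal (1 / (1 + x\<^sup>2)) * indicator {0..} x" .
  qed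
  then have "(\<integral>\<^sup>+x. ennreal (Kn n x) \<partial>lborel) < \<infinity>" using fin by (rule le_less_trans)
  then show ?thesis
    by (intro integrableI_nonneg AE_I2 less_imp_le[OF Kn_pos]) auto
qed

text \<open>Differentiability is asked only at the point \<open>x0\<close> and for almost every
  \<open>a\<close>, and a Lipschitz majorant of the increments replaces a bound on the derivatives.
  This form fits \<open>chi\<close>, whose time derivative exists merely almost everywhere.\<close>

lemma has_derivative_under_integral:
  fixes f :: "real \<Rightarrow> 'a \<Rightarrow> real"
  assumes S: "open S" "x0 \<in> S" and i: "\<And>x. x \<in> S \<Longrightarrow> integrable M (f x)"
    and f': "f' \<in> borel_measurable M" "AE a in M. ((\<lambda>x. f x a) has_real_derivative f' a) (at x0)"
    and w: "integrable M w" "\<And>x. x \<in> S \<Longrightarrow> AE a in M. \<bar>f x a - f x0 a\<bar> \<le> w a * \<bar>x - x0\<bar>"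
  shows "((\<lambda>x. \<integral>a. f x a \<partial>M) has_real_derivative (\<integral>a. f' a \<partial>M)) (at x0)"
proof -
  have "((\<lambda>x. ((\<integral>a. f x a \<partial>M) - (\<integral>a. f x0 a \<partial>M)) / (x - x0)) \<longlongrightarrow> (\<integral>a. f' a \<partial>M)) (at x0 within S)"
    unfolding tendsto_at_iff_sequentially
  proof (intro allI impI)
    fix X :: "nat \<Rightarrow> real" assume X: "\<forall>i. X i \<in> S - {x0}" "X \<longlonglongrightarrow> x0"
    have "(\<lambda>i. \<integral>a. (f (X i) a - f x0 a) / (X i - x0) \<partial>M) \<longlonglongrightarrow> (\<integral>a. f' a \<partial>M)"
    proof (rule integral_dominated_convergence[OF f'(1) _ w(1)])
      show "(\<lambda>a. (f (X j) a - f x0 a) / (X j - x0)) \<in> borel_measurable M" for j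
        using i[of "X j"] i[OF S(2)] X by auto
      show "AE a in M. (\<lambda>i. (f (X i) a - f x0 a) / (X i - x0)) \<longlonglongrightarrow> f' a"
        using f'(2)
      proof eventually_elim
        case (elim a)
        then have "((\<lambda>y. (f y a - f x0 a) / (y - x0)) \<longlongrightarrow> f' a) (at x0)"
          unfolding has_field_derivative_iff .
        then show ?case
          by (rule filterlim_compose) (use X in \<open>auto simp: filterlim_at\<close>)
      qed
      show "AE a in M. norm ((f (X j) a - f x0 a) / (X j - x0)) \<le> w a" for j
        using w(2)[of "X j"] X by (auto elim!: eventually_mono simp: divide_le_eq abs_divide)
    qed
    moreover have "(\<integral>a. (f (X j) a - f x0 a) / (X j - x0) \<partial>M) = ((\<integral>a. f (X j) a \<partial>M) - (\<integral>a. f x0 a \<partial>M)) / (X j - x0)" for j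
      using i[of "X j"] i[OF S(2)] X by auto
    ultimately show "((\<lambda>x. ((\<integral>a. f x a \<partial>M) - (\<integral>a. f x0 a \<partial>M)) / (x - x0)) \<circ> X) \<longlonglongrightarrow> (\<integral>a. f' a \<partial>M)"
      by (simp only: comp_def)
  qed
  then show ?thesis
    unfolding has_field_derivative_iff using at_within_open[OF S(2,1)] by simp
qed

text \<open>Integrating \<open>f\<close> against \<open>p dx + \<mu>\<close> is integrating \<open>smear n f\<close> against
  \<open>\<mu>\<close>, so that everything is driven by the transport equation for \<open>\<mu>\<close> alone.\<close>

definition smear :: "nat \<Rightarrow> (real \<Rightarrow> real) \<Rightarrow> real \<Rightarrow> real" where
  "smear n f y = f y + (\<integral>x. f x * Kn n (x - y) \<partial>lborel)"

section \<open>Smearing test functions with the kernel\<close>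

locale kernel =
  fixes n :: nat
  assumes n1: "n \<ge> 1"
begin

text \<open>The constant that relates \<open>B\<close> to the total mass: by Fubini \<open>B\<close>
  is \<open>\<kappa> * C\<close>.\<close>

definition \<kappa> where "\<kappa> = (\<integral>x. Kn n x \<partial>lborel)"

lemma kappa_nonneg: "0 \<le> \<kappa>"
  unfolding \<kappa>_def by (intro Bochner_Integration.integral_nonneg less_imp_le[OF Kn_pos])

lemma K_shift_integrable: "integrable lborel (\<lambda>x. Kn n (x - y))"
  using lborel_integrable_real_affine[OF Kn_integrable[OF n1], of 1 "- y"] by (simp add: algebra_simps)

lemma K_shift_integral: "(\<integral>x. Kn n (x - y) \<partial>lborel) = \<kappa>"
  using lborel_integral_real_affine[of 1 "Kn n" "- y"] by (simp add: \<kappa>_def algebra_simps)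

lemma fK_integrable:
  assumes "f \<in> borel_measurable borel" "\<And>x. \<bar>f x\<bar> \<le> A"
  shows "integrable lborel (\<lambda>x. f (x + c) * Kn n (x - y))"
proof (rule Bochner_Integration.integrable_bound)
  show "integrable lborel (\<lambda>x. A * Kn n (x - y))" by (intro integrable_mult_right K_shift_integrable)
  show "AE x in lborel. norm (f (x + c) * Kn n (x - y)) \<le> norm (A * Kn n (x - y))"
  proof (intro AE_I2)
    fix x
    have "\<bar>f (x + c)\<bar> * Kn n (x - y) \<le> \<bar>A\<bar> * Kn n (x - y)"
      using assms(2)[of "x + c"] Kn_pos[of n "x - y"] by (intro mult_right_mono) auto
    then show "norm (f (x + c) * Kn n (x - y)) \<le> norm (A * Kn n (x - y))"
      using Kn_pos[of n "x - y"] by (simp add: abs_mult)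
  qed
qed (use assms(1) in measurable)

text \<open>Moving \<open>y\<close> from the kernel into \<open>f\<close> makes it visible that
  smearing commutes with differentiation and translation.\<close>

lemma smear_shift: "smear n f y = f y + (\<integral>x. f (x + y) * Kn n x \<partial>lborel)"
  unfolding smear_def by (subst lborel_integral_real_affine[where c = 1 and t = y]) (auto simp: add.commute)

lemma conv_bound:
  assumes "f \<in> borel_measurable borel" "\<And>x. \<bar>f x\<bar> \<le> A"
  shows "\<bar>\<integral>x. f (x + y) * Kn n x \<partial>lborel\<bar> \<le> A * \<kappa>"
proof -
  have "\<bar>\<integral>x. f (x + y) * Kn n x \<partial>lborel\<bar> \<le> (\<integral>x. \<bar>f (x + y) * Kn n x\<bar> \<partial>lborel)" by (rule integral_abs_bound)
  also have "\<dots> \<le> (\<integral>x. A * Kn n x \<partial>lborel)"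
    using fK_integrable[OF assms, of y 0] Kn_integrable[OF n1] assms(2) Kn_pos[of n]
    by (intro integral_mono integrable_abs integrable_mult_right) (auto simp: abs_mult less_imp_le intro!: mult_right_mono)
  finally show ?thesis by (simp add: \<kappa>_def)
qed

lemma smear_bound:
  assumes "f \<in> borel_measurable borel" "\<And>x. \<bar>f x\<bar> \<le> A"
  shows "\<bar>smear n f y\<bar> \<le> A * (1 + \<kappa>)"
  using conv_bound[OF assms, of y] assms(2)[of y] unfolding smear_shift by (simp add: distrib_left)

lemma smear_DERIV:
  assumes f: "\<And>x. (f has_real_derivative f' x) (at x)" and f'c: "continuous_on UNIV f'"
    and fb: "\<And>x. \<bar>f x\<bar> \<le> A" and f'b: "\<And>x. \<bar>f' x\<bar> \<le> A'"
  shows "(smear n f has_real_derivative smear n f' y) (at y)"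
proof -
  have [measurable]: "f \<in> borel_measurable borel" "f' \<in> borel_measurable borel"
    using f DERIV_isCont by (auto intro!: borel_measurable_continuous_onI f'c continuous_at_imp_continuous_on)
  have "((\<lambda>y. \<integral>x. f (x + y) * Kn n x \<partial>lborel) has_real_derivative (\<integral>x. f' (x + y) * Kn n x \<partial>lborel)) (at y)"
  proof (rule has_derivative_under_integral[where S = UNIV and w = "\<lambda>x. A' * Kn n x"])
    show "integrable lborel (\<lambda>xa. f (xa + x) * Kn n xa)" for x
      using fK_integrable[of f A x 0] fb by auto
    show "AE a in lborel. ((\<lambda>x. f (a + x) * Kn n a) has_real_derivative f' (a + y) * Kn n a) (at y)"
      by (intro AE_I2 DERIV_cmult_right) (use f DERIV_shift[of f _ y] in \<open>auto simp: add.commute\<close>)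
    have "\<bar>f (a + x) * Kn n a - f (a + y) * Kn n a\<bar> \<le> A' * Kn n a * \<bar>x - y\<bar>" for a x
    proof -
      have "\<bar>f (a + x) * Kn n a - f (a + y) * Kn n a\<bar> = \<bar>f (a + x) - f (a + y)\<bar> * Kn n a"
        using Kn_pos[of n a] by (simp add: abs_mult left_diff_distrib[symmetric])
      also have "\<dots> \<le> (A' * \<bar>a + x - (a + y)\<bar>) * Kn n a"
        using Kn_pos[of n a] by (intro mult_right_mono lipschitz_of_bounded_deriv[OF f f'b]) auto
      finally show ?thesis by (simp add: mult_ac)
    qed
    then show "AE a in lborel. \<bar>f (a + x) * Kn n a - f (a + y) * Kn n a\<bar> \<le> A' * Kn n a * \<bar>x - y\<bar>" for x by simp
    show "integrable lborel (\<lambda>x. A' * Kn n x)" by (intro integrable_mult_right Kn_integrable n1)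
  qed auto
  then show ?thesis unfolding smear_shift[abs_def] by (intro DERIV_add f)
qed

lemma smear_lipschitz:
  assumes L: "\<And>x y. \<bar>f x - f y\<bar> \<le> L * \<bar>x - y\<bar>" and fb: "\<And>x. \<bar>f x\<bar> \<le> A"
  shows "\<bar>smear n f x - smear n f y\<bar> \<le> L * (1 + \<kappa>) * \<bar>x - y\<bar>"
proof -
  have "L-lipschitz_on UNIV f"
    using L[of 1 0] by (auto simp: lipschitz_on_def dist_real_def L)
  then have fm [measurable]: "f \<in> borel_measurable borel"
    by (intro borel_measurable_continuous_onI lipschitz_on_continuous_on)
  have i: "integrable lborel (\<lambda>z. f (z + c) * Kn n z)" for c
    using fK_integrable[OF fm fb, of c 0] by simp
  have "\<bar>\<integral>z. (f (z + x) - f (z + y)) * Kn n z \<partial>lborel\<bar> \<le> (\<integral>z. \<bar>(f (z + x) - f (z + y)) * Kn n z\<bar> \<partial>lborel)"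
    by (rule integral_abs_bound)
  also have "\<dots> \<le> (\<integral>z. (L * \<bar>x - y\<bar>) * Kn n z \<partial>lborel)"
  proof (intro integral_mono integrable_abs integrable_mult_right Kn_integrable n1)
    show "integrable lborel (\<lambda>z. (f (z + x) - f (z + y)) * Kn n z)"
      using i[of x] i[of y] by (simp add: left_diff_distrib)
    show "\<bar>(f (z + x) - f (z + y)) * Kn n z\<bar> \<le> L * \<bar>x - y\<bar> * Kn n z" for z
      using L[of "z + x" "z + y"] Kn_pos[of n z] by (simp add: abs_mult)
  qed
  finally have "\<bar>(\<integral>z. f (z + x) * Kn n z \<partial>lborel) - (\<integral>z. f (z + y) * Kn n z \<partial>lborel)\<bar> \<le> L * \<bar>x - y\<bar> * \<kappa>"
    using i[of x] i[of y] by (simp add: left_diff_distrib \<kappa>_def)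
  then show ?thesis using L[of x y] unfolding smear_shift by (simp add: algebra_simps abs_le_iff)
qed

text \<open>The kernel is positive. Applied to a derivative, this keeps decreasing test functions
  decreasing under smearing.\<close>

lemma smear_nonpos:
  assumes "\<And>x. f x \<le> 0"
  shows "smear n f y \<le> 0"
proof -
  have "(\<integral>x. - (f x * Kn n (x - y)) \<partial>lborel) \<ge> 0"
    using assms less_imp_le[OF Kn_pos] by (intro Bochner_Integration.integral_nonneg) (simp add: mult_nonpos_nonneg)
  then show ?thesis using assms[of y] unfolding smear_def by simp
qed

end

section \<open>The distribution function and its inverse\<close>

locale hs = weak_solution u \<mu> \<psi>p \<psi>m + kernel n for u \<mu> \<psi>p \<psi>m n
begin

definition C where "C = measure (\<mu> 0) UNIV"

abbreviation "p \<equiv> pp n \<mu>"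
abbreviation "G \<equiv> GG n \<mu>"
abbreviation "\<xi> \<equiv> chi n \<mu>"
text \<open>The end points are left out: at 0 the set in the definition of \<open>chi\<close> is
  empty, and at \<open>BC n \<mu>\<close>, if there is mass, it is the whole line, so the supremum
  carries no information there.\<close>

abbreviation "I \<equiv> {0<..<BC n \<mu>}"

text \<open>The constant 1 has zero flux at positive times; weak continuity carries the value down
  to time 0.\<close>

lemma mass_const: "0 \<le> t \<Longrightarrow> measure (\<mu> t) UNIV = C"
proof -
  assume "0 \<le> t"
  have D: "((\<lambda>t. \<integral>x. (1::real) \<partial>\<mu> t) has_real_derivative 0) (at r)" if "0 < r" for r
    using transport_DERIV[of "\<lambda>_. 1" "\<lambda>_. 0" 1 0 r] that by simp
  have c: "continuous_on {0..} (\<lambda>t. \<integral>x. (1::real) \<partial>\<mu> t)" by (intro weak_cont) auto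
  show ?thesis
  proof (cases "t = 0")
    case False
    then have "(\<integral>x. (1::real) \<partial>\<mu> t) = (\<integral>x. (1::real) \<partial>\<mu> 0)"
      using \<open>0 \<le> t\<close> by (intro DERIV_isconst_end D continuous_on_subset[OF c]) auto
    then show ?thesis using \<open>0 \<le> t\<close> by (simp add: C_def)
  qed (simp add: C_def)
qed

lemma C_nonneg: "0 \<le> C" by (simp add: C_def)

section \<open>Convolutions of the measures with the kernel\<close>

lemma integral_mu_bound_C:
  fixes f :: "real \<Rightarrow> real"
  assumes "0 \<le> t" "f \<in> borel_measurable borel" "\<And>x. \<bar>f x\<bar> \<le> B"
  shows "\<bar>\<integral>x. f x \<partial>\<mu> t\<bar> \<le> B * C"
  using integral_mu_bound[OF assms] mass_const[OF assms(1)] by simp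

lemma vK_integrable:
  assumes "0 \<le> t" "v \<in> borel_measurable borel" "\<And>y. \<bar>v y\<bar> \<le> B"
  shows "integrable (\<mu> t) (\<lambda>y. v y * Kn n (x - y))" "integrable (\<mu> t) (\<lambda>y. v y * Kd n (x - y))"
proof -
  note [measurable] = assms(2)
  show "integrable (\<mu> t) (\<lambda>y. v y * Kn n (x - y))"
    using assms(1,3) Kn_le_1[of n] less_imp_le[OF Kn_pos[of n]]
    by (intro integrable_mu[of _ _ "B * 1"])
       (auto simp: abs_mult simp del: mult_1_right intro!: mult_mono order_trans[OF abs_ge_zero assms(3)])
  show "integrable (\<mu> t) (\<lambda>y. v y * Kd n (x - y))"
    using assms(1,3) Kd_bound[of n]
    by (intro integrable_mu[of _ _ "B * real n"]) (auto simp: abs_mult intro!: mult_mono order_trans[OF abs_ge_zero assms(3)])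
qed

lemma K_integrable_mu: "0 \<le> t \<Longrightarrow> integrable (\<mu> t) (\<lambda>y. Kn n (x - y))"
  using vK_integrable(1)[of t "\<lambda>_. 1" 1] by simp

lemma p_nonneg: "0 \<le> p t x"
  unfolding pp_def by (intro Bochner_Integration.integral_nonneg less_imp_le[OF Kn_pos])

text \<open>The weight \<open>v\<close> is 1 in the identities about \<open>p\<close> and
  \<open>u t\<close> in those about the flux \<open>w\<close>.\<close>

lemma fubini_K:
  assumes t: "0 \<le> t" and f: "f \<in> borel_measurable borel" "\<And>x. \<bar>f x\<bar> \<le> A"
    and v: "v \<in> borel_measurable borel" "\<And>x. \<bar>v x\<bar> \<le> B"
  shows "integrable lborel (\<lambda>x. f x * (\<integral>y. v y * Kn n (x - y) \<partial>\<mu> t))"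
    and "(\<integral>x. f x * (\<integral>y. v y * Kn n (x - y) \<partial>\<mu> t) \<partial>lborel) = (\<integral>y. v y * (\<integral>x. f x * Kn n (x - y) \<partial>lborel) \<partial>\<mu> t)"
proof -
  note [measurable] = f(1) v(1)
  interpret mu: finite_measure "\<mu> t" using finite_mu[OF t] .
  interpret P: pair_sigma_finite "\<mu> t" lborel ..
  have [measurable_cong]: "sets (\<mu> t) = sets borel" by (rule sets_mu[OF t])
  have A: "0 \<le> A" "0 \<le> B" using f(2)[of 0] v(2)[of 0] by auto
  let ?g = "\<lambda>(y, x). v y * (f x * Kn n (x - y))"
  have fi: "integrable lborel (\<lambda>x. f x * Kn n (x - y))" for y
    using fK_integrable[OF f, of 0 y] by simp
  have i: "integrable (\<mu> t \<Otimes>\<^sub>M lborel) ?g"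
  proof (rule P.Fubini_integrable)
    show "?g \<in> borel_measurable (\<mu> t \<Otimes>\<^sub>M lborel)" by measurable
    show "AE x in \<mu> t. integrable lborel (\<lambda>y. ?g (x, y))"
      using fi by (auto intro!: AE_I2)
    have "\<bar>\<integral>x. norm (?g (y, x)) \<partial>lborel\<bar> \<le> B * A * \<kappa>" for y
    proof -
      have "\<bar>\<integral>x. norm (?g (y, x)) \<partial>lborel\<bar> = (\<integral>x. norm (?g (y, x)) \<partial>lborel)"
        by (intro abs_of_nonneg Bochner_Integration.integral_nonneg) auto
      also have "\<dots> \<le> (\<integral>x. B * A * Kn n (x - y) \<partial>lborel)"
      proof (intro integral_mono integrable_mult_right K_shift_integrable)
        show "integrable lborel (\<lambda>x. norm (?g (y, x)))" using fi by (intro integrable_norm) auto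
        show "norm (?g (y, x)) \<le> B * A * Kn n (x - y)" for x
          using f(2)[of x] v(2)[of y] Kn_pos[of n "x - y"] A
          by (auto simp: abs_mult mult.assoc intro!: mult_mono)
      qed
      finally show ?thesis using K_shift_integral[of y] by simp
    qed
    then show "integrable (\<mu> t) (\<lambda>y. \<integral>x. norm (?g (y, x)) \<partial>lborel)"
      by (intro finite_measure_integrable_bounded[OF finite_mu[OF t]]) measurable
  qed
  have "integrable lborel (\<lambda>x. \<integral>y. v y * (f x * Kn n (x - y)) \<partial>\<mu> t)"
    using P.integrable_snd[of "\<lambda>y x. v y * (f x * Kn n (x - y))"] i by simp
  then show "integrable lborel (\<lambda>x. f x * (\<integral>y. v y * Kn n (x - y) \<partial>\<mu> t))"
    by (simp add: mult.left_commute)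
  have "(\<integral>x. f x * (\<integral>y. v y * Kn n (x - y) \<partial>\<mu> t) \<partial>lborel) = (\<integral>x. (\<integral>y. v y * (f x * Kn n (x - y)) \<partial>\<mu> t) \<partial>lborel)"
    by (simp add: mult.left_commute)
  also have "\<dots> = (\<integral>y. (\<integral>x. v y * (f x * Kn n (x - y)) \<partial>lborel) \<partial>\<mu> t)"
    using P.Fubini_integral[of "\<lambda>y x. v y * (f x * Kn n (x - y))"] i by simp
  also have "\<dots> = (\<integral>y. v y * (\<integral>x. f x * Kn n (x - y) \<partial>lborel) \<partial>\<mu> t)"
    by simp
  finally show "(\<integral>x. f x * (\<integral>y. v y * Kn n (x - y) \<partial>\<mu> t) \<partial>lborel) = (\<integral>y. v y * (\<integral>x. f x * Kn n (x - y) \<partial>lborel) \<partial>\<mu> t)" .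
qed

lemma p_integrable: "0 \<le> t \<Longrightarrow> integrable lborel (p t)"
  using fubini_K(1)[of t "\<lambda>_. 1" 1 "\<lambda>_. 1" 1] by (simp add: pp_def[abs_def])

lemma p_integral: "0 \<le> t \<Longrightarrow> (\<integral>x. p t x \<partial>lborel) = \<kappa> * C"
  using fubini_K(2)[of t "\<lambda>_. 1" 1 "\<lambda>_. 1" 1] mass_const[of t]
  by (simp add: pp_def[abs_def] K_shift_integral mult.commute)

lemma BC_eq: "BC n \<mu> = \<kappa> * C + C"
  unfolding BC_def p_integral[OF order_refl] C_def by simp

lemma vK_lipschitz:
  assumes t: "0 \<le> t" and v: "v \<in> borel_measurable borel" "\<And>x. \<bar>v x\<bar> \<le> B"
  shows "\<bar>(\<integral>y. v y * Kn n (a - y) \<partial>\<mu> t) - (\<integral>y. v y * Kn n (b - y) \<partial>\<mu> t)\<bar> \<le> B * real n * C * \<bar>a - b\<bar>"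
    "\<bar>(\<integral>y. v y * Kd n (a - y) \<partial>\<mu> t) - (\<integral>y. v y * Kd n (b - y) \<partial>\<mu> t)\<bar>
      \<le> B * (2 * real n + 4 * real n * real (Suc n)) * C * \<bar>a - b\<bar>"
proof -
  note [measurable] = v(1)
  have B: "0 \<le> B" using v(2)[of 0] by auto
  have "\<bar>\<integral>y. v y * (Kn n (a - y) - Kn n (b - y)) \<partial>\<mu> t\<bar> \<le> B * (real n * \<bar>a - b\<bar>) * C"
    using v(2) B Kn_lipschitz[of n] 
    by (intro integral_mu_bound_C t) (auto simp: abs_mult intro!: mult_mono order_trans[OF Kn_lipschitz])
  then show "\<bar>(\<integral>y. v y * Kn n (a - y) \<partial>\<mu> t) - (\<integral>y. v y * Kn n (b - y) \<partial>\<mu> t)\<bar> \<le> B * real n * C * \<bar>a - b\<bar>"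
    using vK_integrable(1)[OF t v] by (simp add: right_diff_distrib mult_ac)
  have "\<bar>\<integral>y. v y * (Kd n (a - y) - Kd n (b - y)) \<partial>\<mu> t\<bar> \<le> B * ((2 * real n + 4 * real n * real (Suc n)) * \<bar>a - b\<bar>) * C"
    using v(2) B 
    by (intro integral_mu_bound_C t) (auto simp: abs_mult simp del: of_nat_Suc intro!: mult_mono order_trans[OF Kd_lipschitz])
  then show "\<bar>(\<integral>y. v y * Kd n (a - y) \<partial>\<mu> t) - (\<integral>y. v y * Kd n (b - y) \<partial>\<mu> t)\<bar>
      \<le> B * (2 * real n + 4 * real n * real (Suc n)) * C * \<bar>a - b\<bar>"
    using vK_integrable(2)[OF t v] by (simp add: right_diff_distrib mult_ac del: of_nat_Suc)
qed

lemma p_lipschitz: "0 \<le> t \<Longrightarrow> \<bar>p t a - p t b\<bar> \<le> real n * C * \<bar>a - b\<bar>"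
  using vK_lipschitz(1)[of t "\<lambda>_. 1" 1 a b] by (simp add: pp_def)

lemma p_cont: "0 \<le> t \<Longrightarrow> continuous_on S (p t)"
  using lipschitz_cont[OF p_lipschitz] by blast

lemma p_measurable: "0 \<le> t \<Longrightarrow> p t \<in> borel_measurable borel"
  by (intro borel_measurable_continuous_onI p_cont)

lemma p_le: "0 \<le> t \<Longrightarrow> p t x \<le> C"
  using integral_mu_bound_C[of t "\<lambda>y. Kn n (x - y)" 1] Kn_le_1[of n] less_imp_le[OF Kn_pos[of n]]
  by (auto simp: pp_def)

text \<open>The kernel vanishes nowhere, so a zero of \<open>p t\<close> would force
  \<open>\<mu> t\<close> to be the zero measure.\<close>

lemma p_pos:
  assumes "0 \<le> t" "0 < C"
  shows "0 < p t x"
proof (rule ccontr)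
  assume "\<not> 0 < p t x"
  then have "p t x = 0" using p_nonneg[of t x] by simp
  then have "AE y in \<mu> t. Kn n (x - y) = 0"
    unfolding pp_def using integral_nonneg_eq_0_iff_AE[OF K_integrable_mu[OF assms(1)], of x] less_imp_le[OF Kn_pos] by auto
  then have "AE y in \<mu> t. False" using Kn_pos[of n] by (auto simp: less_le)
  then have "emeasure (\<mu> t) UNIV = 0" using AE_iff_null[of "\<mu> t" "\<lambda>_. False"] assms(1) sets.top[of "\<mu> t"] by (auto simp: null_sets_def)
  then show False using mass_const[OF assms(1)] assms(2) by (simp add: measure_def)
qed

section \<open>The measure \<open>rho\<close> and its distribution function\<close>

definition rho where "rho t = msum (density lborel (\<lambda>x. ennreal (p t x))) (\<mu> t)"

lemma sets_rho [simp, measurable_cong]: "sets (rho t) = sets borel"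
  by (simp add: rho_def)

lemma space_rho [simp]: "space (rho t) = UNIV"
  by (simp add: rho_def)

lemma emeasure_rho:
  assumes "0 \<le> t" "A \<in> sets borel"
  shows "emeasure (rho t) A = ennreal (LINT y:A|lborel. p t y) + emeasure (\<mu> t) A"
proof -
  have [measurable]: "p t \<in> borel_measurable borel" by (intro p_measurable assms)
  have "emeasure (density lborel (\<lambda>x. ennreal (p t x))) A = (\<integral>\<^sup>+y. ennreal (indicator A y *\<^sub>R p t y) \<partial>lborel)"
    using assms by (subst emeasure_density) (auto simp: indicator_def intro!: nn_integral_cong)
  also have "\<dots> = ennreal (LINT y:A|lborel. p t y)"
    unfolding set_lebesgue_integral_def using assms p_nonneg
    by (intro nn_integral_eq_integral integrable_mult_indicator p_integrable) auto
  finally show ?thesis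
    unfolding rho_def using assms sets_mu by (subst emeasure_msum) auto
qed

lemma finite_rho: 
  assumes "0 \<le> t"
  shows "finite_measure (rho t)"
proof
  interpret finite_measure "\<mu> t" using finite_mu[OF assms] .
  show "emeasure (rho t) (space (rho t)) \<noteq> \<infinity>" using emeasure_rho[OF assms, of UNIV] by simp
qed

lemma measure_rho:
  assumes "0 \<le> t" "A \<in> sets borel"
  shows "measure (rho t) A = (LINT y:A|lborel. p t y) + measure (\<mu> t) A"
proof -
  interpret finite_measure "\<mu> t" using finite_mu[OF assms(1)] .
  have "0 \<le> (LINT y:A|lborel. p t y)"
    unfolding set_lebesgue_integral_def using p_nonneg by (intro Bochner_Integration.integral_nonneg) auto
  then have "emeasure (rho t) A = ennreal ((LINT y:A|lborel. p t y) + measure (\<mu> t) A)"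
    using emeasure_rho[OF assms] by (simp add: emeasure_eq_measure ennreal_plus)
  then show ?thesis
    using \<open>0 \<le> (LINT y:A|lborel. p t y)\<close> by (simp add: measure_def[of "rho t"] del: ennreal_plus)
qed

lemma measure_rho_UNIV: "0 \<le> t \<Longrightarrow> measure (rho t) UNIV = BC n \<mu>"
  using measure_rho[of t UNIV] by (simp add: BC_eq p_integral mass_const set_lebesgue_integral_def)

lemma integral_rho:
  assumes t: "0 \<le> t" and f: "f \<in> borel_measurable borel" "\<And>x. \<bar>f x\<bar> \<le> A"
  shows "(\<integral>x. f x \<partial>rho t) = (\<integral>x. f x * p t x \<partial>lborel) + (\<integral>x. f x \<partial>\<mu> t)"
    and "(\<integral>x. f x \<partial>rho t) = (\<integral>x. smear n f x \<partial>\<mu> t)"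
proof -
  note [measurable] = f(1)
  have [measurable]: "p t \<in> borel_measurable borel" by (intro p_measurable t)
  have i: "integrable lborel (\<lambda>x. f x * p t x)"
    using fubini_K(1)[OF t f, of "\<lambda>_. 1" 1] by (simp add: pp_def)
  have i1: "integrable (density lborel (\<lambda>x. ennreal (p t x))) f"
    using i p_nonneg by (subst integrable_density) (auto simp: mult.commute)
  have i2: "integrable (\<mu> t) f" by (rule integrable_mu[OF t f])
  show 1: "(\<integral>x. f x \<partial>rho t) = (\<integral>x. f x * p t x \<partial>lborel) + (\<integral>x. f x \<partial>\<mu> t)"
    unfolding rho_def using sets_mu[OF t] i1 i2 p_nonneg
    by (subst integral_msum(2)) (auto simp: integral_density mult.commute)
  interpret finite_measure "\<mu> t" using finite_mu[OF t] .
  have [measurable_cong]: "sets (\<mu> t) = sets borel" by (rule sets_mu[OF t])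
  have "integrable (\<mu> t) (\<lambda>y. \<integral>x. f x * Kn n (x - y) \<partial>lborel)"
  proof (rule finite_measure_integrable_bounded[OF finite_mu[OF t]])
    show "(\<lambda>y. \<integral>x. f x * Kn n (x - y) \<partial>lborel) \<in> borel_measurable (\<mu> t)" by measurable
    show "\<bar>\<integral>x. f x * Kn n (x - y) \<partial>lborel\<bar> \<le> A * \<kappa>" for y
      using conv_bound[OF f, of y] smear_def[of n f y] smear_shift[of f y] by simp
  qed
  then have "(\<integral>x. smear n f x \<partial>\<mu> t) = (\<integral>x. f x \<partial>\<mu> t) + (\<integral>y. (\<integral>x. f x * Kn n (x - y) \<partial>lborel) \<partial>\<mu> t)"
    unfolding smear_def using i2 by simp
  then show "(\<integral>x. f x \<partial>rho t) = (\<integral>x. smear n f x \<partial>\<mu> t)"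
    unfolding 1 using fubini_K(2)[OF t f, of "\<lambda>_. 1" 1] by (simp add: pp_def)
qed

lemma G_rho:
  assumes "0 \<le> t"
  shows "G t x = measure (rho t) {..<x}"
proof -
  \<comment> \<open>\<open>GG\<close> takes a closed half-line for \<open>p\<close> and an open one
    for \<open>\<mu>\<close>; for the Lebesgue part the point \<open>x\<close> makes no
    difference.\<close>
  have "(LINT y:{..x}|lborel. p t y) = (LINT y:{..<x}|lborel. p t y)"
    unfolding set_lebesgue_integral_def
  proof (rule integral_cong_AE)
    show "AE y in lborel. indicat_real {..x} y *\<^sub>R p t y = indicat_real {..<x} y *\<^sub>R p t y"
      using AE_lborel_singleton[of x] by eventually_elim (auto simp: indicator_def)
  qed (use p_measurable[OF assms] in measurable)
  then show ?thesis by (simp add: GG_def measure_rho assms)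
qed

lemma G_diff:
  assumes "0 \<le> t" "x \<le> y"
  shows "G t y - G t x = measure (rho t) {x..<y}"
proof -
  interpret finite_measure "rho t" by (rule finite_rho[OF assms(1)])
  have "{..<y} - {..<x} = {x..<y}" by auto
  then show ?thesis
    using finite_measure_Diff[of "{..<y}" "{..<x}"] assms by (simp add: G_rho)
qed

text \<open>The part \<open>p dx\<close> alone provides the growth, and \<open>\<mu> t\<close> can
  only add to it. This lower bound becomes the Lipschitz bound of the inverse.\<close>

lemma G_diff_ge:
  assumes "0 \<le> t" "x \<le> y" "\<And>z. x \<le> z \<Longrightarrow> z \<le> y \<Longrightarrow> c \<le> p t z"
  shows "c * (y - x) \<le> G t y - G t x"
proof -
  have "c * (y - x) = (\<integral>z. indicator {x..<y} z * c \<partial>lborel)"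
    using assms(2) by simp
  also have "\<dots> \<le> (\<integral>z. indicator {x..<y} z *\<^sub>R p t z \<partial>lborel)"
  proof (intro integral_mono integrable_mult_indicator p_integrable assms)
    show "integrable lborel (\<lambda>z. indicator {x..<y} z * c)"
      using assms(2) by (intro integrable_mult_left integrable_real_indicator) auto
    show "indicator {x..<y} z * c \<le> indicator {x..<y} z *\<^sub>R p t z" for z
      using assms(3)[of z] by (auto simp: indicator_def)
  qed auto
  also have "\<dots> = (LINT z:{x..<y}|lborel. p t z)" by (simp add: set_lebesgue_integral_def)
  also have "\<dots> \<le> measure (rho t) {x..<y}" using assms by (simp add: measure_rho)
  finally show ?thesis using G_diff assms by simp
qed

lemma G_mono: "0 \<le> t \<Longrightarrow> x \<le> y \<Longrightarrow> G t x \<le> G t y"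
  using G_diff[of t x y] measure_nonneg[of "rho t" "{x..<y}"] by linarith

lemma G_strict_mono:
  assumes "0 \<le> t" "0 < C" "x < y"
  shows "G t x < G t y"
proof -
  obtain z where z: "z \<in> {x..y}" "\<forall>w\<in>{x..y}. p t z \<le> p t w"
    using continuous_attains_inf[of "{x..y}" "p t"] p_cont[OF assms(1)] assms(3) by auto
  have "0 < p t z * (y - x)" using p_pos assms by auto
  also have "\<dots> \<le> G t y - G t x" using z assms by (intro G_diff_ge) auto
  finally show ?thesis by simp
qed

text \<open>Left continuity, in the one-sided form used for the Galois connection; it holds because
  \<open>G\<close> measures open half-lines.\<close>

lemma G_left:
  assumes t: "0 \<le> t" and le: "\<And>y. y < x \<Longrightarrow> G t y \<le> c"
  shows "G t x \<le> c"
proof -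
  interpret finite_measure "rho t" by (rule finite_rho[OF t])
  have "(\<Union>k. {..<x - 1 / real (Suc k)}) = {..<x}"
  proof (intro equalityI subsetI)
    fix y assume "y \<in> {..<x}"
    then obtain k where "1 / real (Suc k) < x - y" using nat_approx_posE[of "x - y"] by auto
    then show "y \<in> (\<Union>k. {..<x - 1 / real (Suc k)})" by (auto simp del: of_nat_Suc intro!: exI[of _ k])
  qed (auto intro: less_trans)
  moreover have "(\<lambda>k. measure (rho t) {..<x - 1 / real (Suc k)}) \<longlonglongrightarrow> measure (rho t) (\<Union>k. {..<x - 1 / real (Suc k)})"
    by (intro finite_Lim_measure_incseq) (auto simp: incseq_def field_simps)
  ultimately have "(\<lambda>k. G t (x - 1 / real (Suc k))) \<longlonglongrightarrow> G t x" by (simp add: G_rho t)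
  then show ?thesis by (rule LIMSEQ_le_const2) (auto intro!: le)
qed

lemma G_low:
  assumes t: "0 \<le> t" and e: "0 < e"
  shows "\<exists>x. G t x < e"
proof -
  interpret finite_measure "rho t" by (rule finite_rho[OF t])
  have "(\<lambda>k. measure (rho t) {..<- real k}) \<longlonglongrightarrow> measure (rho t) (\<Inter>k. {..<- real k})"
    by (intro finite_Lim_measure_decseq) (auto simp: decseq_def)
  moreover have "(\<Inter>k. {..<- real k}) = {}"
  proof -
    have "\<exists>k. \<not> x < - real k" for x using reals_Archimedean2[of "- x"] by (metis minus_less_iff not_less_iff_gr_or_eq)
    then show ?thesis by auto
  qed
  ultimately have "\<forall>\<^sub>F k in sequentially. measure (rho t) {..<- real k} < e" using e by (intro order_tendstoD) auto
  then show ?thesis using t by (auto simp: G_rho eventually_sequentially)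
qed

lemma G_high:
  assumes t: "0 \<le> t" and e: "e < BC n \<mu>"
  shows "\<exists>x. e < G t x"
proof -
  interpret finite_measure "rho t" by (rule finite_rho[OF t])
  have "(\<lambda>k. measure (rho t) {..<real k}) \<longlonglongrightarrow> measure (rho t) (\<Union>k. {..<real k})"
    by (intro finite_Lim_measure_incseq) (auto simp: incseq_def)
  moreover have "(\<Union>k. {..<real k}) = UNIV" using reals_Archimedean2 by auto
  ultimately have "\<forall>\<^sub>F k in sequentially. e < measure (rho t) {..<real k}"
    using e measure_rho_UNIV[OF t] by (intro order_tendstoD) auto
  then show ?thesis using t by (auto simp: G_rho eventually_sequentially)
qed

lemma G_in_I: "0 \<le> t \<Longrightarrow> 0 < C \<Longrightarrow> G t x \<in> I"
proof -
  assume a: "0 \<le> t" "0 < C"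
  have "0 \<le> G t (x - 1)" using a by (simp add: G_rho)
  also have "\<dots> < G t x" using a by (intro G_strict_mono) auto
  finally have 1: "0 < G t x" .
  interpret finite_measure "rho t" by (rule finite_rho[OF a(1)])
  have "G t x < G t (x + 1)" using a by (intro G_strict_mono) auto
  also have "\<dots> \<le> BC n \<mu>" using a bounded_measure measure_rho_UNIV[OF a(1)] by (simp add: G_rho finite_measure_mono)
  finally show ?thesis using 1 by simp
qed

section \<open>The inverse \<open>chi\<close> of \<open>G\<close>\<close>

lemma I_C_pos: "\<eta> \<in> I \<Longrightarrow> 0 < C"
  using C_nonneg BC_eq by (cases "C = 0") auto

text \<open>Left continuity of \<open>G t\<close> gives one direction and strict monotonicity the
  other. The order properties of \<open>\<xi> t\<close> are read off from this adjunction, also in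
  the presence of atoms.\<close>

lemma chi_galois:
  assumes t: "0 \<le> t" and eta: "\<eta> \<in> I"
  shows "x \<le> \<xi> t \<eta> \<longleftrightarrow> G t x \<le> \<eta>"
proof -
  have C: "0 < C" using I_C_pos[OF eta] .
  obtain a where a: "G t a < \<eta>" using G_low[OF t] eta by auto
  obtain b where b: "\<eta> < G t b" using G_high[OF t] eta by auto
  have ub: "x \<le> b" if "G t x < \<eta>" for x
    using that b G_mono[OF t, of b x] by (cases "x \<le> b") auto
  then have bdd: "bdd_above {x. G t x < \<eta>}" by (auto simp: bdd_above_def)
  have low: "G t x < \<eta>" if x: "x < \<xi> t \<eta>" for x
  proof -
    have "{x. G t x < \<eta>} \<noteq> {}" using a by auto
    from less_cSup_iff[OF this bdd, of x] obtain z where "z \<in> {x. G t x < \<eta>}" "x < z"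
      using x unfolding chi_def by auto
    then show ?thesis using G_mono[OF t, of x z] by auto
  qed
  show ?thesis
  proof
    assume x: "x \<le> \<xi> t \<eta>"
    show "G t x \<le> \<eta>" by (rule G_left[OF t]) (rule less_imp_le[OF low[OF less_le_trans[OF _ x]]])
  next
    assume x: "G t x \<le> \<eta>"
    show "x \<le> \<xi> t \<eta>"
    proof (rule dense_le)
      fix y assume "y < x"
      then have "G t y < \<eta>" using G_strict_mono[OF t C, of y x] x by simp
      then show "y \<le> \<xi> t \<eta>" unfolding chi_def by (intro cSup_upper bdd) auto
    qed
  qed
qed

lemma chi_less_iff: "0 \<le> t \<Longrightarrow> \<eta> \<in> I \<Longrightarrow> \<xi> t \<eta> < x \<longleftrightarrow> \<eta> < G t x"
  using chi_galois[of t \<eta> x] by (auto simp: not_le[symmetric])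

text \<open>This composition is the identity even if \<open>G t\<close> jumps, since
  \<open>G t\<close> is strictly increasing; the opposite one is available only without
  atoms.\<close>

lemma chi_G: "0 \<le> t \<Longrightarrow> 0 < C \<Longrightarrow> \<xi> t (G t x) = x"
proof -
  assume a: "0 \<le> t" "0 < C"
  have "y \<le> \<xi> t (G t x) \<longleftrightarrow> y \<le> x" for y
    using chi_galois[OF a(1) G_in_I[OF a], of y x] G_strict_mono[OF a] G_mono[OF a(1)] by (meson not_le)
  then show ?thesis by (meson order_antisym order_refl)
qed

lemma chi_mono: "0 \<le> t \<Longrightarrow> \<eta> \<in> I \<Longrightarrow> \<eta>' \<in> I \<Longrightarrow> \<eta> \<le> \<eta>' \<Longrightarrow> \<xi> t \<eta> \<le> \<xi> t \<eta>'"
  using chi_galois[of t] by (meson order_refl order_trans)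

text \<open>\<open>\<xi> t\<close> maps \<open>{a..b}\<close> into a compact interval, on which
  \<open>p t\<close> has a positive minimum \<open>c\<close>. There \<open>G t\<close> grows at
  least at the rate \<open>c\<close>, so its inverse is Lipschitz with constant
  \<open>1 / c\<close>.\<close>

lemma chi_lipschitz_local:
  assumes t: "0 \<le> t" and ab: "0 < a" "b < BC n \<mu>"
  shows "\<exists>L>0. \<forall>x\<in>{a..b}. \<forall>y\<in>{a..b}. \<bar>\<xi> t x - \<xi> t y\<bar> \<le> L * \<bar>x - y\<bar>"
proof (cases "a \<le> b")
  case True
  have abI: "\<eta> \<in> I" if "\<eta> \<in> {a..b}" for \<eta> using that ab by auto
  have C: "0 < C" using I_C_pos[of a] abI[of a] True by auto
  have "\<xi> t a \<le> \<xi> t b" using abI True by (intro chi_mono t) auto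
  then obtain z where z: "\<forall>w\<in>{\<xi> t a..\<xi> t b}. p t z \<le> p t w"
    using continuous_attains_inf[of "{\<xi> t a..\<xi> t b}" "p t"] p_cont[OF t] by auto
  define c where "c = p t z"
  have c: "c > 0" unfolding c_def by (rule p_pos[OF t C])
  have *: "c * (\<xi> t y - \<xi> t x) \<le> y - x" if xy: "x \<in> {a..b}" "y \<in> {a..b}" "x \<le> y" for x y
  proof (cases "\<xi> t x < \<xi> t y")
    case True
    \<comment> \<open>An atom at \<open>\<xi> t x\<close> may leave \<open>G t (\<xi> t x)\<close>
      strictly below \<open>x\<close>. Hence \<open>G t\<close> is evaluated at points
      \<open>w\<close> to the right, where \<open>x < G t w\<close>, and \<open>w\<close> then
      approaches \<open>\<xi> t x\<close>.\<close>
    have "\<xi> t y - (y - x) / c \<le> w" if w: "\<xi> t x < w" "w < \<xi> t y" for w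
    proof -
      have "x < G t w" using chi_less_iff[OF t abI[OF xy(1)], of w] w by simp
      moreover have "G t (\<xi> t y) \<le> y" using chi_galois[OF t abI[OF xy(2)], of "\<xi> t y"] by simp
      moreover have "c * (\<xi> t y - w) \<le> G t (\<xi> t y) - G t w"
      proof (rule G_diff_ge[OF t])
        fix v assume v: "w \<le> v" "v \<le> \<xi> t y"
        have "\<xi> t a \<le> \<xi> t x" "\<xi> t y \<le> \<xi> t b" using abI xy \<open>a \<le> b\<close> by (auto intro!: chi_mono t)
        then show "c \<le> p t v" using z v w unfolding c_def by auto
      qed (use w in simp)
      ultimately have "c * (\<xi> t y - w) \<le> y - x" by simp
      then show ?thesis using c by (simp add: field_simps)
    qed
    then have "\<xi> t y - (y - x) / c \<le> \<xi> t x" using True by (intro dense_ge_bounded[of "\<xi> t x" "\<xi> t y"]) auto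
    then show ?thesis using c by (simp add: field_simps)
  next
    case False
    then have "c * (\<xi> t y - \<xi> t x) \<le> 0" using c by (intro mult_nonneg_nonpos) auto
    then show ?thesis using xy by simp
  qed
  have "\<bar>\<xi> t x - \<xi> t y\<bar> \<le> 1 / c * \<bar>x - y\<bar>" if "x \<in> {a..b}" "y \<in> {a..b}" for x y
  proof (cases "x \<le> y")
    case True
    then show ?thesis using *[OF that True] chi_mono[OF t abI[OF that(1)] abI[OF that(2)]] c
      by (simp add: field_simps)
  next
    case False
    then show ?thesis using *[OF that(2,1)] chi_mono[OF t abI[OF that(2)] abI[OF that(1)]] c
      by (simp add: field_simps)
  qed
  then show ?thesis using c by (intro exI[of _ "1 / c"]) auto
qed (auto intro: exI[of _ 1])

lemma chi_isCont:
  assumes t: "0 \<le> t" and eta: "\<eta> \<in> I"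
  shows "isCont (\<xi> t) \<eta>"
proof -
  define a where "a = \<eta> / 2"
  define b where "b = (\<eta> + BC n \<mu>) / 2"
  have ab: "0 < a" "a < \<eta>" "\<eta> < b" "b < BC n \<mu>" using eta by (auto simp: a_def b_def)
  obtain L where L: "L > 0" "\<forall>x\<in>{a..b}. \<forall>y\<in>{a..b}. \<bar>\<xi> t x - \<xi> t y\<bar> \<le> L * \<bar>x - y\<bar>"
    using chi_lipschitz_local[OF t ab(1,4)] by blast
  have "L-lipschitz_on {a..b} (\<xi> t)" using L by (auto simp: lipschitz_on_def dist_real_def)
  then have "continuous_on {a..b} (\<xi> t)" by (rule lipschitz_on_continuous_on)
  then show ?thesis using ab by (intro continuous_on_interior[of "{a..b}"]) auto
qed

lemma chi_cont: "0 \<le> t \<Longrightarrow> continuous_on I (\<xi> t)"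
  by (intro continuous_at_imp_continuous_on ballI chi_isCont)

abbreviation "lamI \<equiv> restrict_space lborel I"

lemma finite_lamI: "finite_measure lamI"
proof (rule finite_measureI)
  have "emeasure lborel I \<le> emeasure lborel {0..BC n \<mu>}" by (intro emeasure_mono) auto
  also have "\<dots> < \<infinity>" by (simp add: emeasure_lborel_Icc_eq)
  finally show "emeasure lamI (space lamI) \<noteq> \<infinity>"
    by (simp add: emeasure_restrict_space space_restrict_space)
qed

lemma chi_measurable: "0 \<le> t \<Longrightarrow> \<xi> t \<in> borel_measurable lamI"
  by (simp add: borel_measurable_restrict_space_iff)
     (use borel_measurable_continuous_on_indicator[OF _ chi_cont[of t]] in \<open>auto\<close>)

text \<open>It is enough to compare on the half-lines \<open>{..<x}\<close>, which generate the
  Borel sets: there the preimage is \<open>{0<..<G t x}\<close>, of length \<open>G t x\<close>.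
  Without mass the interval is empty and both measures vanish.\<close>

lemma distr_chi:
  assumes t: "0 \<le> t"
  shows "distr lamI borel (\<xi> t) = rho t"
proof (cases "C = 0")
  case True
  then have I0: "I = {}" using BC_eq by auto
  show ?thesis
  proof (rule measure_eqI)
    fix A assume "A \<in> sets (distr lamI borel (\<xi> t))"
    then have A: "A \<in> sets borel" by simp
    interpret finite_measure "rho t" by (rule finite_rho[OF t])
    have "measure (rho t) A \<le> measure (rho t) UNIV" by (intro finite_measure_mono) auto
    also have "\<dots> = 0" using measure_rho_UNIV[OF t] BC_eq True by simp
    finally have "emeasure (rho t) A = 0" using measure_nonneg[of "rho t" A] by (simp add: emeasure_eq_measure)
    moreover have "emeasure (distr lamI borel (\<xi> t)) A = 0"
      using A chi_measurable[OF t] by (subst emeasure_distr) (auto simp: emeasure_restrict_space I0)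
    ultimately show "emeasure (distr lamI borel (\<xi> t)) A = emeasure (rho t) A" by simp
  qed simp
next
  case False
  then have C: "0 < C" using C_nonneg by simp
  show ?thesis
  proof (rule measure_eqI_generator_eq[where E = "range lessThan" and \<Omega> = UNIV and A = "\<lambda>k. {..<real k}"])
    show "Int_stable (range lessThan :: real set set)"
    proof -
      have "{..<a} \<inter> {..<b} = {..<min a b}" for a b :: real by auto
      then show ?thesis by (auto simp: Int_stable_def)
    qed
    show "sets (distr lamI borel (\<xi> t)) = sigma_sets UNIV (range lessThan)" "sets (rho t) = sigma_sets UNIV (range lessThan)"
      by (simp_all add: borel_Iio)
    show eq: "emeasure (distr lamI borel (\<xi> t)) X = emeasure (rho t) X" if "X \<in> range lessThan" for X
    proof -
      obtain x where X: "X = {..<x}" using \<open>X \<in> range lessThan\<close> by auto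
      interpret finite_measure "rho t" by (rule finite_rho[OF t])
      have "\<xi> t -` {..<x} \<inter> space lamI = {0<..<G t x}"
        using chi_less_iff[OF t] G_in_I[OF t C, of x] by (auto simp: space_restrict_space)
      moreover have "emeasure lamI {0<..<G t x} = emeasure lborel {0<..<G t x}"
        using G_in_I[OF t C, of x] by (intro emeasure_restrict_space) auto
      ultimately have "emeasure (distr lamI borel (\<xi> t)) X = emeasure lborel {0<..<G t x}"
        unfolding X using chi_measurable[OF t] by (subst emeasure_distr) auto
      also have "\<dots> = ennreal (G t x)" using G_in_I[OF t C, of x] by simp
      also have "\<dots> = emeasure (rho t) X" by (simp add: X G_rho t emeasure_eq_measure)
      finally show ?thesis .
    qed
    show "emeasure (distr lamI borel (\<xi> t)) {..<real k} \<noteq> \<infinity>" for k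
    proof -
      interpret finite_measure "rho t" by (rule finite_rho[OF t])
      show ?thesis by (subst eq) (auto)
    qed
    show "(\<Union>i. {..<real i}) = UNIV" using reals_Archimedean2 by auto
  qed auto
qed

lemma integral_chi:
  fixes f :: "real \<Rightarrow> real"
  assumes "0 \<le> t" "f \<in> borel_measurable borel"
  shows "(\<integral>\<eta>. f (\<xi> t \<eta>) \<partial>lamI) = (\<integral>x. f x \<partial>rho t)"
  using integral_distr[OF chi_measurable[OF assms(1)], of f] assms distr_chi by simp

end

section \<open>Regularity in time\<close>

text \<open>Subtracting the tangent at \<open>z\<close> leaves a function whose derivative is at
  most \<open>L * \<bar>h\<bar>\<close> in absolute value between \<open>z - h\<close> and
  \<open>z\<close>.\<close>

lemma DERIV_second_order_bound:
  fixes \<Phi> \<Phi>' :: "real \<Rightarrow> real"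
  assumes "\<And>x. (\<Phi> has_real_derivative \<Phi>' x) (at x)" "\<And>x y. \<bar>\<Phi>' x - \<Phi>' y\<bar> \<le> L * \<bar>x - y\<bar>"
  shows "\<bar>\<Phi> (z - h) - \<Phi> z + h * \<Phi>' z\<bar> \<le> L * h\<^sup>2"
proof -
  have L: "0 \<le> L" using assms(2)[of 1 0] by simp
  define S where "S = {min z (z - h)..max z (z - h)}"
  have "norm ((\<Phi> (z - h) - \<Phi>' z * (z - h)) - (\<Phi> z - \<Phi>' z * z)) \<le> (L * \<bar>h\<bar>) * norm (z - h - z)"
  proof (rule field_differentiable_bound[of S "\<lambda>s. \<Phi> s - \<Phi>' z * s" "\<lambda>s. \<Phi>' s - \<Phi>' z"])
    fix s assume s: "s \<in> S"
    show "((\<lambda>s. \<Phi> s - \<Phi>' z * s) has_field_derivative \<Phi>' s - \<Phi>' z) (at s within S)"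
      by (rule has_field_derivative_at_within) (auto intro!: derivative_eq_intros assms(1))
    have "\<bar>\<Phi>' s - \<Phi>' z\<bar> \<le> L * \<bar>s - z\<bar>" by (rule assms(2))
    also have "\<dots> \<le> L * \<bar>h\<bar>" using s L by (intro mult_left_mono) (auto simp: S_def)
    finally show "norm (\<Phi>' s - \<Phi>' z) \<le> L * \<bar>h\<bar>" by simp
  qed (auto simp: S_def)
  then show ?thesis by (simp add: algebra_simps power2_eq_square abs_mult)
qed

context hs
begin

text \<open>Function and measure vary at once. The translation is linearised: its first-order term
  is integrated against \<open>\<mu> r\<close>, where weak continuity applies, and the remainder is
  quadratic in \<open>c r - c t\<close>. Only differentiability of \<open>c\<close> at
  \<open>t\<close> enters, so the lemma covers uniform motion as well as motion along
  \<open>chi\<close>.\<close>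

lemma move_DERIV:
  assumes \<Phi>: "\<And>x. (\<Phi> has_real_derivative \<Phi>' x) (at x)" "\<And>x. \<bar>\<Phi> x\<bar> \<le> A" "\<And>x. \<bar>\<Phi>' x\<bar> \<le> A'"
    and lip: "\<And>x y. \<bar>\<Phi>' x - \<Phi>' y\<bar> \<le> L * \<bar>x - y\<bar>"
    and c: "(c has_real_derivative c') (at t)" and t: "0 < t"
  shows "((\<lambda>r. \<integral>y. \<Phi> (y - c r) \<partial>\<mu> r) has_real_derivative (\<integral>y. (u t y - c') * \<Phi>' (y - c t) \<partial>\<mu> t)) (at t)"
proof -
  have cont': "continuous_on S \<Phi>'" for S by (rule lipschitz_cont[OF lip])
  have cont: "continuous_on S \<Phi>" for S
    by (meson DERIV_isCont continuous_at_imp_continuous_on \<Phi>(1))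
  have [measurable]: "\<Phi> \<in> borel_measurable borel" "\<Phi>' \<in> borel_measurable borel" "u t \<in> borel_measurable borel"
    using t by (auto intro!: borel_measurable_continuous_onI cont cont' u_cont)
  have sc: "continuous_on UNIV (\<lambda>y. \<Phi>' (y - a))" for a
    by (intro continuous_on_compose2[OF cont'[of UNIV]] continuous_intros) auto
  define m where "m r = (\<integral>y. \<Phi> (y - c t) \<partial>\<mu> r)" for r
  define W where "W r = (\<integral>y. \<Phi>' (y - c t) \<partial>\<mu> r)" for r
  define H where "H r = (\<integral>y. \<Phi> (y - c r) \<partial>\<mu> r)" for r
  define R where "R r = H r - m r + (c r - c t) * W r" for r
  have mD: "(m has_real_derivative (\<integral>y. u t y * \<Phi>' (y - c t) \<partial>\<mu> t)) (at t)"
    unfolding m_def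
  proof (rule transport_DERIV[OF _ sc])
    show "((\<lambda>y. \<Phi> (y - c t)) has_real_derivative \<Phi>' (x - c t)) (at x)" for x
      using DERIV_shift[of \<Phi> "\<Phi>' (x - c t)" x "- c t"] \<Phi>(1) by simp
  qed (use \<Phi> t in auto)
  have "bounded (range (\<lambda>y. \<Phi>' (y - c t)))" by (rule boundedI[of _ A']) (use \<Phi> in auto)
  then have "continuous_on {0..} W" unfolding W_def by (intro weak_cont sc)
  then have Wc: "(W \<longlongrightarrow> W t) (at t)"
    using t continuous_on_interior[of "{0..}" W t] by (simp add: isCont_def)
  have Rb: "\<bar>R r\<bar> \<le> L * (c r - c t)\<^sup>2 * C" if r: "0 \<le> r" for r
  proof -
    have i: "integrable (\<mu> r) (\<lambda>y. \<Phi> (y - a))" for a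
      using r \<Phi> by (intro integrable_mu[of _ _ A]) auto
    have i': "integrable (\<mu> r) (\<lambda>y. \<Phi>' (y - a))" for a
      using r \<Phi> by (intro integrable_mu[of _ _ A']) auto
    have "\<bar>\<integral>y. \<Phi> (y - c r) - \<Phi> (y - c t) + (c r - c t) * \<Phi>' (y - c t) \<partial>\<mu> r\<bar> \<le> L * (c r - c t)\<^sup>2 * C"
    proof (rule integral_mu_bound_C[OF r])
      show "\<bar>\<Phi> (y - c r) - \<Phi> (y - c t) + (c r - c t) * \<Phi>' (y - c t)\<bar> \<le> L * (c r - c t)\<^sup>2" for y
        using DERIV_second_order_bound[OF \<Phi>(1) lip, of "y - c t" "c r - c t"] by simp
    qed measurable
    then show ?thesis unfolding R_def H_def m_def W_def using i i' by simp
  qed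
  have cq: "((\<lambda>r. (c r - c t) / (r - t)) \<longlongrightarrow> c') (at t)" using c unfolding has_field_derivative_iff .
  have cc: "((\<lambda>r. c r - c t) \<longlongrightarrow> 0) (at t)"
    using DERIV_isCont[OF c] by (simp add: isCont_def LIM_zero_iff)
  have "((\<lambda>r. R r / (r - t)) \<longlongrightarrow> 0) (at t)"
  proof (rule Lim_null_comparison)
    have "((\<lambda>r. L * C * \<bar>(c r - c t) / (r - t)\<bar> * \<bar>c r - c t\<bar>) \<longlongrightarrow> L * C * \<bar>c'\<bar> * \<bar>0\<bar>) (at t)"
      by (intro tendsto_intros cq cc)
    then show "((\<lambda>r. L * C * \<bar>(c r - c t) / (r - t)\<bar> * \<bar>c r - c t\<bar>) \<longlongrightarrow> 0) (at t)" by simp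
    have "\<forall>\<^sub>F r in at t. 0 < r" using t by (intro order_tendstoD(1)[of "\<lambda>r. r" t]) auto
    then show "\<forall>\<^sub>F r in at t. norm (R r / (r - t)) \<le> L * C * \<bar>(c r - c t) / (r - t)\<bar> * \<bar>c r - c t\<bar>"
    proof eventually_elim
      case (elim r)
      have "\<bar>R r\<bar> / \<bar>r - t\<bar> \<le> (L * (c r - c t)\<^sup>2 * C) / \<bar>r - t\<bar>"
        using Rb[of r] elim by (intro divide_right_mono) auto
      also have "\<dots> = L * C * \<bar>(c r - c t) / (r - t)\<bar> * \<bar>c r - c t\<bar>"
        by (simp add: abs_divide power2_eq_square abs_mult[symmetric])
      finally show ?case by (simp add: abs_divide)
    qed
  qed
  then have "((\<lambda>r. (m r - m t) / (r - t) - (c r - c t) / (r - t) * W r + R r / (r - t)) \<longlongrightarrow>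
      (\<integral>y. u t y * \<Phi>' (y - c t) \<partial>\<mu> t) - c' * W t + 0) (at t)"
    by (intro tendsto_intros cq Wc mD[unfolded has_field_derivative_iff])
  moreover have "(m r - m t) / (r - t) - (c r - c t) / (r - t) * W r + R r / (r - t) = (H r - H t) / (r - t)" for r
    by (simp add: R_def H_def[of t] m_def[of t] diff_divide_distrib add_divide_distrib left_diff_distrib)
  moreover have "(\<integral>y. u t y * \<Phi>' (y - c t) \<partial>\<mu> t) - c' * W t = (\<integral>y. (u t y - c') * \<Phi>' (y - c t) \<partial>\<mu> t)"
  proof -
    have t0: "0 \<le> t" using t by simp
    obtain M where M: "\<And>x. \<bar>u t x\<bar> \<le> M" by (rule u_bdd_at[OF t0]) blast
    have A': "0 \<le> A'" using \<Phi>(3)[of 0] by auto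
    have "integrable (\<mu> t) (\<lambda>y. u t y * \<Phi>' (y - c t))"
      using t0 M \<Phi>(3) A' by (intro integrable_mu[of _ _ "M * A'"])
        (auto simp: abs_mult intro!: mult_mono order_trans[OF abs_ge_zero M])
    moreover have "integrable (\<mu> t) (\<lambda>y. \<Phi>' (y - c t))"
      using t0 \<Phi>(3) by (intro integrable_mu[of _ _ A']) auto
    ultimately show ?thesis unfolding W_def by (simp add: left_diff_distrib)
  qed
  ultimately show ?thesis unfolding has_field_derivative_iff H_def[symmetric] by simp
qed

lemma move_cont:
  assumes \<Phi>: "\<And>x. (\<Phi> has_real_derivative \<Phi>' x) (at x)" "\<And>x. \<bar>\<Phi> x\<bar> \<le> A" "\<And>x. \<bar>\<Phi>' x\<bar> \<le> A'"
    and c: "continuous_on {0..} c"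
  shows "continuous_on {0..} (\<lambda>r. \<integral>y. \<Phi> (y - c r) \<partial>\<mu> r)"
  unfolding continuous_on_def
proof (intro ballI)
  fix t :: real assume t: "t \<in> {0..}"
  have cont: "continuous_on S \<Phi>" for S
    by (meson DERIV_isCont continuous_at_imp_continuous_on \<Phi>(1))
  have [measurable]: "\<Phi> \<in> borel_measurable borel" by (intro borel_measurable_continuous_onI cont)
  have "bounded (range (\<lambda>y. \<Phi> (y - c t)))" by (rule boundedI[of _ A]) (use \<Phi> in auto)
  moreover have "continuous_on UNIV (\<lambda>y. \<Phi> (y - c t))"
    by (intro continuous_on_compose2[OF cont[of UNIV]] continuous_intros) auto
  ultimately have 1: "((\<lambda>r. \<integral>y. \<Phi> (y - c t) \<partial>\<mu> r) \<longlongrightarrow> (\<integral>y. \<Phi> (y - c t) \<partial>\<mu> t)) (at t within {0..})"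
    using weak_cont[of "\<lambda>y. \<Phi> (y - c t)"] t by (auto simp: continuous_on_def)
  have 2: "((\<lambda>r. (\<integral>y. \<Phi> (y - c r) \<partial>\<mu> r) - (\<integral>y. \<Phi> (y - c t) \<partial>\<mu> r)) \<longlongrightarrow> 0) (at t within {0..})"
  proof (rule Lim_null_comparison)
    have "((\<lambda>r. A' * \<bar>c r - c t\<bar> * C) \<longlongrightarrow> A' * \<bar>c t - c t\<bar> * C) (at t within {0..})"
      using c t by (intro tendsto_intros) (auto simp: continuous_on_def)
    then show "((\<lambda>r. A' * \<bar>c r - c t\<bar> * C) \<longlongrightarrow> 0) (at t within {0..})" by simp
    have "norm ((\<integral>y. \<Phi> (y - c r) \<partial>\<mu> r) - (\<integral>y. \<Phi> (y - c t) \<partial>\<mu> r)) \<le> A' * \<bar>c r - c t\<bar> * C" if r: "0 \<le> r" for r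
    proof -
      have i: "integrable (\<mu> r) (\<lambda>y. \<Phi> (y - a))" for a
        using r \<Phi> by (intro integrable_mu[of _ _ A]) auto
      have "\<bar>\<integral>y. \<Phi> (y - c r) - \<Phi> (y - c t) \<partial>\<mu> r\<bar> \<le> A' * \<bar>c r - c t\<bar> * C"
      proof (rule integral_mu_bound_C[OF r])
        show "\<bar>\<Phi> (y - c r) - \<Phi> (y - c t)\<bar> \<le> A' * \<bar>c r - c t\<bar>" for y
          using lipschitz_of_bounded_deriv[OF \<Phi>(1,3), of "y - c r" "y - c t"] by (simp add: abs_minus_commute)
      qed measurable
      then show ?thesis using i by simp
    qed
    then show "\<forall>\<^sub>F r in at t within {0..}. norm ((\<integral>y. \<Phi> (y - c r) \<partial>\<mu> r) - (\<integral>y. \<Phi> (y - c t) \<partial>\<mu> r)) \<le> A' * \<bar>c r - c t\<bar> * C"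
      by (auto simp: eventually_at_filter)
  qed
  show "((\<lambda>r. \<integral>y. \<Phi> (y - c r) \<partial>\<mu> r) \<longlongrightarrow> (\<integral>y. \<Phi> (y - c t) \<partial>\<mu> t)) (at t within {0..})"
    using tendsto_add[OF 2 1] by simp
qed

section \<open>Finite speed of propagation\<close>

lemma smear_translate: "smear n f (y + h) = smear n (\<lambda>z. f (z + h)) y"
  by (simp add: smear_shift add.assoc)

text \<open>For a decreasing profile moved with velocity \<open>\<sigma>\<close> the time derivative
  is the integral of \<open>u - \<sigma>\<close> times the smeared and translated \<open>f'\<close>.
  Since \<open>f'\<close> is nonpositive and \<open>M\<close> bounds \<open>u\<close>, it has a
  definite sign for \<open>\<sigma> = - M\<close> and for \<open>\<sigma> = M\<close>.\<close>

lemma speed_test: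
  assumes f: "\<And>x. (f has_real_derivative f' x) (at x)" "\<And>x. \<bar>f x\<bar> \<le> A" "\<And>x. \<bar>f' x\<bar> \<le> A'"
    and lip: "\<And>x y. \<bar>f' x - f' y\<bar> \<le> L * \<bar>x - y\<bar>" and neg: "\<And>x. f' x \<le> 0"
    and st: "0 \<le> s" "s \<le> t" and M: "\<And>r x. 0 \<le> r \<Longrightarrow> r \<le> t \<Longrightarrow> \<bar>u r x\<bar> \<le> M"
  shows "(\<integral>y. f (y + M * (t - s)) \<partial>rho t) \<le> (\<integral>y. f y \<partial>rho s)"
    "(\<integral>y. f y \<partial>rho s) \<le> (\<integral>y. f (y - M * (t - s)) \<partial>rho t)"
proof -
  have f'c: "continuous_on UNIV f'" by (rule lipschitz_cont[OF lip])
  have fc: "continuous_on UNIV f" by (meson DERIV_isCont continuous_at_imp_continuous_on f(1))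
  have [measurable]: "f \<in> borel_measurable borel" "f' \<in> borel_measurable borel"
    by (auto intro!: borel_measurable_continuous_onI fc f'c)
  let ?\<Phi> = "smear n f" and ?\<Phi>' = "smear n f'"
  have D: "(?\<Phi> has_real_derivative ?\<Phi>' x) (at x)" for x by (rule smear_DERIV[OF f(1) f'c f(2,3)])
  have b: "\<bar>?\<Phi> x\<bar> \<le> A * (1 + \<kappa>)" "\<bar>?\<Phi>' x\<bar> \<le> A' * (1 + \<kappa>)" for x
    using smear_bound[of f A] smear_bound[of f' A'] f by auto
  have l: "\<bar>?\<Phi>' x - ?\<Phi>' y\<bar> \<le> L * (1 + \<kappa>) * \<bar>x - y\<bar>" for x y
    by (rule smear_lipschitz[OF lip f(3)])
  define H where "H \<sigma> r = (\<integral>y. ?\<Phi> (y - \<sigma> * (r - s)) \<partial>\<mu> r)" for \<sigma> r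
  have HD: "(H \<sigma> has_real_derivative (\<integral>y. (u r y - \<sigma>) * ?\<Phi>' (y - \<sigma> * (r - s)) \<partial>\<mu> r)) (at r)" if "0 < r" for \<sigma> r
    unfolding H_def
    by (rule move_DERIV[OF D b l _ that]) (auto intro!: derivative_eq_intros)
  have Hc: "continuous_on {s..t} (H \<sigma>)" for \<sigma>
    unfolding H_def using st
    by (intro continuous_on_subset[OF move_cont[OF D b]] continuous_intros) auto
  have Hs: "H \<sigma> s = (\<integral>y. f y \<partial>rho s)" for \<sigma>
    unfolding H_def using integral_rho(2)[OF st(1), of f A] f(2) by simp
  have Ht: "H \<sigma> t = (\<integral>y. f (y - \<sigma> * (t - s)) \<partial>rho t)" for \<sigma>
    unfolding H_def using integral_rho(2)[of t "\<lambda>y. f (y - \<sigma> * (t - s))" A] f(2) st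
      smear_translate[of f _ "- \<sigma> * (t - s)"] by simp
  have neg': "?\<Phi>' x \<le> 0" for x by (rule smear_nonpos[OF neg])
  have "H (- M) t \<le> H (- M) s"
  proof (rule DERIV_nonpos_imp_decreasing_open[OF st(2)])
    fix r assume r: "s < r" "r < t"
    have uM: "- M \<le> u r x" "u r x \<le> M" for x using M[of r x] r st by (auto simp: abs_le_iff)
    have "(\<integral>y. - ((u r y - (- M)) * ?\<Phi>' (y - (- M) * (r - s))) \<partial>\<mu> r) \<ge> 0"
    proof (intro Bochner_Integration.integral_nonneg)
      fix y
      have "(u r y - (- M)) * ?\<Phi>' (y - (- M) * (r - s)) \<le> 0"
        using uM(1)[of y] neg' by (intro mult_nonneg_nonpos) auto
      then show "0 \<le> - ((u r y - (- M)) * ?\<Phi>' (y - (- M) * (r - s)))" by simp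
    qed
    then have "(\<integral>y. (u r y - (- M)) * ?\<Phi>' (y - (- M) * (r - s)) \<partial>\<mu> r) \<le> 0" by simp
    then show "\<exists>y. (H (- M) has_real_derivative y) (at r) \<and> y \<le> 0" using HD[of r "- M"] r st by auto
  qed (rule Hc)
  then show "(\<integral>y. f (y + M * (t - s)) \<partial>rho t) \<le> (\<integral>y. f y \<partial>rho s)" unfolding Hs Ht by simp
  have "H M s \<le> H M t"
  proof (rule DERIV_nonneg_imp_increasing_open[OF st(2)])
    fix r assume r: "s < r" "r < t"
    have uM: "- M \<le> u r x" "u r x \<le> M" for x using M[of r x] r st by (auto simp: abs_le_iff)
    have "(\<integral>y. (u r y - M) * ?\<Phi>' (y - M * (r - s)) \<partial>\<mu> r) \<ge> 0"
      using uM neg' by (intro Bochner_Integration.integral_nonneg) (simp add: mult_nonpos_nonpos)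
    then show "\<exists>y. (H M has_real_derivative y) (at r) \<and> 0 \<le> y" using HD[of r M] r st by auto
  qed (rule Hc)
  then show "(\<integral>y. f y \<partial>rho s) \<le> (\<integral>y. f (y - M * (t - s)) \<partial>rho t)" unfolding Hs Ht .
qed

text \<open>The shift by \<open>sqrt k\<close> makes the pointwise limit the indicator of the open half-line, as needed
  for the left-continuous \<open>G\<close>.\<close>

definition step :: "nat \<Rightarrow> real \<Rightarrow> real" where
  "step k z = 1 / 2 - arctan (real k * z + sqrt (real k)) / pi"

lemma step_lim: "(\<lambda>k. step k z) \<longlonglongrightarrow> indicator {..<0} z"
proof (cases "z < 0")
  case True
  have "filterlim (\<lambda>k. real k * z + sqrt (real k)) at_bot sequentially"
    using True by real_asymp
  then have "(\<lambda>k. step k z) \<longlonglongrightarrow> 1 / 2 - (- (pi / 2)) / pi"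
    unfolding step_def by (intro tendsto_intros filterlim_compose[OF tendsto_arctan_at_bot]) auto
  then show ?thesis using True by simp
next
  case False
  have "filterlim (\<lambda>k. real k * z + sqrt (real k)) at_top sequentially"
  proof (rule filterlim_at_top_mono)
    show "filterlim (\<lambda>k. sqrt (real k)) at_top sequentially" by real_asymp
    show "\<forall>\<^sub>F k in sequentially. sqrt (real k) \<le> real k * z + sqrt (real k)" using False by auto
  qed
  then have "(\<lambda>k. step k z) \<longlonglongrightarrow> 1 / 2 - (pi / 2) / pi"
    unfolding step_def by (intro tendsto_intros filterlim_compose[OF tendsto_arctan_at_top]) auto
  then show ?thesis using False by simp
qed

lemma step_bound: "\<bar>step k z\<bar> \<le> 1"
proof -
  have "\<bar>arctan (real k * z + sqrt (real k)) / pi\<bar> \<le> 1 / 2"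
    using arctan_bounded[of "real k * z + sqrt (real k)"] by (auto simp: abs_le_iff field_simps)
  then show ?thesis unfolding step_def by linarith
qed

lemma step_DERIV: "(step k has_real_derivative - (real k / pi * Kn 1 (real k * z + sqrt (real k)))) (at z)"
  unfolding step_def[abs_def]
  by (auto intro!: derivative_eq_intros simp: Kn_def divide_simps)

lemma step_measurable [measurable]: "step k \<in> borel_measurable borel"
  unfolding step_def[abs_def] by measurable

lemma step_integral_lim:
  assumes "0 \<le> t"
  shows "(\<lambda>k. \<integral>y. step k (y - x) \<partial>rho t) \<longlonglongrightarrow> G t x"
proof -
  interpret finite_measure "rho t" by (rule finite_rho[OF assms])
  have "(\<lambda>k. \<integral>y. step k (y - x) \<partial>rho t) \<longlonglongrightarrow> (\<integral>y. indicator {..<0} (y - x) \<partial>rho t)"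
    by (rule integral_dominated_convergence[where w = "\<lambda>_. 1"]) (auto simp: step_bound step_lim)
  also have "(\<integral>y. indicator {..<0} (y - x) \<partial>rho t) = (\<integral>y. indicator {..<x} y \<partial>rho t)"
    by (intro Bochner_Integration.integral_cong) (auto simp: indicator_def)
  finally show ?thesis by (simp add: G_rho assms)
qed

text \<open>In the limit of the profiles \<open>step\<close>, \<open>speed_test\<close> says that no
  mass overtakes a front that moves with the maximal speed \<open>M\<close>.\<close>

lemma G_speed:
  assumes st: "0 \<le> s" "s \<le> t" and M: "\<And>r x. 0 \<le> r \<Longrightarrow> r \<le> t \<Longrightarrow> \<bar>u r x\<bar> \<le> M"
  shows "G t (x - M * (t - s)) \<le> G s x" "G s x \<le> G t (x + M * (t - s))"
proof -
  have T: "(\<integral>y. step k (y + M * (t - s) - x) \<partial>rho t) \<le> (\<integral>y. step k (y - x) \<partial>rho s)"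
      "(\<integral>y. step k (y - x) \<partial>rho s) \<le> (\<integral>y. step k (y - M * (t - s) - x) \<partial>rho t)" for k
  proof -
    \<comment> \<open>\<open>Kn 1\<close> is the derivative of \<open>arctan\<close>, so the
      estimates for the kernel supply the bounds for the profile.\<close>
    let ?f' = "\<lambda>z. - (real k / pi * Kn 1 (real k * (z - x) + sqrt (real k)))"
    have 1: "((\<lambda>y. step k (y - x)) has_real_derivative ?f' z) (at z)" for z
      using DERIV_shift[of "step k" "?f' z" z "- x"] step_DERIV[of k "z - x"] by simp
    have 2: "\<bar>?f' z\<bar> \<le> real k / pi" for z
      using Kn_le_1[of 1 "real k * (z - x) + sqrt (real k)"] less_imp_le[OF Kn_pos[of 1 "real k * (z - x) + sqrt (real k)"]]
      by (auto simp: abs_mult mult_left_le divide_right_mono)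
    have 3: "\<bar>?f' a - ?f' b\<bar> \<le> real k / pi * real k * \<bar>a - b\<bar>" for a b
    proof -
      have "\<bar>?f' a - ?f' b\<bar> = real k / pi * \<bar>Kn 1 (real k * (a - x) + sqrt (real k)) - Kn 1 (real k * (b - x) + sqrt (real k))\<bar>"
        by (subst abs_minus_commute) (simp add: abs_mult right_diff_distrib[symmetric] del: times_divide_eq_left)
      also have "\<dots> \<le> real k / pi * (real 1 * \<bar>(real k * (a - x) + sqrt (real k)) - (real k * (b - x) + sqrt (real k))\<bar>)"
        by (intro mult_left_mono Kn_lipschitz) auto
      also have "\<dots> = real k / pi * real k * \<bar>a - b\<bar>"
        by (simp add: abs_mult right_diff_distrib[symmetric])
      finally show ?thesis .
    qed
    have 4: "?f' z \<le> 0" for z using less_imp_le[OF Kn_pos] by simp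
    note S = speed_test[OF 1 _ 2 3 4 st M, of 1]
    show "(\<integral>y. step k (y + M * (t - s) - x) \<partial>rho t) \<le> (\<integral>y. step k (y - x) \<partial>rho s)"
      using S(1) step_bound by simp
    show "(\<integral>y. step k (y - x) \<partial>rho s) \<le> (\<integral>y. step k (y - M * (t - s) - x) \<partial>rho t)"
      using S(2) step_bound by simp
  qed
  have t: "0 \<le> t" using st by simp
  show "G t (x - M * (t - s)) \<le> G s x"
    by (rule LIMSEQ_le[OF step_integral_lim[OF t] step_integral_lim[OF st(1)]])
       (use T(1) in \<open>auto simp: algebra_simps\<close>)
  show "G s x \<le> G t (x + M * (t - s))"
    by (rule LIMSEQ_le[OF step_integral_lim[OF st(1)] step_integral_lim[OF t]])
       (use T(2) in \<open>auto simp: algebra_simps\<close>)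
qed

text \<open>The Galois connection turns the horizontal shifts of \<open>G\<close> into bounds for
  \<open>\<xi>\<close>, with a constant independent of \<open>\<eta>\<close>.\<close>

lemma chi_time_lipschitz_le:
  assumes st: "0 \<le> s" "s \<le> t" and M: "\<And>r x. 0 \<le> r \<Longrightarrow> r \<le> t \<Longrightarrow> \<bar>u r x\<bar> \<le> M" and eta: "\<eta> \<in> I"
  shows "\<bar>\<xi> t \<eta> - \<xi> s \<eta>\<bar> \<le> M * (t - s)"
proof -
  have t: "0 \<le> t" using st by simp
  have "G t (\<xi> s \<eta> - M * (t - s)) \<le> G s (\<xi> s \<eta>)" by (rule G_speed[OF st M])
  also have "\<dots> \<le> \<eta>" using chi_galois[OF st(1) eta] by blast
  finally have 1: "\<xi> s \<eta> - M * (t - s) \<le> \<xi> t \<eta>" using chi_galois[OF t eta] by blast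
  have "G s (\<xi> t \<eta> - M * (t - s)) \<le> G t (\<xi> t \<eta> - M * (t - s) + M * (t - s))" by (rule G_speed[OF st M])
  also have "\<dots> \<le> \<eta>" using chi_galois[OF t eta, of "\<xi> t \<eta>"] by simp
  finally have 2: "\<xi> t \<eta> - M * (t - s) \<le> \<xi> s \<eta>" using chi_galois[OF st(1) eta] by blast
  show ?thesis using 1 2 by simp
qed

lemma chi_time_lipschitz:
  assumes "s \<in> {0..T}" "t \<in> {0..T}" and M: "\<And>r x. r \<in> {0..T} \<Longrightarrow> \<bar>u r x\<bar> \<le> M" and eta: "\<eta> \<in> I"
  shows "\<bar>\<xi> t \<eta> - \<xi> s \<eta>\<bar> \<le> M * \<bar>t - s\<bar>"
proof (cases "s \<le> t")
  case True
  then show ?thesis using chi_time_lipschitz_le[of s t M \<eta>] assms by auto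
next
  case False
  then show ?thesis using chi_time_lipschitz_le[of t s M \<eta>] assms by (auto simp: abs_minus_commute)
qed

section \<open>Time regularity of \<open>p\<close> and of \<open>p\<close> along
  \<open>chi\<close>\<close>

lemma p_eq: "p t x = (\<integral>y. Kn n (y - x) \<partial>\<mu> t)"
  unfolding pp_def by (simp add: Kn_diff_commute[of n x])

lemma p_DERIV_move:
  assumes c: "(c has_real_derivative c') (at t)" and t: "0 < t"
  shows "((\<lambda>r. p r (c r)) has_real_derivative (\<integral>y. (u t y - c') * Kd n (y - c t) \<partial>\<mu> t)) (at t)"
  unfolding p_eq
  by (rule move_DERIV[OF Kn_DERIV Kn_abs_le Kd_bound Kd_lipschitz c t])

text \<open>The mean value theorem needs the derivative only inside the interval. This admits time
  0, where mere continuity is known.\<close>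

lemma p_time_lipschitz:
  assumes st: "s \<in> {0..T}" "t \<in> {0..T}" and M: "\<And>r x. r \<in> {0..T} \<Longrightarrow> \<bar>u r x\<bar> \<le> M"
  shows "\<bar>p t x - p s x\<bar> \<le> M * real n * C * \<bar>t - s\<bar>"
proof -
  have *: "\<bar>p b x - p a x\<bar> \<le> M * real n * C * \<bar>b - a\<bar>" if ab: "0 \<le> a" "a < b" "b \<le> T" for a b
  proof -
    have D: "((\<lambda>r. p r x) has_real_derivative (\<integral>y. (u r y - 0) * Kd n (y - x) \<partial>\<mu> r)) (at r)" if "0 < r" for r
      using p_DERIV_move[of "\<lambda>_. x" 0 r] that by simp
    have "continuous_on {0..} (\<lambda>r. p r x)"
      unfolding p_eq by (intro move_cont[OF Kn_DERIV Kn_abs_le Kd_bound] continuous_intros)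
    then have cab: "continuous_on {a..b} (\<lambda>r. p r x)" by (rule continuous_on_subset) (use ab in auto)
    have dab: "(\<lambda>r. p r x) differentiable (at r)" if "a < r" "r < b" for r
      using D[of r] that ab unfolding real_differentiable_def by auto
    obtain l z where lz: "a < z" "z < b" "((\<lambda>r. p r x) has_real_derivative l) (at z)" "p b x - p a x = (b - a) * l"
      using MVT[OF ab(2) cab dab] by blast
    have z: "z \<in> {0..T}" using lz ab by auto
    have Mnn: "0 \<le> M" using M[OF st(1), of 0] by auto
    have [measurable]: "u z \<in> borel_measurable borel"
      using z by (intro borel_measurable_continuous_onI u_cont) auto
    have "l = (\<integral>y. (u z y - 0) * Kd n (y - x) \<partial>\<mu> z)" using DERIV_unique[OF lz(3) D] lz ab by auto
    moreover have "\<bar>\<integral>y. (u z y - 0) * Kd n (y - x) \<partial>\<mu> z\<bar> \<le> (M * real n) * C"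
      using z M[OF z] Kd_bound[of n] Mnn by (intro integral_mu_bound_C) (auto simp: abs_mult intro!: mult_mono)
    ultimately have "\<bar>l\<bar> \<le> M * real n * C" by simp
    then have "\<bar>b - a\<bar> * \<bar>l\<bar> \<le> \<bar>b - a\<bar> * (M * real n * C)" by (intro mult_left_mono) auto
    then show ?thesis using lz(4) by (simp add: abs_mult mult_ac)
  qed
  consider "s < t" | "s = t" | "t < s" by linarith
  then show ?thesis
    using *[of s t] *[of t s] st by cases (auto simp: abs_minus_commute)
qed

lemma P_time_lipschitz:
  assumes st: "s \<in> {0..T}" "t \<in> {0..T}" and M: "\<And>r x. r \<in> {0..T} \<Longrightarrow> \<bar>u r x\<bar> \<le> M" and eta: "\<eta> \<in> I"
  shows "\<bar>PP n \<mu> t \<eta> - PP n \<mu> s \<eta>\<bar> \<le> 2 * (M * real n * C) * \<bar>t - s\<bar>"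
proof -
  have "\<bar>p t (\<xi> t \<eta>) - p t (\<xi> s \<eta>)\<bar> \<le> real n * C * \<bar>\<xi> t \<eta> - \<xi> s \<eta>\<bar>" using st by (intro p_lipschitz) auto
  also have "\<dots> \<le> real n * C * (M * \<bar>t - s\<bar>)"
    using C_nonneg by (intro mult_left_mono chi_time_lipschitz[OF st M eta]) auto
  finally have "\<bar>p t (\<xi> t \<eta>) - p t (\<xi> s \<eta>)\<bar> \<le> M * real n * C * \<bar>t - s\<bar>" by (simp add: mult_ac)
  moreover have "\<bar>p t (\<xi> s \<eta>) - p s (\<xi> s \<eta>)\<bar> \<le> M * real n * C * \<bar>t - s\<bar>" by (rule p_time_lipschitz[OF st M])
  ultimately show ?thesis unfolding PP_def by linarith
qed

text \<open>The flux of \<open>p\<close>: convolving \<open>\<mu>_t + (u \<mu>)_x = 0\<close> with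
  the kernel gives \<open>p_t + w_x = 0\<close>.\<close>

definition w where "w t x = (\<integral>y. u t y * Kn n (x - y) \<partial>\<mu> t)"

text \<open>The right-hand side is the flux \<open>u \<mu> + w dx\<close> of \<open>rho t\<close>,
  tested with \<open>f'\<close>. So \<open>\<xi> t\<close> pushes \<open>Y d\<eta>\<close> forward
  to this flux, which is all that the weak equation reveals about \<open>Y\<close>.\<close>

lemma flux_identity:
  assumes t: "0 < t"
    and Y: "Y \<in> borel_measurable lamI" "AE \<eta> in lamI. ((\<lambda>r. \<xi> r \<eta>) has_real_derivative Y \<eta>) (at t)"
    and f: "\<And>x. (f has_real_derivative f' x) (at x)" "continuous_on UNIV f'" "\<And>x. \<bar>f x\<bar> \<le> A" "\<And>x. \<bar>f' x\<bar> \<le> A'"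
  shows "(\<integral>\<eta>. f' (\<xi> t \<eta>) * Y \<eta> \<partial>lamI) = (\<integral>x. u t x * f' x \<partial>\<mu> t) + (\<integral>x. f' x * w t x \<partial>lborel)"
proof -
  have t0: "0 \<le> t" using t by simp
  interpret lam: finite_measure lamI by (rule finite_lamI)
  have fc: "continuous_on UNIV f" by (meson DERIV_isCont continuous_at_imp_continuous_on f(1))
  have fm [measurable]: "f \<in> borel_measurable borel" "f' \<in> borel_measurable borel" "u t \<in> borel_measurable borel"
    using t0 by (auto intro!: borel_measurable_continuous_onI fc f u_cont)
  obtain M where M: "\<And>x. \<bar>u t x\<bar> \<le> M" by (rule u_bdd_at[OF t0]) blast
  have A': "0 \<le> A'" using f(4)[of 0] by auto
  have b: "\<bar>smear n f x\<bar> \<le> A * (1 + \<kappa>)" "\<bar>smear n f' x\<bar> \<le> A' * (1 + \<kappa>)" for x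
    using smear_bound[of f A] smear_bound[of f' A'] f by auto
  \<comment> \<open>\<open>f'\<close> is merely bounded and continuous, so continuity of its
    smearing comes from dominated convergence.\<close>
  have sc: "continuous_on UNIV (smear n f')"
  proof -
    have "isCont (smear n f') x" for x
    proof -
      have "((\<lambda>y. \<integral>x. f' (x + y) * Kn n x \<partial>lborel) \<longlongrightarrow> (\<integral>z. f' (z + x) * Kn n z \<partial>lborel)) (at x)"
        unfolding tendsto_at_iff_sequentially
      proof (intro allI impI)
        fix X :: "nat \<Rightarrow> real" assume X: "\<forall>i. X i \<in> UNIV - {x}" "X \<longlonglongrightarrow> x"
        have "(\<lambda>i. \<integral>z. f' (z + X i) * Kn n z \<partial>lborel) \<longlonglongrightarrow> (\<integral>z. f' (z + x) * Kn n z \<partial>lborel)"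
        proof (rule integral_dominated_convergence[where w = "\<lambda>z. A' * Kn n z"])
          show "AE z in lborel. (\<lambda>i. f' (z + X i) * Kn n z) \<longlonglongrightarrow> f' (z + x) * Kn n z"
            using f(2) X by (intro AE_I2 tendsto_intros isCont_tendsto_compose[of _ f'])
              (auto simp: continuous_on_eq_continuous_at)
          show "AE z in lborel. norm (f' (z + X i) * Kn n z) \<le> A' * Kn n z" for i
            using f(4) less_imp_le[OF Kn_pos] by (intro AE_I2) (auto simp: abs_mult intro!: mult_right_mono)
          show "integrable lborel (\<lambda>z. A' * Kn n z)" by (intro integrable_mult_right Kn_integrable n1)
        qed auto
        then show "((\<lambda>y. \<integral>x. f' (x + y) * Kn n x \<partial>lborel) \<circ> X) \<longlonglongrightarrow> (\<integral>z. f' (z + x) * Kn n z \<partial>lborel)"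
          by (simp add: comp_def)
      qed
      moreover have "(f' \<longlongrightarrow> f' x) (at x)" using f(2) by (simp add: continuous_on_eq_continuous_at isCont_def)
      ultimately show ?thesis unfolding isCont_def smear_shift[abs_def] by (intro tendsto_add)
    qed
    then show ?thesis by (simp add: continuous_on_eq_continuous_at)
  qed
  have N: "(\<integral>\<eta>. f (\<xi> r \<eta>) \<partial>lamI) = (\<integral>x. smear n f x \<partial>\<mu> r)" if "0 \<le> r" for r
    using integral_chi[OF that fm(1)] integral_rho(2)[OF that fm(1) f(3)] by simp
  have D1: "((\<lambda>r. \<integral>x. smear n f x \<partial>\<mu> r) has_real_derivative (\<integral>x. u t x * smear n f' x \<partial>\<mu> t)) (at t)"
    by (rule transport_DERIV[OF smear_DERIV[OF f(1,2,3,4)] sc b t])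
  \<comment> \<open>The Lipschitz bound in time is uniform in \<open>\<eta>\<close> and gives a
    constant majorant on an interval of finite length; an almost everywhere derivative
    \<open>Y\<close> is then enough.\<close>
  have D2: "((\<lambda>r. \<integral>\<eta>. f (\<xi> r \<eta>) \<partial>lamI) has_real_derivative (\<integral>\<eta>. f' (\<xi> t \<eta>) * Y \<eta> \<partial>lamI)) (at t)"
  proof -
    obtain M' where M': "\<And>r x. r \<in> {0..t + 1} \<Longrightarrow> \<bar>u r x\<bar> \<le> M'" using u_bdd[of "t + 1"] by blast
    show ?thesis
    proof (rule has_derivative_under_integral[where S = "{0<..<t + 1}" and w = "\<lambda>_. A' * M'"])
      show "integrable lamI (\<lambda>\<eta>. f (\<xi> r \<eta>))" if "r \<in> {0<..<t + 1}" for r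
      proof (rule lam.integrable_const_bound[where B = A])
        show "(\<lambda>\<eta>. f (\<xi> r \<eta>)) \<in> borel_measurable lamI"
          using measurable_compose[OF chi_measurable fm(1)] that by auto
      qed (use f in auto)
      show "(\<lambda>\<eta>. f' (\<xi> t \<eta>) * Y \<eta>) \<in> borel_measurable lamI"
        using measurable_compose[OF chi_measurable[OF t0] fm(2)] Y(1) by (intro borel_measurable_times)
      show "AE \<eta> in lamI. ((\<lambda>r. f (\<xi> r \<eta>)) has_real_derivative f' (\<xi> t \<eta>) * Y \<eta>) (at t)"
        using Y(2) by eventually_elim (rule DERIV_chain2[OF f(1)])
      show "AE \<eta> in lamI. \<bar>f (\<xi> r \<eta>) - f (\<xi> t \<eta>)\<bar> \<le> A' * M' * \<bar>r - t\<bar>" if r: "r \<in> {0<..<t + 1}" for r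
      proof (rule AE_I2)
        fix \<eta> assume "\<eta> \<in> space lamI"
        then have eta: "\<eta> \<in> I" by (simp add: space_restrict_space)
        have "\<bar>f (\<xi> r \<eta>) - f (\<xi> t \<eta>)\<bar> \<le> A' * \<bar>\<xi> r \<eta> - \<xi> t \<eta>\<bar>" by (rule lipschitz_of_bounded_deriv[OF f(1,4)])
        also have "\<dots> \<le> A' * (M' * \<bar>r - t\<bar>)"
          using r t A' by (intro mult_left_mono chi_time_lipschitz[OF _ _ M' eta]) auto
        finally show "\<bar>f (\<xi> r \<eta>) - f (\<xi> t \<eta>)\<bar> \<le> A' * M' * \<bar>r - t\<bar>" by simp
      qed
    qed (use t in auto)
  qed
  have "((\<lambda>r. \<integral>\<eta>. f (\<xi> r \<eta>) \<partial>lamI) has_real_derivative (\<integral>x. u t x * smear n f' x \<partial>\<mu> t)) (at t)"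
    by (rule has_field_derivative_transform_within_open[OF D1, of "{0<..}"]) (use t N in auto)
  then have "(\<integral>\<eta>. f' (\<xi> t \<eta>) * Y \<eta> \<partial>lamI) = (\<integral>x. u t x * smear n f' x \<partial>\<mu> t)"
    using DERIV_unique[OF D2] by blast
  also have "\<dots> = (\<integral>x. u t x * f' x + u t x * (\<integral>z. f' z * Kn n (z - x) \<partial>lborel) \<partial>\<mu> t)"
    by (simp add: smear_def distrib_left)
  also have "\<dots> = (\<integral>x. u t x * f' x \<partial>\<mu> t) + (\<integral>x. u t x * (\<integral>z. f' z * Kn n (z - x) \<partial>lborel) \<partial>\<mu> t)"
  proof (rule Bochner_Integration.integral_add)
    show i1: "integrable (\<mu> t) (\<lambda>x. u t x * f' x)"
      using t0 M f(4) A' by (intro integrable_mu[of _ _ "M * A'"])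
        (auto simp: abs_mult intro!: mult_mono order_trans[OF abs_ge_zero M])
    have "integrable (\<mu> t) (\<lambda>x. u t x * smear n f' x)"
      using t0 M b(2) A' kappa_nonneg borel_measurable_continuous_onI[OF sc] by (intro integrable_mu[of _ _ "M * (A' * (1 + \<kappa>))"])
        (auto simp: abs_mult intro!: mult_mono order_trans[OF abs_ge_zero M])
    then have "integrable (\<mu> t) (\<lambda>x. u t x * smear n f' x - u t x * f' x)" using i1 by (rule Bochner_Integration.integrable_diff)
    then show "integrable (\<mu> t) (\<lambda>x. u t x * (\<integral>z. f' z * Kn n (z - x) \<partial>lborel))"
      by (simp add: smear_def distrib_left)
  qed
  also have "(\<integral>x. u t x * (\<integral>z. f' z * Kn n (z - x) \<partial>lborel) \<partial>\<mu> t) = (\<integral>x. f' x * w t x \<partial>lborel)"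
    unfolding w_def by (rule fubini_K(2)[OF t0 fm(2) f(4) fm(3) M, symmetric])
  finally show ?thesis .
qed

end

section \<open>The velocity of the inverse distribution function\<close>

text \<open>Composition with this map makes a function that is Lipschitz on compact subintervals of
  \<open>(0, B)\<close> Lipschitz on the line, without changing it on the \<open>k\<close>-th
  subinterval; so differentiability results for the whole line apply. The maximum is outermost: if
  the subinterval is empty, the map is constant.\<close>

definition clamp_k :: "real \<Rightarrow> nat \<Rightarrow> real \<Rightarrow> real" where
  "clamp_k B k x = max (1 / Suc k) (min (B - 1 / Suc k) x)"

lemma clamp_k_id: "1 / Suc k \<le> x \<Longrightarrow> x \<le> B - 1 / Suc k \<Longrightarrow> clamp_k B k x = x"
  by (simp add: clamp_k_def)

lemma clamp_k_exhaust:
  assumes "x \<in> {0<..<B}"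
  shows "\<exists>k0. \<forall>k\<ge>k0. 1 / Suc k < x \<and> x < B - 1 / Suc k"
proof -
  obtain k where k: "1 / Suc k < min x (B - x)" using nat_approx_posE[of "min x (B - x)"] assms by auto
  have "1 / Suc j \<le> 1 / Suc k" if "k \<le> j" for j using that by (intro frac_le) auto
  then show ?thesis using k by (intro exI[of _ k]) force
qed

lemma local_lipschitz_ex:
  fixes h :: "real \<Rightarrow> real"
  assumes lip: "\<And>a b. 0 < a \<Longrightarrow> b < B \<Longrightarrow> \<exists>L>0. \<forall>x\<in>{a..b}. \<forall>y\<in>{a..b}. \<bar>h x - h y\<bar> \<le> L * \<bar>x - y\<bar>"
  shows "\<exists>L. L-lipschitz_on UNIV (\<lambda>x. h (clamp_k B k x))"
proof (cases "1 / Suc k \<le> B - 1 / Suc k")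
  case True
  obtain L where L: "L > 0" "\<forall>x\<in>{1 / Suc k..B - 1 / Suc k}. \<forall>y\<in>{1 / Suc k..B - 1 / Suc k}. \<bar>h x - h y\<bar> \<le> L * \<bar>x - y\<bar>"
    using lip[of "1 / Suc k" "B - 1 / Suc k"] by auto
  have "\<bar>h (clamp_k B k x) - h (clamp_k B k y)\<bar> \<le> L * \<bar>x - y\<bar>" for x y
  proof -
    have "\<bar>h (clamp_k B k x) - h (clamp_k B k y)\<bar> \<le> L * \<bar>clamp_k B k x - clamp_k B k y\<bar>"
      using L(2) True by (auto simp: clamp_k_def)
    also have "\<dots> \<le> L * \<bar>x - y\<bar>" using L(1) by (intro mult_left_mono) (auto simp: clamp_k_def)
    finally show ?thesis .
  qed
  then show ?thesis using L(1) by (auto simp: lipschitz_on_def dist_real_def intro!: exI[of _ L])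
next
  case False
  then have "clamp_k B k x = 1 / Suc k" for x by (auto simp: clamp_k_def)
  then show ?thesis by (auto intro!: exI[of _ 0] lipschitz_on_constant)
qed

lemma clamp_k_DERIV_iff:
  assumes "1 / Suc k < x" "x < B - 1 / Suc k"
  shows "((\<lambda>x. h (clamp_k B k x)) has_real_derivative d) (at x) \<longleftrightarrow> (h has_real_derivative d) (at x)"
proof -
  have "\<forall>\<^sub>F y in nhds x. y \<in> {1 / Suc k<..<B - 1 / Suc k}"
    using assms by (intro eventually_nhds_in_open) auto
  then have "\<forall>\<^sub>F y in nhds x. h (clamp_k B k y) = h y" by eventually_elim (simp add: clamp_k_id)
  then show ?thesis by (intro DERIV_cong_ev) auto
qed

lemma local_lipschitz_AE_differentiable:
  fixes h :: "real \<Rightarrow> real"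
  assumes lip: "\<And>a b. 0 < a \<Longrightarrow> b < B \<Longrightarrow> \<exists>L>0. \<forall>x\<in>{a..b}. \<forall>y\<in>{a..b}. \<bar>h x - h y\<bar> \<le> L * \<bar>x - y\<bar>"
  shows "AE x in lborel. x \<in> {0<..<B} \<longrightarrow> (h has_real_derivative deriv h x) (at x)"
    and "(\<lambda>x. indicator {0<..<B} x * deriv h x) \<in> borel_measurable borel"
proof -
  define f where "f k x = h (clamp_k B k x)" for k x
  have "\<exists>L. L-lipschitz_on UNIV (f k)" for k unfolding f_def by (rule local_lipschitz_ex[OF lip])
  then have "\<forall>k. \<exists>L. L-lipschitz_on UNIV (f k)" ..
  from choice[OF this] obtain L :: "nat \<Rightarrow> real" where L: "\<And>k. (L k)-lipschitz_on UNIV (f k)" by blast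
  have "AE x in lborel. \<forall>k. x \<notin> nondiff (f k)"
    unfolding AE_all_countable using lipschitz_nondiff_null[OF L] by (auto intro: AE_not_in)
  then show "AE x in lborel. x \<in> {0<..<B} \<longrightarrow> (h has_real_derivative deriv h x) (at x)"
  proof eventually_elim
    case (elim x)
    show ?case
    proof
      assume "x \<in> {0<..<B}"
      then obtain k where k: "1 / Suc k < x" "x < B - 1 / Suc k" using clamp_k_exhaust by blast
      then obtain d where "(f k has_real_derivative d) (at x)"
        using elim not_nondiff_differentiable[OF L[of k], of x] real_differentiable_def by blast
      then have "(h has_real_derivative d) (at x)" unfolding f_def by (simp only: clamp_k_DERIV_iff[OF k])
      then show "(h has_real_derivative deriv h x) (at x)" using DERIV_imp_deriv by metis
    qed
  qed
  have [measurable]: "deriv (f k) \<in> borel_measurable borel" for k by (rule borel_measurable_deriv_lipschitz[OF L])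
  show "(\<lambda>x. indicator {0<..<B} x * deriv h x) \<in> borel_measurable borel"
  proof (rule borel_measurable_LIMSEQ_real)
    show "(\<lambda>x. indicator {1 / Suc k<..<B - 1 / Suc k} x * deriv (f k) x) \<in> borel_measurable borel" for k
      by measurable
    fix x :: real
    \<comment> \<open>This holds also where no derivative exists: both functions have the same
      derivative candidates at \<open>x\<close>, so \<open>deriv\<close> makes the same
      choice.\<close>
    have de: "deriv (f k) x = deriv h x" if "1 / Suc k < x" "x < B - 1 / Suc k" for k
      unfolding deriv_def f_def using clamp_k_DERIV_iff[OF that] by simp
    show "(\<lambda>k. indicator {1 / Suc k<..<B - 1 / Suc k} x * deriv (f k) x) \<longlonglongrightarrow> indicator {0<..<B} x * deriv h x"
    proof (cases "x \<in> {0<..<B}")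
      case True
      obtain k0 where k0: "\<forall>k\<ge>k0. 1 / Suc k < x \<and> x < B - 1 / Suc k" using clamp_k_exhaust[OF True] by blast
      have "\<forall>\<^sub>F k in sequentially. indicator {1 / Suc k<..<B - 1 / Suc k} x * deriv (f k) x = indicator {0<..<B} x * deriv h x"
        using eventually_ge_at_top[of k0]
      proof eventually_elim
        case (elim k)
        then have k: "1 / Suc k < x" "x < B - 1 / Suc k" using k0 by auto
        then show ?case using True de[OF k] by (simp del: of_nat_Suc)
      qed
      then show ?thesis by (rule tendsto_eventually)
    next
      case False
      have "x \<notin> {1 / Suc k<..<B - 1 / Suc k}" for k
      proof
        assume "x \<in> {1 / Suc k<..<B - 1 / Suc k}"
        moreover have "0 < 1 / real (Suc k)" by simp
        ultimately have "0 < x" "x < B" by (auto simp only: greaterThanLessThan_iff)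
        then show False using False by simp
      qed
      then show ?thesis using False by simp
    qed
  qed
qed

text \<open>The push-forward under \<open>X\<close> of the signed measure \<open>Z dM\<close>
  vanishes on half-lines, which determine finite Borel measures. It is handled as the difference of
  two finite measures, built from the positive and the negative part of \<open>Z\<close>.\<close>

lemma halfline_integrals_zero:
  fixes Z :: "'a \<Rightarrow> real" and X :: "'a \<Rightarrow> real"
  assumes Z: "integrable M Z" and X [measurable]: "X \<in> borel_measurable M"
    and zero: "\<And>x. (\<integral>a. indicator {x<..} (X a) * Z a \<partial>M) = 0" and A: "A \<in> sets borel"
  shows "(\<integral>a. indicator A (X a) * Z a \<partial>M) = 0"
proof -
  have [measurable]: "Z \<in> borel_measurable M" using Z by auto
  \<comment> \<open>\<open>ennreal\<close> sends negative numbers to 0, so \<open>s = 1\<close> and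
    \<open>s = -1\<close> select the two parts of \<open>Z\<close>.\<close>
  define P where "P s = distr (density M (\<lambda>a. ennreal (s * Z a))) borel X" for s :: real
  have iA: "integrable M (\<lambda>a. indicator A (X a) * (c * max 0 (s * Z a)))" if "A \<in> sets borel" for A c and s :: real
  proof (rule Bochner_Integration.integrable_bound[OF integrable_mult_right[OF Z, of "\<bar>c\<bar> * \<bar>s\<bar>"]])
    show "AE a in M. norm (indicator A (X a) * (c * max 0 (s * Z a))) \<le> norm (\<bar>c\<bar> * \<bar>s\<bar> * Z a)"
    proof (rule AE_I2)
      fix a
      have "max 0 (s * Z a) \<le> \<bar>s\<bar> * \<bar>Z a\<bar>" using abs_ge_self[of "s * Z a"] by (simp add: abs_mult)
      then have "\<bar>c\<bar> * max 0 (s * Z a) \<le> \<bar>c\<bar> * (\<bar>s\<bar> * \<bar>Z a\<bar>)" by (intro mult_left_mono) auto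
      then show "norm (indicator A (X a) * (c * max 0 (s * Z a))) \<le> norm (\<bar>c\<bar> * \<bar>s\<bar> * Z a)"
        by (auto simp: indicator_def abs_mult)
    qed
  qed (use that in measurable)
  have em: "emeasure (P s) A = ennreal (\<integral>a. indicator A (X a) * max 0 (s * Z a) \<partial>M)" if [measurable]: "A \<in> sets borel" for A s
  proof -
    have "emeasure (P s) A = (\<integral>\<^sup>+a. ennreal (s * Z a) * indicator (X -` A \<inter> space M) a \<partial>M)"
      unfolding P_def by (subst emeasure_distr, simp, simp, subst emeasure_density) auto
    also have "\<dots> = (\<integral>\<^sup>+a. ennreal (indicator A (X a) * max 0 (s * Z a)) \<partial>M)"
      by (intro nn_integral_cong) (auto simp: indicator_def max_def ennreal_neg)
    also have "\<dots> = ennreal (\<integral>a. indicator A (X a) * max 0 (s * Z a) \<partial>M)"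
      using iA[OF that, of 1 s] by (intro nn_integral_eq_integral) auto
    finally show ?thesis .
  qed
  have dec: "(\<integral>a. indicator A (X a) * Z a \<partial>M) = (\<integral>a. indicator A (X a) * max 0 (1 * Z a) \<partial>M) - (\<integral>a. indicator A (X a) * max 0 (- 1 * Z a) \<partial>M)"
    if "A \<in> sets borel" for A
  proof -
    have eq: "indicator A (X a) * Z a = indicator A (X a) * (1 * max 0 (1 * Z a)) - indicator A (X a) * (1 * max 0 (- 1 * Z a))" for a
      by (auto simp: max_def indicator_def)
    show ?thesis
      unfolding eq Bochner_Integration.integral_diff[OF iA[OF that] iA[OF that]] by simp
  qed
  have "P 1 = P (- 1)"
  proof (rule measure_eqI_lessThan)
    fix x :: real
    show "emeasure (P 1) {x<..} = emeasure (P (- 1)) {x<..}"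
      using zero[of x] dec[of "{x<..}"] by (simp add: em)
    show "emeasure (P 1) {x<..} < \<infinity>" by (simp add: em)
  qed (simp_all add: P_def)
  then have "emeasure (P 1) A = emeasure (P (- 1)) A" by simp
  then have "(\<integral>a. indicator A (X a) * max 0 (1 * Z a) \<partial>M) = (\<integral>a. indicator A (X a) * max 0 (- 1 * Z a) \<partial>M)"
    unfolding em[OF A] by (subst (asm) ennreal_inj) (auto intro!: Bochner_Integration.integral_nonneg)
  then show ?thesis using dec[OF A] by simp
qed

text \<open>A bounded function whose derivative tends to the indicator of \<open>(a, b)\<close> off the end points.\<close>

definition ramp :: "nat \<Rightarrow> real \<Rightarrow> real \<Rightarrow> real \<Rightarrow> real" where
  "ramp k a b x = (sqrt ((x - a)\<^sup>2 + 1 / Suc k) - sqrt ((x - b)\<^sup>2 + 1 / Suc k)) / 2"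

definition ramp' :: "nat \<Rightarrow> real \<Rightarrow> real \<Rightarrow> real \<Rightarrow> real" where
  "ramp' k a b x = ((x - a) / sqrt ((x - a)\<^sup>2 + 1 / Suc k) - (x - b) / sqrt ((x - b)\<^sup>2 + 1 / Suc k)) / 2"

lemma ramp_root_pos: "0 < (x::real)\<^sup>2 + 1 / Suc k"
  by (intro add_nonneg_pos) auto

lemma sqrt_shift_DERIV:
  "((\<lambda>x. sqrt ((x - a)\<^sup>2 + 1 / Suc k)) has_real_derivative (x - a) / sqrt ((x - a)\<^sup>2 + 1 / Suc k)) (at x)"
  using ramp_root_pos[of "x - a" k]
  by (auto intro!: derivative_eq_intros simp: field_simps simp del: of_nat_Suc)

lemma ramp_DERIV: "(ramp k a b has_real_derivative ramp' k a b x) (at x)"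
  unfolding ramp_def[abs_def] ramp'_def
  by (intro DERIV_cdivide DERIV_diff sqrt_shift_DERIV)

lemma ratio_bound: "\<bar>(x::real) / sqrt (x\<^sup>2 + 1 / Suc k)\<bar> \<le> 1"
proof -
  have "\<bar>x\<bar> = sqrt (x\<^sup>2)" by simp
  also have "\<dots> \<le> sqrt (x\<^sup>2 + 1 / Suc k)" by (intro real_sqrt_le_mono) simp
  finally show ?thesis using ramp_root_pos[of x k] by (simp add: abs_divide divide_le_eq)
qed

lemma ramp'_bound: "\<bar>ramp' k a b x\<bar> \<le> 1"
proof -
  have "\<bar>(y - z) / 2\<bar> \<le> 1" if "\<bar>y\<bar> \<le> 1" "\<bar>z\<bar> \<le> 1" for y z :: real
    using that by auto
  then show ?thesis
    unfolding ramp'_def using ratio_bound[of "x - a" k] ratio_bound[of "x - b" k] by blast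
qed

lemma ramp'_continuous: "continuous_on S (ramp' k a b)"
  unfolding ramp'_def[abs_def] using ramp_root_pos[of _ k]
  by (intro continuous_intros) (auto simp: less_le simp del: of_nat_Suc)

text \<open>Each root grows linearly, but \<open>sqrt (z^2 + c)\<close> is 1-Lipschitz in
  \<open>z\<close>, so the difference stays bounded.\<close>

lemma ramp_bound: "\<bar>ramp k a b x\<bar> \<le> \<bar>a - b\<bar>"
proof -
  have "\<bar>sqrt ((x - a)\<^sup>2 + 1 / Suc k) - sqrt ((x - b)\<^sup>2 + 1 / Suc k)\<bar> \<le> 1 * \<bar>(x - a) - (x - b)\<bar>"
  proof -
    have "((\<lambda>z. sqrt (z\<^sup>2 + 1 / Suc k)) has_real_derivative z / sqrt (z\<^sup>2 + 1 / Suc k)) (at z)" for z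
      using sqrt_shift_DERIV[of 0 k z] by simp
    from lipschitz_of_bounded_deriv[OF this ratio_bound, of "x - a" "x - b"] show ?thesis .
  qed
  moreover have "\<bar>(y - z) / 2\<bar> \<le> \<bar>a - b\<bar>" if "\<bar>y - z\<bar> \<le> 1 * \<bar>(x - a) - (x - b)\<bar>" for y z :: real
  proof -
    have "\<bar>y - z\<bar> \<le> \<bar>a - b\<bar>" using that by (simp add: abs_minus_commute)
    moreover have "\<bar>(y - z) / 2\<bar> \<le> \<bar>y - z\<bar>" unfolding abs_divide by simp
    ultimately show ?thesis by (rule order_trans[rotated])
  qed
  ultimately show ?thesis unfolding ramp_def by blast
qed

lemma ratio_lim: "(\<lambda>k. x / sqrt (x\<^sup>2 + 1 / Suc k)) \<longlonglongrightarrow> sgn (x::real)"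
proof (cases "x = 0")
  case False
  have "(\<lambda>k. x / sqrt (x\<^sup>2 + 1 / Suc k)) \<longlonglongrightarrow> x / sqrt (x\<^sup>2 + 0)"
    using False by (intro tendsto_intros LIMSEQ_Suc[OF lim_1_over_n]) auto
  then show ?thesis using False by (simp add: sgn_if abs_if split: if_splits)
qed simp

lemma ramp'_lim: "(\<lambda>k. ramp' k a b x) \<longlonglongrightarrow> (sgn (x - a) - sgn (x - b)) / 2"
  unfolding ramp'_def by (intro tendsto_intros ratio_lim) auto

context hs
begin

section \<open>Measurability and almost everywhere derivatives in the mass variable\<close>

lemma integral_lamI: "(\<integral>\<eta>. F \<eta> \<partial>lamI) = (LINT \<eta>:{0..BC n \<mu>}|lborel. F \<eta>)" for F :: "real \<Rightarrow> real"
proof -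
  have "(\<integral>\<eta>. F \<eta> \<partial>lamI) = (\<integral>\<eta>. indicator I \<eta> *\<^sub>R F \<eta> \<partial>lborel)"
    by (rule integral_restrict_space) auto
  also have "\<dots> = (\<integral>\<eta>. indicator {0..BC n \<mu>} \<eta> *\<^sub>R F \<eta> \<partial>lborel)"
    by (rule integral_discrete_difference[of "{0, BC n \<mu>}"]) (auto simp: indicator_def)
  finally show ?thesis by (simp add: set_lebesgue_integral_def)
qed

lemma AE_lamI: "(AE \<eta> in lamI. Q \<eta>) \<longleftrightarrow> (AE \<eta> in lborel. \<eta> \<in> I \<longrightarrow> Q \<eta>)"
  by (rule AE_restrict_space_iff) auto

lemma measurable_lamI: "F \<in> borel_measurable lamI \<longleftrightarrow> (\<lambda>\<eta>. indicator I \<eta> * F \<eta>) \<in> borel_measurable borel"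
  for F :: "real \<Rightarrow> real"
  using borel_measurable_restrict_space_iff[of I lborel F] by simp

lemma integrable_lamI_bounded:
  fixes F :: "real \<Rightarrow> real"
  assumes "F \<in> borel_measurable lamI" "\<And>x. x \<in> I \<Longrightarrow> \<bar>F x\<bar> \<le> B"
  shows "integrable lamI F"
  using assms by (intro finite_measure.integrable_const_bound[OF finite_lamI, where B = B] AE_I2)
    (auto simp: space_restrict_space)

lemma deriv_chi_measurable: "0 \<le> t \<Longrightarrow> deriv (\<xi> t) \<in> borel_measurable lamI"
  unfolding measurable_lamI by (rule local_lipschitz_AE_differentiable(2)[OF chi_lipschitz_local])

lemma chi_AE_DERIV: "0 \<le> t \<Longrightarrow> AE \<eta> in lamI. (\<xi> t has_real_derivative deriv (\<xi> t) \<eta>) (at \<eta>)"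
  unfolding AE_lamI by (rule local_lipschitz_AE_differentiable(1)[OF chi_lipschitz_local])

lemma P_lipschitz_local:
  assumes t: "0 \<le> t" and ab: "0 < a" "b < BC n \<mu>"
  shows "\<exists>L>0. \<forall>x\<in>{a..b}. \<forall>y\<in>{a..b}. \<bar>PP n \<mu> t x - PP n \<mu> t y\<bar> \<le> L * \<bar>x - y\<bar>"
proof -
  obtain L where L: "L > 0" "\<forall>x\<in>{a..b}. \<forall>y\<in>{a..b}. \<bar>\<xi> t x - \<xi> t y\<bar> \<le> L * \<bar>x - y\<bar>"
    using chi_lipschitz_local[OF t ab] by blast
  have "\<bar>PP n \<mu> t x - PP n \<mu> t y\<bar> \<le> ((real n * C + 1) * L) * \<bar>x - y\<bar>" if "x \<in> {a..b}" "y \<in> {a..b}" for x y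
  proof -
    have "\<bar>PP n \<mu> t x - PP n \<mu> t y\<bar> \<le> real n * C * \<bar>\<xi> t x - \<xi> t y\<bar>" unfolding PP_def by (rule p_lipschitz[OF t])
    also have "\<dots> \<le> (real n * C + 1) * (L * \<bar>x - y\<bar>)" using L that C_nonneg by (intro mult_mono) auto
    finally show ?thesis by simp
  qed
  moreover have "(real n * C + 1) * L > 0" using L(1) C_nonneg by (intro mult_pos_pos add_nonneg_pos) auto
  ultimately show ?thesis by blast
qed

lemma deriv_P_measurable: "0 \<le> t \<Longrightarrow> deriv (PP n \<mu> t) \<in> borel_measurable lamI"
  unfolding measurable_lamI by (rule local_lipschitz_AE_differentiable(2)[OF P_lipschitz_local])

lemma P_measurable: "0 \<le> t \<Longrightarrow> PP n \<mu> t \<in> borel_measurable lamI"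
  unfolding PP_def[abs_def] by (rule measurable_compose[OF chi_measurable p_measurable])

definition px where "px t x = (\<integral>y. Kd n (x - y) \<partial>\<mu> t)"

lemma p_DERIV_x:
  assumes t: "0 \<le> t"
  shows "(p t has_real_derivative px t x) (at x)"
proof -
  have [measurable]: "Kn n \<in> borel_measurable (\<mu> t)" "Kd n \<in> borel_measurable (\<mu> t)" by (auto intro!: meas_mu t)
  show ?thesis
    unfolding pp_def[abs_def] px_def
  proof (rule has_derivative_under_integral[where S = UNIV and w = "\<lambda>_. real n"])
    show "integrable (\<mu> t) (\<lambda>y. Kn n (x - y))" for x by (rule K_integrable_mu[OF t])
    show "(\<lambda>y. Kd n (x - y)) \<in> borel_measurable (\<mu> t)" by (intro meas_mu t) measurable
    show "AE a in \<mu> t. ((\<lambda>x. Kn n (x - a)) has_real_derivative Kd n (x - a)) (at x)"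
    proof (rule AE_I2)
      fix a show "((\<lambda>x. Kn n (x - a)) has_real_derivative Kd n (x - a)) (at x)"
        using DERIV_shift[of "Kn n" "Kd n (x - a)" x "- a"] Kn_DERIV[of n "x - a"] by simp
    qed
    show "integrable (\<mu> t) (\<lambda>_. real n)" using t by (intro integrable_mu[of _ _ "real n"]) auto
    show "AE a in \<mu> t. \<bar>Kn n (x' - a) - Kn n (x - a)\<bar> \<le> real n * \<bar>x' - x\<bar>" for x'
      using Kn_lipschitz[of n] by (intro AE_I2) (metis (no_types, lifting) add_diff_cancel_right' diff_add_cancel diff_diff_eq2)
  qed auto
qed

lemma P_DERIV_eta:
  assumes "0 \<le> t" "(\<xi> t has_real_derivative d) (at \<eta>)"
  shows "(PP n \<mu> t has_real_derivative px t (\<xi> t \<eta>) * d) (at \<eta>)"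
  unfolding PP_def[abs_def] by (rule DERIV_chain2[OF p_DERIV_x[OF assms(1)] assms(2)])

text \<open>Approaching \<open>\<xi> t \<eta>\<close> from the right, the Galois connection shows
  that the closed half-line up to it has mass at least \<open>\<eta>\<close>; without atoms the open
  half-line has the same mass.\<close>

lemma G_chi:
  assumes t: "0 \<le> t" and atomless: "\<And>x. measure (\<mu> t) {x} = 0" and eta: "\<eta> \<in> I"
  shows "G t (\<xi> t \<eta>) = \<eta>"
proof -
  interpret finite_measure "rho t" by (rule finite_rho[OF t])
  define x where "x = \<xi> t \<eta>"
  have "(\<Inter>k. {..<x + 1 / real (Suc k)}) = {..x}"
  proof (intro equalityI subsetI)
    fix y assume y: "y \<in> (\<Inter>k. {..<x + 1 / real (Suc k)})"
    have "y \<le> x"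
    proof (rule ccontr)
      assume "\<not> y \<le> x"
      then obtain k where "1 / real (Suc k) < y - x" using nat_approx_posE[of "y - x"] by auto
      moreover have "y < x + 1 / real (Suc k)" using y by blast
      ultimately show False by linarith
    qed
    then show "y \<in> {..x}" by simp
  next
    fix y assume "y \<in> {..x}"
    moreover have "0 < 1 / real (Suc k)" for k by simp
    ultimately show "y \<in> (\<Inter>k. {..<x + 1 / real (Suc k)})"
      by (auto simp del: of_nat_Suc zero_less_divide_iff intro: le_less_trans)
  qed
  moreover have "(\<lambda>k. measure (rho t) {..<x + 1 / real (Suc k)}) \<longlonglongrightarrow> measure (rho t) (\<Inter>k. {..<x + 1 / real (Suc k)})"
    by (intro finite_Lim_measure_decseq) (auto simp: decseq_def field_simps)
  ultimately have "(\<lambda>k. G t (x + 1 / real (Suc k))) \<longlonglongrightarrow> measure (rho t) {..x}" by (simp add: G_rho t)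
  moreover have "\<eta> \<le> G t (x + 1 / real (Suc k))" for k
    using chi_less_iff[OF t eta, of "x + 1 / real (Suc k)"] by (simp add: x_def)
  ultimately have "\<eta> \<le> measure (rho t) {..x}" by (intro LIMSEQ_le_const) auto
  also have "{..x} = {..<x} \<union> {x}" by auto
  also have "measure (rho t) \<dots> = measure (rho t) {..<x} + measure (rho t) {x}"
    by (intro finite_measure_Union) auto
  also have "measure (rho t) {x} = 0"
    using measure_rho[OF t, of "{x}"] atomless[of x]
    by (simp add: set_lebesgue_integral_def integral_eq_zero_AE[OF AE_mp[OF AE_lborel_singleton[of x]]])
  finally have "\<eta> \<le> G t x" by (simp add: G_rho t)
  moreover have "G t x \<le> \<eta>" using chi_galois[OF t eta, of x] by (simp add: x_def)
  ultimately show ?thesis by (simp add: x_def)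
qed

end

text \<open>One positive time without atoms. The condition \<open>0 < C\<close> sets aside the case
  of an empty interval \<open>I\<close>, in which there is nothing to compute.\<close>

locale hs_good = hs +
  fixes t
  assumes t: "0 < t" and C: "0 < C" and atomless: "\<And>x. measure (\<mu> t) {x} = 0"
begin

lemma t0: "0 \<le> t" using t by simp

lemma G_xi: "\<eta> \<in> I \<Longrightarrow> G t (\<xi> t \<eta>) = \<eta>"
  by (rule G_chi[OF t0 atomless])

text \<open>\<open>\<xi> t\<close> is a bijection from \<open>I\<close> onto the line. The
  substitution theorem is applied on the set \<open>S\<close> of points of differentiability; the
  rest of \<open>I\<close> is null, and so is its image, since \<open>\<xi> t\<close> is locally
  Lipschitz.\<close>

lemma chi_change_of_variables:
  assumes g: "integrable lborel g"
  shows "integrable lamI (\<lambda>\<eta>. g (\<xi> t \<eta>) * deriv (\<xi> t) \<eta>)"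
    and "(\<integral>\<eta>. g (\<xi> t \<eta>) * deriv (\<xi> t) \<eta> \<partial>lamI) = (\<integral>x. g x \<partial>lborel)"
proof -
  define S where "S = {\<eta>\<in>I. (\<xi> t has_real_derivative deriv (\<xi> t) \<eta>) (at \<eta>)}"
  define N where "N = I - S"
  have gm: "g \<in> borel_measurable borel" using g by auto
  have "AE \<eta> in lborel. \<eta> \<notin> N" using chi_AE_DERIV[OF t0] unfolding AE_lamI N_def S_def by auto
  then obtain N' where N': "\<And>\<eta>. \<eta> \<in> space lborel - N' \<Longrightarrow> \<eta> \<notin> N" "N' \<in> null_sets lborel"
    by (rule AE_E3) blast
  then have "negligible N'" by (simp add: negligible_iff_null_sets null_sets_completionI)
  then have N: "negligible N" by (rule negligible_subset) (use N'(1) in auto)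
  then have AEN: "AE \<eta> in lebesgue. \<eta> \<notin> N" by (simp add: negligible_iff_null_sets AE_not_in)
  have S: "S \<in> sets lebesgue"
  proof -
    have "S = I - N" by (auto simp: N_def S_def)
    then show ?thesis using negligible_imp_sets[OF N] by (simp add: sets.Diff)
  qed
  have inj: "inj_on (\<xi> t) I" by (rule inj_on_inverseI[of _ "G t"]) (rule G_xi)
  have surj: "\<xi> t ` I = UNIV"
  proof -
    have "x \<in> \<xi> t ` I" for x
      using chi_G[OF t0 C, of x] G_in_I[OF t0 C, of x] by (metis imageI)
    then show ?thesis by auto
  qed
  have Nn: "negligible (\<xi> t ` N)"
  proof (rule negligible_locally_Lipschitz_image[OF _ N])
    fix x assume "x \<in> N"
    then have "x \<in> I" by (simp add: N_def)
    then obtain k where k: "1 / real (Suc k) < x" "x < BC n \<mu> - 1 / real (Suc k)" using clamp_k_exhaust by blast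
    obtain L where "\<forall>z\<in>{1 / real (Suc k)..BC n \<mu> - 1 / real (Suc k)}. \<forall>y\<in>{1 / real (Suc k)..BC n \<mu> - 1 / real (Suc k)}. \<bar>\<xi> t z - \<xi> t y\<bar> \<le> L * \<bar>z - y\<bar>"
      using chi_lipschitz_local[OF t0, of "1 / real (Suc k)" "BC n \<mu> - 1 / real (Suc k)"] by auto
    then show "\<exists>T B. open T \<and> x \<in> T \<and> (\<forall>y\<in>N \<inter> T. norm (\<xi> t y - \<xi> t x) \<le> B * norm (y - x))"
      using k by (intro exI[of _ "{1 / real (Suc k)<..<BC n \<mu> - 1 / real (Suc k)}"] exI[of _ L]) (auto simp del: of_nat_Suc)
  qed simp
  have SN: "\<xi> t ` S = UNIV - \<xi> t ` N"
  proof -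
    have "S \<subseteq> I" by (auto simp: S_def)
    then have "\<xi> t ` N = UNIV - \<xi> t ` S"
      unfolding N_def surj[symmetric] by (intro inj_on_image_set_diff[OF inj]) auto
    then show ?thesis by auto
  qed
  \<comment> \<open>Monotonicity removes the absolute value from the Jacobian.\<close>
  have sgnd: "0 \<le> deriv (\<xi> t) \<eta>" if eS: "\<eta> \<in> S" for \<eta>
  proof (rule ccontr)
    assume "\<not> 0 \<le> deriv (\<xi> t) \<eta>"
    then obtain d where d: "d > 0" "\<And>h. 0 < h \<Longrightarrow> h < d \<Longrightarrow> \<xi> t (\<eta> + h) < \<xi> t \<eta>"
      using eS DERIV_neg_dec_right[of "\<xi> t" "deriv (\<xi> t) \<eta>" \<eta>] unfolding S_def by auto
    define h where "h = min (d / 2) ((BC n \<mu> - \<eta>) / 2)"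
    have h: "0 < h" "h < d" "\<eta> + h \<in> I" using d(1) that by (auto simp: h_def S_def min_def field_simps)
    then show False using d(2)[OF h(1,2)] chi_mono[OF t0, of \<eta> "\<eta> + h"] that by (auto simp: S_def)
  qed
  have gU: "g absolutely_integrable_on UNIV"
    using g by (simp add: set_integrable_def integrable_completion)
  have gS: "g absolutely_integrable_on (\<xi> t ` S)" "integral (\<xi> t ` S) g = integral UNIV g"
  proof -
    have "\<xi> t ` S \<in> sets lebesgue" unfolding SN using sets.compl_sets[OF negligible_imp_sets[OF Nn]] by simp
    with gU show "g absolutely_integrable_on (\<xi> t ` S)" by (rule set_integrable_subset) auto
    show "integral (\<xi> t ` S) g = integral UNIV g" by (rule integral_spike_set) (use Nn SN in \<open>auto elim!: negligible_subset\<close>)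
  qed
  have "(\<lambda>\<eta>. \<bar>deriv (\<xi> t) \<eta>\<bar> * g (\<xi> t \<eta>)) absolutely_integrable_on S \<and>
      integral S (\<lambda>\<eta>. \<bar>deriv (\<xi> t) \<eta>\<bar> * g (\<xi> t \<eta>)) = integral UNIV g"
    by (subst has_absolute_integral_change_of_variables_1'[OF S])
       (use gS inj in \<open>auto simp: S_def inj_on_def intro: has_field_derivative_at_within\<close>)
  then have ai: "set_integrable lebesgue S (\<lambda>\<eta>. \<bar>deriv (\<xi> t) \<eta>\<bar> * g (\<xi> t \<eta>))"
    and li: "(LINT \<eta>:S|lebesgue. \<bar>deriv (\<xi> t) \<eta>\<bar> * g (\<xi> t \<eta>)) = integral UNIV g"
    by (auto simp: set_lebesgue_integral_eq_integral)
  \<comment> \<open>The substitution takes place in the completed measure and on \<open>S\<close>.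
    This Borel function equals its integrand almost everywhere and brings the result back to
    \<open>lborel\<close>.\<close>
  define E where "E \<eta> = indicator I \<eta> * (g (\<xi> t \<eta>) * deriv (\<xi> t) \<eta>)" for \<eta>
  have Fm: "(\<lambda>\<eta>. g (\<xi> t \<eta>) * deriv (\<xi> t) \<eta>) \<in> borel_measurable lamI"
    by (intro borel_measurable_times measurable_compose[OF chi_measurable[OF t0] gm] deriv_chi_measurable t0)
  then have Em: "E \<in> borel_measurable lborel" unfolding E_def measurable_lamI by simp
  have AEE: "AE \<eta> in lebesgue. indicator S \<eta> *\<^sub>R (\<bar>deriv (\<xi> t) \<eta>\<bar> * g (\<xi> t \<eta>)) = E \<eta>"
    using AEN
  proof eventually_elim
    case (elim \<eta>)
    then show ?case using sgnd[of \<eta>] by (cases "\<eta> \<in> S") (auto simp: E_def N_def S_def)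
  qed
  have Em': "E \<in> borel_measurable lebesgue" using Em by (rule measurable_completion)
  have iE: "integrable lebesgue E"
    using ai unfolding set_integrable_def by (rule integrable_cong_AE_imp[OF _ Em' AEE])
  then have "integrable lborel E" using Em by (simp add: integrable_completion)
  then show "integrable lamI (\<lambda>\<eta>. g (\<xi> t \<eta>) * deriv (\<xi> t) \<eta>)"
    unfolding E_def by (subst integrable_restrict_space) auto
  have "(\<integral>\<eta>. g (\<xi> t \<eta>) * deriv (\<xi> t) \<eta> \<partial>lamI) = (\<integral>\<eta>. E \<eta> \<partial>lborel)"
    unfolding E_def by (subst integral_restrict_space) auto
  also have "\<dots> = (\<integral>\<eta>. E \<eta> \<partial>lebesgue)" using Em by (simp add: integral_completion)
  also have "\<dots> = (LINT \<eta>:S|lebesgue. \<bar>deriv (\<xi> t) \<eta>\<bar> * g (\<xi> t \<eta>))"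
    unfolding set_lebesgue_integral_def
    using ai Em' AEE by (intro integral_cong_AE) (auto simp: set_integrable_def elim!: AE_symmetric)
  also have "\<dots> = integral UNIV g" by (rule li)
  also have "\<dots> = (\<integral>x. g x \<partial>lborel)"
    using integral_lborel[OF g] by simp
  finally show "(\<integral>\<eta>. g (\<xi> t \<eta>) * deriv (\<xi> t) \<eta> \<partial>lamI) = (\<integral>x. g x \<partial>lborel)" .
qed

text \<open>\<open>d\<eta>\<close> is pushed forward to \<open>rho t\<close> and
  \<open>\<xi>_\<eta> d\<eta>\<close> to Lebesgue measure, hence
  \<open>P \<xi>_\<eta> d\<eta>\<close> to \<open>p dx\<close>. The difference is
  \<open>\<mu> t\<close>, which explains the factor common to the integrals in \<open>h\<close> and
  \<open>R\<close>.\<close>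

lemma mu_pullback:
  assumes v: "v \<in> borel_measurable borel" "\<And>x. \<bar>v x\<bar> \<le> B"
  shows "integrable lamI (\<lambda>\<eta>. v (\<xi> t \<eta>) * (1 - PP n \<mu> t \<eta> * deriv (\<xi> t) \<eta>))"
    and "(\<integral>\<eta>. v (\<xi> t \<eta>) * (1 - PP n \<mu> t \<eta> * deriv (\<xi> t) \<eta>) \<partial>lamI) = (\<integral>y. v y \<partial>\<mu> t)"
proof -
  have "integrable lborel (\<lambda>x. v x * p t x)"
    using fubini_K(1)[OF t0 v, of "\<lambda>_. 1" 1] by (simp add: pp_def)
  note c = chi_change_of_variables[OF this]
  have i: "integrable lamI (\<lambda>\<eta>. v (\<xi> t \<eta>))"
    using measurable_compose[OF chi_measurable[OF t0] v(1)] v(2) by (intro integrable_lamI_bounded[of _ B])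
  have eq: "v (\<xi> t \<eta>) * (1 - PP n \<mu> t \<eta> * deriv (\<xi> t) \<eta>) = v (\<xi> t \<eta>) - v (\<xi> t \<eta>) * p t (\<xi> t \<eta>) * deriv (\<xi> t) \<eta>" for \<eta>
    by (simp add: PP_def right_diff_distrib)
  show "integrable lamI (\<lambda>\<eta>. v (\<xi> t \<eta>) * (1 - PP n \<mu> t \<eta> * deriv (\<xi> t) \<eta>))"
    unfolding eq by (rule Bochner_Integration.integrable_diff[OF i c(1)])
  show "(\<integral>\<eta>. v (\<xi> t \<eta>) * (1 - PP n \<mu> t \<eta> * deriv (\<xi> t) \<eta>) \<partial>lamI) = (\<integral>y. v y \<partial>\<mu> t)"
    unfolding eq Bochner_Integration.integral_diff[OF i c(1)] c(2)
    using integral_chi[OF t0 v(1)] integral_rho(1)[OF t0 v] by simp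
qed

end

context hs_good
begin

lemma u_meas: "u t \<in> borel_measurable borel"
  by (intro borel_measurable_continuous_onI u_cont t0)

lemma uK_bounded:
  obtains M where "0 \<le> M" "\<And>x. \<bar>u t x\<bar> \<le> M" "\<And>a x. \<bar>u t x * Kn n (a - x)\<bar> \<le> M" "\<And>a x. \<bar>u t x * Kd n (a - x)\<bar> \<le> M * real n"
proof -
  obtain M where M: "\<And>x. \<bar>u t x\<bar> \<le> M" by (rule u_bdd_at[OF t0]) blast
  have "0 \<le> M" using M[of 0] by auto
  moreover have "\<bar>u t x * Kn n (a - x)\<bar> \<le> M" for a x
  proof -
    have "\<bar>u t x\<bar> * \<bar>Kn n (a - x)\<bar> \<le> M * 1" using \<open>0 \<le> M\<close> M Kn_abs_le by (intro mult_mono) auto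
    then show ?thesis by (simp add: abs_mult)
  qed
  moreover have "\<bar>u t x * Kd n (a - x)\<bar> \<le> M * real n" for a x
    unfolding abs_mult using \<open>0 \<le> M\<close> M Kd_bound by (intro mult_mono) auto
  ultimately show thesis using that M by blast
qed

text \<open>\<open>mu_pullback\<close> for \<open>u(y) K(x - y)\<close> with
  \<open>x = \<xi> t \<eta>\<close> held fixed. In the space variable \<open>h\<close> is the
  difference of the local flux \<open>u p\<close> and the convolved flux \<open>w\<close>.\<close>

lemma hh_eq: "hh n u \<mu> t \<eta> = u t (\<xi> t \<eta>) * p t (\<xi> t \<eta>) - w t (\<xi> t \<eta>)"
proof -
  obtain M where M: "\<And>a x. \<bar>u t x * Kn n (a - x)\<bar> \<le> M" by (rule uK_bounded) blast
  note [measurable] = u_meas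
  have "(\<integral>\<eta>'. u t (\<xi> t \<eta>') * Kn n (\<xi> t \<eta> - \<xi> t \<eta>') * (1 - PP n \<mu> t \<eta>' * deriv (\<xi> t) \<eta>') \<partial>lamI) = w t (\<xi> t \<eta>)"
    unfolding w_def by (rule mu_pullback(2)[of "\<lambda>x. u t x * Kn n (\<xi> t \<eta> - x)", OF _ M]) measurable
  then show ?thesis unfolding hh_def UU_def integral_lamI by (simp add: PP_def)
qed

text \<open>The same pullback with \<open>K'\<close> in place of \<open>K\<close>: in the space
  variable \<open>R\<close> is \<open>u p_x - w_x\<close>.\<close>

lemma RR_eq: "RR n u \<mu> t \<eta> = - (\<integral>y. u t y * Kd n (\<xi> t \<eta> - y) \<partial>\<mu> t) + u t (\<xi> t \<eta>) * px t (\<xi> t \<eta>)"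
proof -
  obtain M where M: "\<And>a x. \<bar>u t x * Kd n (a - x)\<bar> \<le> M * real n" by (rule uK_bounded) blast
  note [measurable] = u_meas
  have 1: "(\<integral>\<eta>'. u t (\<xi> t \<eta>') * Kd n (\<xi> t \<eta> - \<xi> t \<eta>') * (1 - PP n \<mu> t \<eta>' * deriv (\<xi> t) \<eta>') \<partial>lamI)
      = (\<integral>y. u t y * Kd n (\<xi> t \<eta> - y) \<partial>\<mu> t)"
    by (rule mu_pullback(2)[of "\<lambda>x. u t x * Kd n (\<xi> t \<eta> - x)", OF _ M]) measurable
  have 2: "(\<integral>\<eta>'. Kd n (\<xi> t \<eta> - \<xi> t \<eta>') * (1 - PP n \<mu> t \<eta>' * deriv (\<xi> t) \<eta>') \<partial>lamI) = px t (\<xi> t \<eta>)"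
    unfolding px_def by (rule mu_pullback(2)[of "\<lambda>x. Kd n (\<xi> t \<eta> - x)", OF _ Kd_bound]) measurable
  show ?thesis unfolding RR_def UU_def deriv_Kn using 1 2 unfolding integral_lamI by simp
qed

definition D where "D \<eta> = RR n u \<mu> t \<eta> - hh n u \<mu> t \<eta> * deriv (PP n \<mu> t) \<eta>"

lemma D_measurable: "D \<in> borel_measurable lamI"
proof -
  note [measurable] = u_meas p_measurable[OF t0]
  obtain M where M: "\<And>x. \<bar>u t x\<bar> \<le> M" by (rule u_bdd_at[OF t0]) blast
  have [measurable]: "w t \<in> borel_measurable borel" "(\<lambda>x. \<integral>y. u t y * Kd n (x - y) \<partial>\<mu> t) \<in> borel_measurable borel"
    unfolding w_def using vK_lipschitz[OF t0 u_meas M]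
    by (auto intro!: borel_measurable_continuous_onI lipschitz_cont)
  have [measurable]: "px t \<in> borel_measurable borel"
    unfolding px_def using vK_lipschitz(2)[OF t0, of "\<lambda>_. 1" 1]
    by (auto intro!: borel_measurable_continuous_onI lipschitz_cont)
  note [measurable] = chi_measurable[OF t0] deriv_P_measurable[OF t0]
  show ?thesis
    unfolding D_def[abs_def] hh_eq RR_eq
    by (intro borel_measurable_add borel_measurable_diff borel_measurable_times borel_measurable_uminus deriv_P_measurable t0
        measurable_compose[OF chi_measurable[OF t0], of "u t"] measurable_compose[OF chi_measurable[OF t0], of "p t"]
        measurable_compose[OF chi_measurable[OF t0], of "px t"] measurable_compose[OF chi_measurable[OF t0], of "w t"]
        measurable_compose[OF chi_measurable[OF t0], of "\<lambda>x. \<integral>y. u t y * Kd n (x - y) \<partial>\<mu> t"]) measurable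
qed

text \<open>This is \<open>U - h \<xi>_\<eta>\<close>, sorted so that the first summand pulls back
  \<open>u \<mu>\<close> and the second \<open>w dx\<close>.\<close>

definition V where
  "V \<eta> = u t (\<xi> t \<eta>) * (1 - PP n \<mu> t \<eta> * deriv (\<xi> t) \<eta>) + w t (\<xi> t \<eta>) * deriv (\<xi> t) \<eta>"

lemma V_integral:
  assumes g: "g \<in> borel_measurable borel" "\<And>x. \<bar>g x\<bar> \<le> A"
  shows "integrable lamI (\<lambda>\<eta>. g (\<xi> t \<eta>) * V \<eta>)"
    and "(\<integral>\<eta>. g (\<xi> t \<eta>) * V \<eta> \<partial>lamI) = (\<integral>x. u t x * g x \<partial>\<mu> t) + (\<integral>x. g x * w t x \<partial>lborel)"
proof -
  obtain M where M: "\<And>x. \<bar>u t x\<bar> \<le> M" by (rule u_bdd_at[OF t0]) blast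
  note [measurable] = u_meas g(1)
  have ug: "\<bar>u t x * g x\<bar> \<le> M * A" for x
    unfolding abs_mult by (intro mult_mono M g order_trans[OF abs_ge_zero M] abs_ge_zero)
  have gw: "integrable lborel (\<lambda>x. g x * w t x)"
    unfolding w_def by (rule fubini_K(1)[OF t0 g u_meas M])
  note c = chi_change_of_variables[OF gw]
  note m = mu_pullback[of "\<lambda>x. u t x * g x", OF _ ug]
  have eq: "g (\<xi> t \<eta>) * V \<eta> = u t (\<xi> t \<eta>) * g (\<xi> t \<eta>) * (1 - PP n \<mu> t \<eta> * deriv (\<xi> t) \<eta>) + g (\<xi> t \<eta>) * w t (\<xi> t \<eta>) * deriv (\<xi> t) \<eta>" for \<eta>
    by (simp add: V_def algebra_simps)
  show "integrable lamI (\<lambda>\<eta>. g (\<xi> t \<eta>) * V \<eta>)"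
    unfolding eq by (intro Bochner_Integration.integrable_add c(1) m(1)) measurable
  have "(\<integral>\<eta>. g (\<xi> t \<eta>) * V \<eta> \<partial>lamI) = (\<integral>\<eta>. u t (\<xi> t \<eta>) * g (\<xi> t \<eta>) * (1 - PP n \<mu> t \<eta> * deriv (\<xi> t) \<eta>) \<partial>lamI)
      + (\<integral>\<eta>. g (\<xi> t \<eta>) * w t (\<xi> t \<eta>) * deriv (\<xi> t) \<eta> \<partial>lamI)"
    unfolding eq by (intro Bochner_Integration.integral_add c(1) m(1)) measurable
  also have "\<dots> = (\<integral>x. u t x * g x \<partial>\<mu> t) + (\<integral>x. g x * w t x \<partial>lborel)"
    by (subst m(2)) (auto simp: c(2))
  finally show "(\<integral>\<eta>. g (\<xi> t \<eta>) * V \<eta> \<partial>lamI) = (\<integral>x. u t x * g x \<partial>\<mu> t) + (\<integral>x. g x * w t x \<partial>lborel)" .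
qed

text \<open>\<open>flux_identity\<close> and \<open>V_integral\<close> give \<open>Y\<close> and
  \<open>V\<close> the same integrals against \<open>ramp'\<close> evaluated at
  \<open>\<xi> t \<eta>\<close>. Limits yield half-lines and then all Borel sets in the space
  variable. As \<open>\<eta> = G t (\<xi> t \<eta>)\<close>, these already account for every Borel
  set of \<open>\<eta>\<close>.\<close>

lemma chi_velocity:
  assumes Y: "integrable lamI Y" "AE \<eta> in lamI. ((\<lambda>r. \<xi> r \<eta>) has_real_derivative Y \<eta>) (at t)"
  shows "AE \<eta> in lamI. Y \<eta> = V \<eta>"
proof -
  have Ym: "Y \<in> borel_measurable lamI" using Y(1) by auto
  have xm: "\<xi> t \<in> borel_measurable lamI" by (rule chi_measurable[OF t0])
  have Vi: "integrable lamI V" using V_integral(1)[of "\<lambda>_. 1" 1] by simp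
  define Z where "Z \<eta> = Y \<eta> - V \<eta>" for \<eta>
  have Zi: "integrable lamI Z" unfolding Z_def by (intro Bochner_Integration.integrable_diff Y Vi)
  then have Zm: "Z \<in> borel_measurable lamI" by auto
  have gm: "(\<lambda>\<eta>. g (\<xi> t \<eta>)) \<in> borel_measurable lamI" if "g \<in> borel_measurable borel" for g :: "real \<Rightarrow> real"
    using measurable_compose[OF xm that] .
  have rm [measurable]: "ramp' k a b \<in> borel_measurable borel" for k a b
    by (intro borel_measurable_continuous_onI ramp'_continuous)
  have bz: "integrable lamI (\<lambda>\<eta>. g (\<xi> t \<eta>) * Z \<eta>)" if "g \<in> borel_measurable borel" "\<And>x. \<bar>g x\<bar> \<le> 1" for g :: "real \<Rightarrow> real"
    using that Zm gm[OF that(1)]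
    by (intro Bochner_Integration.integrable_bound[OF Zi]) (auto simp: abs_mult intro!: mult_left_le_one_le)
  have z1: "(\<integral>\<eta>. ramp' k a b (\<xi> t \<eta>) * Z \<eta> \<partial>lamI) = 0" for k a b
  proof -
    have Vg: "integrable lamI (\<lambda>\<eta>. ramp' k a b (\<xi> t \<eta>) * V \<eta>)" by (rule V_integral(1)[OF rm ramp'_bound])
    have "integrable lamI (\<lambda>\<eta>. ramp' k a b (\<xi> t \<eta>) * Z \<eta> + ramp' k a b (\<xi> t \<eta>) * V \<eta>)"
      by (intro Bochner_Integration.integrable_add Vg bz rm ramp'_bound)
    then have Yg: "integrable lamI (\<lambda>\<eta>. ramp' k a b (\<xi> t \<eta>) * Y \<eta>)" by (simp add: Z_def algebra_simps)
    have "(\<integral>\<eta>. ramp' k a b (\<xi> t \<eta>) * Y \<eta> \<partial>lamI) = (\<integral>\<eta>. ramp' k a b (\<xi> t \<eta>) * V \<eta> \<partial>lamI)"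
      unfolding flux_identity[OF t Ym Y(2) ramp_DERIV ramp'_continuous ramp_bound ramp'_bound]
        V_integral(2)[OF rm ramp'_bound] ..
    then show ?thesis using Yg Vg by (simp add: Z_def right_diff_distrib)
  qed
  have z2: "(\<integral>\<eta>. (sgn (\<xi> t \<eta> - a) - sgn (\<xi> t \<eta> - b)) / 2 * Z \<eta> \<partial>lamI) = 0" for a b
  proof -
    have "(\<lambda>k. \<integral>\<eta>. ramp' k a b (\<xi> t \<eta>) * Z \<eta> \<partial>lamI) \<longlonglongrightarrow> (\<integral>\<eta>. (sgn (\<xi> t \<eta> - a) - sgn (\<xi> t \<eta> - b)) / 2 * Z \<eta> \<partial>lamI)"
    proof (rule integral_dominated_convergence[where w = "\<lambda>\<eta>. \<bar>Z \<eta>\<bar>"])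
      show "AE \<eta> in lamI. norm (ramp' k a b (\<xi> t \<eta>) * Z \<eta>) \<le> \<bar>Z \<eta>\<bar>" for k
        using ramp'_bound by (intro AE_I2) (auto simp: abs_mult intro!: mult_left_le_one_le)
      show "AE \<eta> in lamI. (\<lambda>k. ramp' k a b (\<xi> t \<eta>) * Z \<eta>) \<longlonglongrightarrow> (sgn (\<xi> t \<eta> - a) - sgn (\<xi> t \<eta> - b)) / 2 * Z \<eta>"
        by (intro AE_I2 tendsto_mult_right ramp'_lim)
    qed (use Zi Zm xm gm[OF rm] integrable_abs[OF Zi] in measurable)
    then show ?thesis unfolding z1 by (simp add: LIMSEQ_const_iff)
  qed
  \<comment> \<open>At the end \<open>a\<close> the limit of \<open>ramp'\<close> need not agree
    with the indicator, but only \<open>\<eta> = G t a\<close> can be mapped there.\<close>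
  have single: "AE \<eta> in lamI. \<xi> t \<eta> \<noteq> a" for a
    unfolding AE_lamI
  proof -
    have "AE \<eta> in lborel. \<eta> \<noteq> G t a" by (rule AE_lborel_singleton)
    then show "AE \<eta> in lborel. \<eta> \<in> I \<longrightarrow> \<xi> t \<eta> \<noteq> a"
      by eventually_elim (use G_xi in auto)
  qed
  have z3: "(\<integral>\<eta>. indicator {a<..} (\<xi> t \<eta>) * Z \<eta> \<partial>lamI) = 0" for a
  proof -
    have "(\<lambda>k. \<integral>\<eta>. (sgn (\<xi> t \<eta> - a) - sgn (\<xi> t \<eta> - real k)) / 2 * Z \<eta> \<partial>lamI) \<longlonglongrightarrow> (\<integral>\<eta>. indicator {a<..} (\<xi> t \<eta>) * Z \<eta> \<partial>lamI)"
    proof (rule integral_dominated_convergence[where w = "\<lambda>\<eta>. \<bar>Z \<eta>\<bar>"])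
      have "\<bar>(sgn x - sgn y) / 2\<bar> \<le> 1" for x y :: real by (auto simp: sgn_if)
      then show "AE \<eta> in lamI. norm ((sgn (\<xi> t \<eta> - a) - sgn (\<xi> t \<eta> - real k)) / 2 * Z \<eta>) \<le> \<bar>Z \<eta>\<bar>" for k
        by (intro AE_I2) (simp only: real_norm_def abs_mult, intro mult_left_le_one_le; simp)
      show "AE \<eta> in lamI. (\<lambda>k. (sgn (\<xi> t \<eta> - a) - sgn (\<xi> t \<eta> - real k)) / 2 * Z \<eta>) \<longlonglongrightarrow> indicator {a<..} (\<xi> t \<eta>) * Z \<eta>"
        using single[of a]
      proof eventually_elim
        case (elim \<eta>)
        have "\<forall>\<^sub>F k in sequentially. \<xi> t \<eta> < real k"
          using filterlim_real_sequentially[THEN filterlim_at_top_dense[THEN iffD1]] by auto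
        then have "\<forall>\<^sub>F k in sequentially. (sgn (\<xi> t \<eta> - a) - sgn (\<xi> t \<eta> - real k)) / 2 = indicator {a<..} (\<xi> t \<eta>)"
          by eventually_elim (use elim in \<open>auto simp: sgn_if indicator_def\<close>)
        then show ?case by (intro tendsto_mult_right tendsto_eventually)
      qed
    qed (use Zi Zm xm integrable_abs[OF Zi] in measurable)
    then show ?thesis unfolding z2 by (simp add: LIMSEQ_const_iff)
  qed
  have Gm: "G t \<in> borel_measurable borel"
    by (rule borel_measurable_mono) (auto simp: mono_def intro: G_mono[OF t0])
  interpret lam: finite_measure lamI by (rule finite_lamI)
  have "AE \<eta> in lamI. Z \<eta> = 0"
  proof (rule lam.density_zero[OF Zi])
    fix A assume A: "A \<in> sets lamI"
    then obtain A' where A': "A' \<in> sets borel" "A = I \<inter> A'" by (auto simp: sets_restrict_space)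
    have "set_lebesgue_integral lamI A Z = (\<integral>\<eta>. indicator (G t -` A') (\<xi> t \<eta>) * Z \<eta> \<partial>lamI)"
      unfolding set_lebesgue_integral_def
      by (intro Bochner_Integration.integral_cong refl)
         (auto simp: A'(2) indicator_def G_xi space_restrict_space)
    also have "\<dots> = 0"
      using measurable_sets[OF Gm A'(1)] by (intro halfline_integrals_zero[OF Zi xm z3]) auto
    finally show "set_lebesgue_integral lamI A Z = 0" .
  qed
  then show ?thesis by eventually_elim (simp add: Z_def)
qed

text \<open>\<open>P\<close> is \<open>p\<close> along the curve \<open>\<xi> r \<eta>\<close>, so
  \<open>p_DERIV_move\<close> gives \<open>Y p_x - w_x\<close>. Inserting
  \<open>Y = U - h \<xi>_\<eta>\<close> and \<open>p_x \<xi>_\<eta> = P_\<eta>\<close> turns this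
  into \<open>R - h P_\<eta>\<close>.\<close>

lemma P_AE_DERIV:
  assumes d: "AE \<eta> in lamI. (\<lambda>r. \<xi> r \<eta>) differentiable (at t)"
  shows "AE \<eta> in lamI. ((\<lambda>r. PP n \<mu> r \<eta>) has_real_derivative D \<eta>) (at t)"
proof -
  obtain M where M: "\<And>r x. r \<in> {0..t + 1} \<Longrightarrow> \<bar>u r x\<bar> \<le> M" using u_bdd[of "t + 1"] by blast
  define q where "q k \<eta> = real (Suc k) * (\<xi> (t + 1 / real (Suc k)) \<eta> - \<xi> t \<eta>)" for k \<eta>
  define Y where "Y \<eta> = lim (\<lambda>k. q k \<eta>)" for \<eta>
  have tk: "0 \<le> t + 1 / real (Suc k)" "t + 1 / real (Suc k) \<le> t + 1" for k using t by auto
  have qm: "q k \<in> borel_measurable lamI" for k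
    unfolding q_def[abs_def] by (intro borel_measurable_times borel_measurable_diff borel_measurable_const chi_measurable t0 tk)
  have Ym: "Y \<in> borel_measurable lamI" unfolding Y_def[abs_def] by (rule borel_measurable_lim_metric[OF qm])
  have lim: "(\<lambda>k. q k \<eta>) \<longlonglongrightarrow> d" if "((\<lambda>r. \<xi> r \<eta>) has_real_derivative d) (at t)" for \<eta> d
  proof -
    have "((\<lambda>h. (\<xi> (t + h) \<eta> - \<xi> t \<eta>) / h) \<longlongrightarrow> d) (at 0)" using that by (simp add: DERIV_def)
    then have "(\<lambda>k. (\<xi> (t + 1 / real (Suc k)) \<eta> - \<xi> t \<eta>) / (1 / real (Suc k))) \<longlonglongrightarrow> d"
      by (rule filterlim_compose)
         (use LIMSEQ_Suc[OF lim_1_over_n[where 'a=real]] in \<open>auto simp: filterlim_at\<close>)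
    then show ?thesis by (simp add: q_def mult.commute)
  qed
  have YD: "AE \<eta> in lamI. ((\<lambda>r. \<xi> r \<eta>) has_real_derivative Y \<eta>) (at t)"
    using d
  proof eventually_elim
    case (elim \<eta>)
    then obtain d where d: "((\<lambda>r. \<xi> r \<eta>) has_real_derivative d) (at t)" by (auto simp: real_differentiable_def)
    then have "Y \<eta> = d" using limI[OF lim] by (simp add: Y_def)
    then show ?case using d by simp
  qed
  have Yb: "AE \<eta> in lamI. \<bar>Y \<eta>\<bar> \<le> M"
    using YD AE_space
  proof eventually_elim
    case (elim \<eta>)
    then have eta: "\<eta> \<in> I" by (simp add: space_restrict_space)
    have "\<bar>q k \<eta>\<bar> \<le> M" for k
    proof -
      have "\<bar>\<xi> (t + 1 / real (Suc k)) \<eta> - \<xi> t \<eta>\<bar> \<le> M * \<bar>t + 1 / real (Suc k) - t\<bar>"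
        using tk[of k] t by (intro chi_time_lipschitz[OF _ _ M eta]) auto
      then have "real (Suc k) * \<bar>\<xi> (t + 1 / real (Suc k)) \<eta> - \<xi> t \<eta>\<bar> \<le> real (Suc k) * (M * (1 / real (Suc k)))"
        by (intro mult_left_mono) auto
      also have "\<dots> = M" by (simp del: of_nat_Suc)
      finally show ?thesis unfolding q_def abs_mult by (simp del: of_nat_Suc)
    qed
    then show ?case by (intro LIMSEQ_le_const2[OF tendsto_rabs[OF lim[OF elim(1)]]]) auto
  qed
  have Yi: "integrable lamI Y"
    by (rule finite_measure.integrable_const_bound[OF finite_lamI _ Ym, of M]) (use Yb in auto)
  obtain Mt where Mt: "\<And>a x. \<bar>u t x * Kd n (a - x)\<bar> \<le> Mt * real n" by (rule uK_bounded) blast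
  note [measurable] = u_meas
  show ?thesis
    using chi_velocity[OF Yi YD] YD chi_AE_DERIV[OF t0]
  proof eventually_elim
    case (elim \<eta>)
    define x where "x = \<xi> t \<eta>"
    have "((\<lambda>r. PP n \<mu> r \<eta>) has_real_derivative (\<integral>y. (u t y - Y \<eta>) * Kd n (y - x) \<partial>\<mu> t)) (at t)"
      unfolding PP_def x_def by (rule p_DERIV_move[OF elim(2) t])
    moreover have "(\<integral>y. (u t y - Y \<eta>) * Kd n (y - x) \<partial>\<mu> t) = D \<eta>"
    proof -
      have i1: "integrable (\<mu> t) (\<lambda>y. u t y * Kd n (x - y))" using Mt by (intro integrable_mu[OF t0]) measurable
      have i2: "integrable (\<mu> t) (\<lambda>y. Kd n (x - y))" using Kd_bound by (intro integrable_mu[OF t0]) measurable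
      have "(\<integral>y. (u t y - Y \<eta>) * Kd n (y - x) \<partial>\<mu> t) = (\<integral>y. Y \<eta> * Kd n (x - y) - u t y * Kd n (x - y) \<partial>\<mu> t)"
        by (subst Kd_diff_commute) (simp add: algebra_simps)
      also have "\<dots> = Y \<eta> * px t x - (\<integral>y. u t y * Kd n (x - y) \<partial>\<mu> t)"
        using i1 i2 by (simp add: px_def)
      also have "\<dots> = D \<eta>"
        using DERIV_imp_deriv[OF P_DERIV_eta[OF t0 elim(3)]] unfolding elim(1)
        by (simp add: D_def hh_eq RR_eq V_def x_def PP_def algebra_simps)
      finally show ?thesis .
    qed
    ultimately show ?case by simp
  qed
qed

end

section \<open>Almost every time is good for almost every \<open>\<eta>\<close>\<close>

context hs
begin

text \<open>For each \<open>\<eta>\<close> almost every time is good, and exchanging the two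
  quantifiers requires the set of bad pairs to be measurable. It is, because \<open>steep\<close>
  depends on the function only through its values at two times, and these are continuous in
  \<open>\<eta>\<close>.\<close>

lemma chi_AE_time_differentiable: "AE t in lborel. 0 < t \<longrightarrow> (AE \<eta> in lamI. (\<lambda>r. \<xi> r \<eta>) differentiable (at t))"
proof -
  have "AE t in lborel. t \<in> {0<..<T} \<longrightarrow> (AE \<eta> in lborel. \<eta> \<in> I \<longrightarrow> (\<lambda>r. \<xi> r \<eta>) differentiable (at t))" for T :: real
  proof (cases "T > 0")
    case True
    obtain M where M: "M \<ge> 0" "\<And>r x. r \<in> {0..T} \<Longrightarrow> \<bar>u r x\<bar> \<le> M" using u_bdd[of T] by blast
    \<comment> \<open>Freezing the time outside \<open>{0..T}\<close> makes the function Lipschitz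
      on the whole line.\<close>
    define f where "f \<eta> r = \<xi> (min T (max 0 r)) \<eta>" for \<eta> r
    have lip: "M-lipschitz_on UNIV (f \<eta>)" if "\<eta> \<in> I" for \<eta>
    proof (rule lipschitz_onI)
      fix x y :: real
      have "\<bar>f \<eta> x - f \<eta> y\<bar> \<le> M * \<bar>min T (max 0 x) - min T (max 0 y)\<bar>"
        unfolding f_def using True by (intro chi_time_lipschitz[OF _ _ M(2) that]) auto
      also have "\<dots> \<le> M * \<bar>x - y\<bar>" using M(1) by (intro mult_left_mono) auto
      finally show "dist (f \<eta> x) (f \<eta> y) \<le> M * dist x y" by (simp add: dist_real_def)
    qed (rule M(1))
    have fc: "continuous_on I (\<lambda>\<eta>. f \<eta> r)" for r unfolding f_def using True by (intro chi_cont) auto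
    define A where "A F s d = {z. fst z \<in> I \<and> snd z \<in> steep (F (fst z)) s d}" for F :: "real \<Rightarrow> real \<Rightarrow> real" and s d
    \<comment> \<open>For fixed interval ends \<open>a\<close> and \<open>b\<close> the condition on
      \<open>\<eta>\<close> is open and the condition on the time is \<open>{a<..<b}\<close>, so the
      set is a union of open rectangles.\<close>
    have oA: "open (A F s d)" if F: "\<And>r. continuous_on I (\<lambda>\<eta>. F \<eta> r)" for F s d
    proof -
      have "A F s d = (\<Union>(a, b)\<in>{(a, b). b - a < d}. {\<eta>\<in>I. s * (b - a) < F \<eta> b - F \<eta> a} \<times> {a<..<b})"
        unfolding A_def steep_def by fastforce
      moreover have "open {\<eta>\<in>I. s * (b - a) < F \<eta> b - F \<eta> a}" for a b
      proof -
        have "open (I \<inter> (\<lambda>\<eta>. F \<eta> b - F \<eta> a) -` {s * (b - a)<..})"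
          by (intro continuous_open_preimage continuous_on_diff F) auto
        moreover have "I \<inter> (\<lambda>\<eta>. F \<eta> b - F \<eta> a) -` {s * (b - a)<..} = {\<eta>\<in>I. s * (b - a) < F \<eta> b - F \<eta> a}" by auto
        ultimately show ?thesis by simp
      qed
      ultimately show ?thesis by (auto intro!: open_UN open_Times)
    qed
    define Bad where "Bad = {z. fst z \<in> I \<and> snd z \<in> nondiff (f (fst z))}"
    have "Bad = (\<Union>r\<in>\<rat>. \<Union>s\<in>{s\<in>\<rat>. r < s}. \<Inter>k. A f s (1 / Suc k) \<inter> A (\<lambda>\<eta> x. - f \<eta> x) (- r) (1 / Suc k))"
      unfolding Bad_def nondiff_def A_def by auto
    moreover have "\<dots> \<in> sets borel"
      using oA[of f, OF fc] oA[of "\<lambda>\<eta> x. - f \<eta> x", OF continuous_on_minus[OF fc]]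
      by (intro sets.countable_UN'' countable_rat countable_Rats_above sets.countable_INT'') (auto intro!: borel_open open_Int)
    ultimately have Bad: "Bad \<in> sets (lborel \<Otimes>\<^sub>M lborel)"
      by (simp add: borel_prod[symmetric] sets_pair_measure_cong[OF sets_lborel sets_lborel])
    have "AE \<eta> in lborel. AE t in lborel. (\<eta>, t) \<notin> Bad"
    proof (rule AE_I2)
      fix \<eta> :: real
      show "AE t in lborel. (\<eta>, t) \<notin> Bad"
        using AE_not_in[OF lipschitz_nondiff_null[OF lip[of \<eta>]]] by (cases "\<eta> \<in> I") (auto simp: Bad_def)
    qed
    moreover have "{x \<in> space (lborel \<Otimes>\<^sub>M lborel). (fst x, snd x) \<notin> Bad} \<in> sets (lborel \<Otimes>\<^sub>M lborel)"
    proof -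
      have "{x \<in> space (lborel \<Otimes>\<^sub>M lborel). (fst x, snd x) \<notin> Bad} = space (lborel \<Otimes>\<^sub>M lborel) - Bad" by auto
      then show ?thesis using sets.compl_sets[OF Bad] by simp
    qed
    ultimately have "AE t in lborel. AE \<eta> in lborel. (\<eta>, t) \<notin> Bad"
      by (subst (asm) lborel_pair.AE_commute) auto
    then show ?thesis
    proof eventually_elim
      case (elim t)
      show ?case
      proof
        assume tT: "t \<in> {0<..<T}"
        show "AE \<eta> in lborel. \<eta> \<in> I \<longrightarrow> (\<lambda>r. \<xi> r \<eta>) differentiable (at t)"
          using elim
        proof eventually_elim
          case (elim \<eta>)
          show ?case
          proof
            assume eta: "\<eta> \<in> I"
            then have "f \<eta> differentiable (at t)"
              using elim not_nondiff_differentiable[OF lip[OF eta], of t] by (auto simp: Bad_def)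
            then obtain d where "(f \<eta> has_real_derivative d) (at t)" by (auto simp: real_differentiable_def)
            then have "((\<lambda>r. \<xi> r \<eta>) has_real_derivative d) (at t)"
              by (rule has_field_derivative_transform_within_open[of _ _ _ "{0<..<T}"]) (use tT in \<open>auto simp: f_def\<close>)
            then show "(\<lambda>r. \<xi> r \<eta>) differentiable (at t)" by (auto simp: real_differentiable_def)
          qed
        qed
      qed
    qed
  qed auto
  then have "AE t in lborel. \<forall>N::nat. t \<in> {0<..<real N} \<longrightarrow> (AE \<eta> in lborel. \<eta> \<in> I \<longrightarrow> (\<lambda>r. \<xi> r \<eta>) differentiable (at t))"
    unfolding AE_all_countable by blast
  then show ?thesis
  proof eventually_elim
    case (elim t)
    obtain N :: nat where "t < real N" using reals_Archimedean2 by blast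
    then show ?case using elim unfolding AE_lamI by auto
  qed
qed

end

section \<open>The equation in \<open>L\<^sup>\<gamma>\<close>\<close>

lemma tendsto_zero_powr_ennreal:
  assumes "(f \<longlongrightarrow> (0::real)) F" "0 < \<gamma>"
  shows "((\<lambda>x. ennreal (\<bar>f x\<bar> powr \<gamma>)) \<longlongrightarrow> 0) F"
proof -
  have "((\<lambda>x. \<bar>f x\<bar> powr \<gamma>) \<longlongrightarrow> 0) F"
    using assms by (intro tendsto_zero_powrI[where b = \<gamma>]) (auto intro: tendsto_rabs_zero)
  then show ?thesis using tendsto_ennrealI by fastforce
qed

context hs
begin

lemma borel_closed_interval:
  fixes F :: "real \<Rightarrow> real"
  assumes "F \<in> borel_measurable lamI"
  shows "set_borel_measurable lborel {0..BC n \<mu>} F"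
proof -
  have "(\<lambda>\<eta>. indicator I \<eta> * F \<eta>) \<in> borel_measurable lborel"
    using assms unfolding measurable_lamI by simp
  then have "(\<lambda>\<eta>. indicator {0..BC n \<mu>} \<eta> *\<^sub>R F \<eta>) \<in> borel_measurable lborel"
    by (rule measurable_discrete_difference[of _ _ _ "{0, BC n \<mu>}"]) (auto simp: indicator_def)
  then show ?thesis by (simp add: set_borel_measurable_def)
qed

lemma AE_closed_interval:
  assumes "AE \<eta> in lamI. Q \<eta>"
  shows "AE \<eta> in lborel. \<eta> \<in> {0..BC n \<mu>} \<longrightarrow> Q \<eta>"
  using assms[unfolded AE_lamI] AE_lborel_singleton[of 0] AE_lborel_singleton[of "BC n \<mu>"]
  by eventually_elim auto

lemma nn_integral_lamI: "(\<integral>\<^sup>+\<eta>\<in>{0..BC n \<mu>}. F \<eta> \<partial>lborel) = (\<integral>\<^sup>+\<eta>. F \<eta> \<partial>lamI)"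
proof -
  have "(\<integral>\<^sup>+\<eta>. F \<eta> \<partial>lamI) = (\<integral>\<^sup>+\<eta>. F \<eta> * indicator I \<eta> \<partial>lborel)"
    by (rule nn_integral_restrict_space) auto
  also have "\<dots> = (\<integral>\<^sup>+\<eta>. F \<eta> * indicator {0..BC n \<mu>} \<eta> \<partial>lborel)"
  proof (rule nn_integral_cong_AE)
    show "AE \<eta> in lborel. F \<eta> * indicator I \<eta> = F \<eta> * indicator {0..BC n \<mu>} \<eta>"
      using AE_lborel_singleton[of 0] AE_lborel_singleton[of "BC n \<mu>"]
      by eventually_elim (auto simp: indicator_def)
  qed
  finally show ?thesis by simp
qed

lemma emeasure_lamI_finite: "emeasure lamI (space lamI) < \<infinity>"
  using finite_measure.emeasure_finite[OF finite_lamI] by (simp add: less_top)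

lemma bounded_Lp_Linf:
  assumes F: "F \<in> borel_measurable lamI" and B: "AE \<eta> in lamI. \<bar>F \<eta>\<bar> \<le> B" and \<gamma>: "0 < \<gamma>"
  shows "Lp_on {0..BC n \<mu>} \<gamma> F" "Linf_on {0..BC n \<mu>} F"
proof -
  have "(\<integral>\<^sup>+\<eta>. ennreal (\<bar>F \<eta>\<bar> powr \<gamma>) \<partial>lamI) \<le> (\<integral>\<^sup>+\<eta>. ennreal (B powr \<gamma>) \<partial>lamI)"
    by (rule nn_integral_mono_AE) (use B \<gamma> in \<open>auto elim!: eventually_mono intro!: ennreal_leI powr_mono2\<close>)
  also have "\<dots> < \<infinity>" using emeasure_lamI_finite by (simp add: ennreal_mult_less_top)
  finally show "Lp_on {0..BC n \<mu>} \<gamma> F"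
    unfolding Lp_on_def nn_integral_lamI using borel_closed_interval[OF F] by simp
  show "Linf_on {0..BC n \<mu>} F"
    unfolding Linf_on_def using borel_closed_interval[OF F] AE_closed_interval[OF B] by auto
qed

text \<open>The Lipschitz constant \<open>L\<close> of \<open>P\<close> in time bounds the
  difference quotients and thereby their limit \<open>D\<close>. On an interval of finite length the
  constant \<open>(2 * L) powr \<gamma>\<close> is then an integrable majorant.\<close>

lemma Lp_time_derivative:
  assumes t: "0 < t" and \<gamma>: "0 < \<gamma>" and D: "D \<in> borel_measurable lamI"
    and P: "AE \<eta> in lamI. ((\<lambda>r. PP n \<mu> r \<eta>) has_real_derivative D \<eta>) (at t)"
  shows "Lp_on {0..BC n \<mu>} \<gamma> D" "Linf_on {0..BC n \<mu>} D"
    "((\<lambda>\<tau>. Lp_dist_pow {0..BC n \<mu>} \<gamma> (\<lambda>\<eta>. (PP n \<mu> (t + \<tau>) \<eta> - PP n \<mu> t \<eta>) / \<tau>) D) \<longlongrightarrow> 0) (at 0)"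
proof -
  obtain M where M: "M \<ge> 0" "\<And>r x. r \<in> {0..t + 1} \<Longrightarrow> \<bar>u r x\<bar> \<le> M" using u_bdd[of "t + 1"] by blast
  define L where "L = 2 * (M * real n * C)"
  \<comment> \<open>Keeps \<open>t + \<tau>\<close> within \<open>{0..t + 1}\<close>, where the
    bound \<open>M\<close> is available.\<close>
  define S where "S = {- min t 1<..<min t 1}"
  define q where "q \<tau> \<eta> = (PP n \<mu> (t + \<tau>) \<eta> - PP n \<mu> t \<eta>) / \<tau>" for \<tau> \<eta>
  have S: "open S" "0 \<in> S" using t by (auto simp: S_def)
  have S': "t + \<tau> \<in> {0..t + 1}" "0 \<le> t + \<tau>" if "\<tau> \<in> S" for \<tau> using that by (auto simp: S_def)
  have qL: "\<bar>q \<tau> \<eta>\<bar> \<le> L" if "\<tau> \<in> S" "\<tau> \<noteq> 0" "\<eta> \<in> I" for \<tau> \<eta>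
  proof -
    have "\<bar>PP n \<mu> (t + \<tau>) \<eta> - PP n \<mu> t \<eta>\<bar> \<le> L * \<bar>t + \<tau> - t\<bar>"
      unfolding L_def using S'[OF that(1)] t by (intro P_time_lipschitz[OF _ _ M(2) that(3)]) auto
    then show ?thesis using that(2) by (simp add: q_def abs_divide divide_le_eq)
  qed
  have qlim: "(q' \<longlongrightarrow> D \<eta>) (at 0)" if "((\<lambda>r. PP n \<mu> r \<eta>) has_real_derivative D \<eta>) (at t)" "q' = (\<lambda>\<tau>. q \<tau> \<eta>)" for \<eta> q'
    using that by (simp add: q_def DERIV_def)
  have DL: "AE \<eta> in lamI. \<bar>D \<eta>\<bar> \<le> L"
    using P AE_space
  proof eventually_elim
    case (elim \<eta>)
    then have eta: "\<eta> \<in> I" by (simp add: space_restrict_space)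
    have "((\<lambda>\<tau>. q \<tau> \<eta>) \<longlongrightarrow> D \<eta>) (at 0)" by (rule qlim[OF elim(1) refl])
    then have lim: "((\<lambda>\<tau>. \<bar>q \<tau> \<eta>\<bar>) \<longlongrightarrow> \<bar>D \<eta>\<bar>) (at 0)" by (rule tendsto_rabs)
    have "\<forall>\<^sub>F \<tau> in at 0. \<tau> \<in> S - {0}" using S eventually_at_in_open by fastforce
    then have "\<forall>\<^sub>F \<tau> in at 0. \<bar>q \<tau> \<eta>\<bar> \<le> L" by eventually_elim (use qL eta in auto)
    then show ?case by (intro tendsto_upperbound[OF lim]) auto
  qed
  show "Lp_on {0..BC n \<mu>} \<gamma> D" "Linf_on {0..BC n \<mu>} D" by (rule bounded_Lp_Linf[OF D DL \<gamma>])+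
  have "((\<lambda>\<tau>. \<integral>\<^sup>+\<eta>. ennreal (\<bar>q \<tau> \<eta> - D \<eta>\<bar> powr \<gamma>) \<partial>lamI) \<longlongrightarrow> 0) (at 0 within S)"
    unfolding tendsto_at_iff_sequentially
  proof (intro allI impI)
    fix X :: "nat \<Rightarrow> real" assume X: "\<forall>i. X i \<in> S - {0}" "X \<longlonglongrightarrow> 0"
    have qm: "q (X i) \<in> borel_measurable lamI" for i
      unfolding q_def[abs_def] using X S' t
      by (intro borel_measurable_divide borel_measurable_diff borel_measurable_const P_measurable) auto
    have "(\<lambda>i. \<integral>\<^sup>+\<eta>. ennreal (\<bar>q (X i) \<eta> - D \<eta>\<bar> powr \<gamma>) \<partial>lamI) \<longlonglongrightarrow> (\<integral>\<^sup>+\<eta>. 0 \<partial>lamI)"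
    proof (rule nn_integral_dominated_convergence[where w = "\<lambda>_. ennreal ((2 * L) powr \<gamma>)"])
      show "AE \<eta> in lamI. ennreal (\<bar>q (X j) \<eta> - D \<eta>\<bar> powr \<gamma>) \<le> ennreal ((2 * L) powr \<gamma>)" for j
        using DL AE_space
      proof eventually_elim
        case (elim \<eta>)
        then have "\<bar>q (X j) \<eta>\<bar> \<le> L" using qL X by (auto simp: space_restrict_space)
        then show ?case using elim(1) \<gamma> by (intro ennreal_leI powr_mono2) auto
      qed
      show "AE \<eta> in lamI. (\<lambda>i. ennreal (\<bar>q (X i) \<eta> - D \<eta>\<bar> powr \<gamma>)) \<longlonglongrightarrow> 0"
        using P
      proof eventually_elim
        case (elim \<eta>)
        have "(\<lambda>i. q (X i) \<eta>) \<longlonglongrightarrow> D \<eta>"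
          by (rule filterlim_compose[OF qlim[OF elim refl]]) (use X in \<open>auto simp: filterlim_at\<close>)
        then show ?case by (intro tendsto_zero_powr_ennreal \<gamma>) (simp add: LIM_zero)
      qed
    qed (use qm D emeasure_lamI_finite in \<open>auto simp: ennreal_mult_less_top\<close>)
    then show "((\<lambda>\<tau>. \<integral>\<^sup>+\<eta>. ennreal (\<bar>q \<tau> \<eta> - D \<eta>\<bar> powr \<gamma>) \<partial>lamI) \<circ> X) \<longlonglongrightarrow> 0"
      by (simp add: comp_def)
  qed
  then show "((\<lambda>\<tau>. Lp_dist_pow {0..BC n \<mu>} \<gamma> (\<lambda>\<eta>. (PP n \<mu> (t + \<tau>) \<eta> - PP n \<mu> t \<eta>) / \<tau>) D) \<longlongrightarrow> 0) (at 0)"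
    unfolding Lp_dist_pow_def nn_integral_lamI q_def at_within_open[OF S(2,1)] .
qed

lemma P_Lp_Linf:
  assumes "0 \<le> t" "0 < \<gamma>"
  shows "Lp_on {0..BC n \<mu>} \<gamma> (PP n \<mu> t)" "Linf_on {0..BC n \<mu>} (PP n \<mu> t)"
  using p_nonneg p_le[OF assms(1)]
  by (auto intro!: bounded_Lp_Linf[OF P_measurable[OF assms(1)] _ assms(2), of C] AE_I2 simp: PP_def)

lemma P_Lp_continuous:
  assumes t0: "t0 \<in> {0..T}" and \<gamma>: "0 < \<gamma>"
  shows "((\<lambda>t. Lp_dist_pow {0..BC n \<mu>} \<gamma> (PP n \<mu> t) (PP n \<mu> t0)) \<longlongrightarrow> 0) (at t0 within {0..T})"
proof -
  obtain M where M: "M \<ge> 0" "\<And>r x. r \<in> {0..T} \<Longrightarrow> \<bar>u r x\<bar> \<le> M" using u_bdd[of T] by blast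
  define L where "L = 2 * (M * real n * C)"
  have le: "Lp_dist_pow {0..BC n \<mu>} \<gamma> (PP n \<mu> t) (PP n \<mu> t0) \<le> ennreal (\<bar>L * \<bar>t - t0\<bar>\<bar> powr \<gamma>) * emeasure lamI (space lamI)"
    if t: "t \<in> {0..T}" for t
  proof -
    have "Lp_dist_pow {0..BC n \<mu>} \<gamma> (PP n \<mu> t) (PP n \<mu> t0) \<le> (\<integral>\<^sup>+\<eta>. ennreal (\<bar>L * \<bar>t - t0\<bar>\<bar> powr \<gamma>) \<partial>lamI)"
      unfolding Lp_dist_pow_def nn_integral_lamI
    proof (rule nn_integral_mono)
      fix \<eta> assume "\<eta> \<in> space lamI"
      then have eta: "\<eta> \<in> I" by (simp add: space_restrict_space)
      have "\<bar>PP n \<mu> t \<eta> - PP n \<mu> t0 \<eta>\<bar> \<le> L * \<bar>t - t0\<bar>"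
        unfolding L_def by (rule P_time_lipschitz[OF t0 t M(2) eta])
      then show "ennreal (\<bar>PP n \<mu> t \<eta> - PP n \<mu> t0 \<eta>\<bar> powr \<gamma>) \<le> ennreal (\<bar>L * \<bar>t - t0\<bar>\<bar> powr \<gamma>)"
        using \<gamma> by (intro ennreal_leI powr_mono2) auto
    qed
    then show ?thesis by simp
  qed
  have "((\<lambda>t. L * \<bar>t - t0\<bar>) \<longlongrightarrow> L * \<bar>t0 - t0\<bar>) (at t0 within {0..T})" by (intro tendsto_intros)
  then have "((\<lambda>t. ennreal (\<bar>L * \<bar>t - t0\<bar>\<bar> powr \<gamma>)) \<longlongrightarrow> 0) (at t0 within {0..T})"
    by (intro tendsto_zero_powr_ennreal \<gamma>) simp
  then have "((\<lambda>t. emeasure lamI (space lamI) * ennreal (\<bar>L * \<bar>t - t0\<bar>\<bar> powr \<gamma>)) \<longlongrightarrow> emeasure lamI (space lamI) * 0) (at t0 within {0..T})"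
    using emeasure_lamI_finite[unfolded infinity_ennreal_def] by (intro ennreal_tendsto_cmult)
  then have up: "((\<lambda>t. ennreal (\<bar>L * \<bar>t - t0\<bar>\<bar> powr \<gamma>) * emeasure lamI (space lamI)) \<longlongrightarrow> 0) (at t0 within {0..T})"
    by (simp add: mult.commute)
  have "\<forall>\<^sub>F t in at t0 within {0..T}. Lp_dist_pow {0..BC n \<mu>} \<gamma> (PP n \<mu> t) (PP n \<mu> t0)
      \<le> ennreal (\<bar>L * \<bar>t - t0\<bar>\<bar> powr \<gamma>) * emeasure lamI (space lamI)"
    unfolding eventually_at_filter by (intro always_eventually allI impI le)
  from tendsto_sandwich[OF _ this tendsto_const up] show ?thesis by simp
qed

lemma P_equation_Lp:
  assumes atomless: "AE t in lborel. 0 < t \<longrightarrow> (\<forall>x. measure (\<mu> t) {x} = 0)" and \<gamma>: "0 < \<gamma>"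
  shows "AE t in lborel. 0 < t \<longrightarrow>
    (let D = (\<lambda>\<eta>. RR n u \<mu> t \<eta> - hh n u \<mu> t \<eta> * deriv (PP n \<mu> t) \<eta>)
     in Lp_on {0..BC n \<mu>} \<gamma> D \<and> Linf_on {0..BC n \<mu>} D \<and>
        ((\<lambda>\<tau>. Lp_dist_pow {0..BC n \<mu>} \<gamma> (\<lambda>\<eta>. (PP n \<mu> (t + \<tau>) \<eta> - PP n \<mu> t \<eta>) / \<tau>) D) \<longlongrightarrow> 0) (at 0))"
  using atomless chi_AE_time_differentiable
proof eventually_elim
  case (elim t)
  define D where "D = (\<lambda>\<eta>. RR n u \<mu> t \<eta> - hh n u \<mu> t \<eta> * deriv (PP n \<mu> t) \<eta>)"
  have "D \<in> borel_measurable lamI \<and> (AE \<eta> in lamI. ((\<lambda>r. PP n \<mu> r \<eta>) has_real_derivative D \<eta>) (at t))" if t: "0 < t"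
  proof (cases "C = 0")
    \<comment> \<open>Without mass \<open>I\<close> is empty and the claims on it are
      trivial.\<close>
    case True
    then have "I = {}" using BC_eq by auto
    then show ?thesis unfolding measurable_lamI AE_lamI by simp
  next
    case False
    interpret good: hs_good u \<mu> \<psi>p \<psi>m n t
      using elim False C_nonneg t by unfold_locales auto
    have "D = good.D" by (simp add: D_def good.D_def fun_eq_iff)
    then show ?thesis using good.D_measurable good.P_AE_DERIV elim t by simp
  qed
  then show ?case unfolding Let_def D_def[symmetric] using Lp_time_derivative[OF _ \<gamma>] by blast
qed

end

section \<open>From weak conservative solutions to the transport setting\<close>

lemma abs_cont_density_atomless:
  fixes x :: real
  assumes "abs_cont_density M g"
  shows "measure M {x} = 0"
proof -
  have "emeasure M {x} = (\<integral>\<^sup>+y\<in>{x}. ennreal (g y) \<partial>lborel)"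
    using assms by (simp add: abs_cont_density_def)
  also have "\<dots> = (\<integral>\<^sup>+(y::real). 0 \<partial>lborel)"
    by (rule nn_integral_cong_AE) (use AE_lborel_singleton[of x] in \<open>auto elim!: eventually_mono\<close>)
  finally show ?thesis by (simp add: measure_def)
qed

text \<open>If \<open>\<bar>f x\<bar>\<close> exceeds \<open>K\<close>, then \<open>f\<close> is at
  least \<open>\<bar>f x\<bar> - K\<close> in absolute value on the interval \<open>{x..x+1}\<close>
  of length 1, and the integral of the square controls this value.\<close>

lemma sq_int_bounded:
  assumes f: "sq_int f" and osc: "\<And>x y. \<bar>x - y\<bar> \<le> 1 \<Longrightarrow> \<bar>f x - f y\<bar> \<le> K"
  shows "\<bar>f x\<bar> \<le> K + sqrt (\<integral>y. (f y)\<^sup>2 \<partial>lborel)"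
proof (cases "\<bar>f x\<bar> \<le> K")
  case True
  then show ?thesis by (simp add: add_increasing2)
next
  case False
  have fi: "integrable lborel (\<lambda>y. (f y)\<^sup>2)" using f by (simp add: sq_int_def)
  have "(\<bar>f x\<bar> - K)\<^sup>2 = (\<integral>y. indicator {x..x+1} y * (\<bar>f x\<bar> - K)\<^sup>2 \<partial>lborel)" by simp
  also have "\<dots> \<le> (\<integral>y. (f y)\<^sup>2 \<partial>lborel)"
  proof (rule integral_mono[OF _ fi])
    show "integrable lborel (\<lambda>y. indicator {x..x+1} y * (\<bar>f x\<bar> - K)\<^sup>2)"
      by (intro integrable_mult_left integrable_real_indicator) auto
    fix y
    show "indicator {x..x+1} y * (\<bar>f x\<bar> - K)\<^sup>2 \<le> (f y)\<^sup>2"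
    proof (cases "y \<in> {x..x+1}")
      case True
      then have "\<bar>f x\<bar> - K \<le> \<bar>f y\<bar>" using osc[of x y] by auto
      then have "(\<bar>f x\<bar> - K)\<^sup>2 \<le> \<bar>f y\<bar>\<^sup>2" using False by (intro power_mono) auto
      then show ?thesis using True by simp
    qed simp
  qed
  finally have "sqrt ((\<bar>f x\<bar> - K)\<^sup>2) \<le> sqrt (\<integral>y. (f y)\<^sup>2 \<partial>lborel)" by (rule real_sqrt_le_mono)
  then show ?thesis using False by simp
qed

text \<open>Hoelder continuity supplies the continuity in space and time. For the bound on
  \<open>u\<close>, the square integrable part of \<open>u 0\<close> has bounded oscillation on unit
  intervals and is therefore bounded; up to time \<open>T\<close> the Hoelder estimate in time adds
  a constant.\<close>

lemma HS_weak_solution: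
  assumes psi: "cutoff_pair \<psi>p \<psi>m" and sol: "HS_weak_conservative \<psi>p \<psi>m u \<mu>"
  shows "weak_solution u \<mu> \<psi>p \<psi>m"
proof -
  interpret cutoffs \<psi>p \<psi>m by unfold_locales (rule psi)
  have E2: "E2 \<psi>p \<psi>m (u 0)" and fin: "\<And>t. 0 \<le> t \<Longrightarrow> finite_borel_measure (\<mu> t)"
    and weak: "\<And>\<phi>. test_fun2 \<phi> \<Longrightarrow> (LINT t:{0..}|lborel. (\<integral>x. dt \<phi> t x + u t x * dx \<phi> t x \<partial>(\<mu> t))) = - (\<integral>x. \<phi> 0 x \<partial>(\<mu> 0))"
    and holder: "\<And>T. 0 < T \<Longrightarrow> holder_on ({0..T} \<times> UNIV) (\<lambda>(t, x). u t x)"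
    and wc: "\<And>f::real \<Rightarrow> real. continuous_on UNIV f \<Longrightarrow> bounded (range f) \<Longrightarrow> continuous_on {0..} (\<lambda>t. \<integral>x. f x \<partial>(\<mu> t))"
    using sol unfolding HS_weak_conservative_def by auto
  have H: "\<exists>\<alpha> L. 0 < \<alpha> \<and> 0 \<le> L \<and> (\<forall>t\<in>{0..T}. \<forall>s\<in>{0..T}. \<forall>x y. \<bar>u t x - u s y\<bar> \<le> L * dist (t, x) (s, y) powr \<alpha>)"
    if T: "0 < T" for T
  proof -
    obtain \<alpha> L where aL: "0 < \<alpha>" "\<And>p q. p \<in> {0..T} \<times> UNIV \<Longrightarrow> q \<in> {0..T} \<times> UNIV \<Longrightarrow>
        \<bar>(case p of (t, x) \<Rightarrow> u t x) - (case q of (t, x) \<Rightarrow> u t x)\<bar> \<le> L * dist p q powr \<alpha>"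
      using holder[OF T] unfolding holder_on_def by blast
    \<comment> \<open>\<open>holder_on\<close> leaves the sign of its constant open, while the
      estimates below multiply inequalities by it.\<close>
    have "\<bar>u t x - u s y\<bar> \<le> \<bar>L\<bar> * dist (t, x) (s, y) powr \<alpha>" if "t \<in> {0..T}" "s \<in> {0..T}" for t s x y
    proof -
      have "\<bar>u t x - u s y\<bar> \<le> L * dist (t, x) (s, y) powr \<alpha>" using aL(2)[of "(t, x)" "(s, y)"] that by simp
      also have "\<dots> \<le> \<bar>L\<bar> * dist (t, x) (s, y) powr \<alpha>" by (intro mult_right_mono) auto
      finally show ?thesis .
    qed
    then show ?thesis using aL(1) by (intro exI[of _ \<alpha>] exI[of _ "\<bar>L\<bar>"]) auto
  qed
  have small: "\<exists>d>0. \<forall>r. \<bar>r\<bar> < d \<longrightarrow> L * \<bar>r\<bar> powr \<alpha> < e" if "0 < \<alpha>" "0 < e" for L \<alpha> e :: real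
  proof -
    have "((\<lambda>r. \<bar>r\<bar>) \<longlongrightarrow> 0) (nhds (0::real))" by (intro tendsto_rabs_zero filterlim_ident)
    then have "((\<lambda>r. L * \<bar>r\<bar> powr \<alpha>) \<longlongrightarrow> L * 0) (nhds (0::real))"
      using that by (intro tendsto_mult_left tendsto_zero_powrI[where b = \<alpha>]) auto
    then have "\<forall>\<^sub>F r in nhds 0. L * \<bar>r\<bar> powr \<alpha> < e" using that by (intro order_tendstoD) auto
    then show ?thesis unfolding eventually_nhds_metric by (simp add: dist_real_def)
  qed
  have "weak_flow u \<mu>"
  proof (rule weak_flow.intro)
    show "sets (\<mu> t) = sets borel" if "0 \<le> t" for t using fin[OF that] by (simp add: finite_borel_measure_def)
    show "finite_measure (\<mu> t)" if "0 \<le> t" for t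
    proof
      have "sets (\<mu> t) = sets borel" using fin[OF that] by (simp add: finite_borel_measure_def)
      then have "space (\<mu> t) = UNIV" using sets_eq_imp_space_eq by fastforce
      then show "emeasure (\<mu> t) (space (\<mu> t)) \<noteq> \<infinity>" using fin[OF that] by (auto simp: finite_borel_measure_def)
    qed
    show "continuous_on {0..} (\<lambda>t. \<integral>x. f x \<partial>\<mu> t)" if "continuous_on UNIV f" "bounded (range f)" for f :: "real \<Rightarrow> real"
      by (rule wc[OF that])
    show "continuous_on UNIV (u t)" if t: "0 \<le> t" for t
    proof -
      obtain \<alpha> L where aL: "0 < \<alpha>" "0 \<le> L" "\<forall>r\<in>{0..t+1}. \<forall>s\<in>{0..t+1}. \<forall>x y. \<bar>u r x - u s y\<bar> \<le> L * dist (r, x) (s, y) powr \<alpha>"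
        using H[of "t + 1"] t by auto
      show ?thesis
        unfolding continuous_on_iff
      proof (intro ballI allI impI)
        fix x e :: real assume "0 < e"
        then obtain d where d: "d > 0" "\<And>r. \<bar>r\<bar> < d \<Longrightarrow> L * \<bar>r\<bar> powr \<alpha> < e" using small[OF aL(1)] by blast
        have "dist (u t y) (u t x) < e" if "dist y x < d" for y
        proof -
          have "\<bar>u t y - u t x\<bar> \<le> L * dist (t, y) (t, x) powr \<alpha>" using aL(3) t by auto
          also have "dist (t, y) (t, x) = \<bar>y - x\<bar>" by (simp add: dist_Pair_Pair dist_real_def)
          also have "L * \<bar>y - x\<bar> powr \<alpha> < e" using that by (intro d) (simp add: dist_real_def)
          finally show ?thesis by (simp add: dist_real_def)
        qed
        then show "\<exists>d>0. \<forall>y\<in>UNIV. dist y x < d \<longrightarrow> dist (u t y) (u t x) < e" using d(1) by auto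
      qed
    qed
    show "\<exists>d>0. \<forall>s\<ge>0. \<bar>s - t\<bar> < d \<longrightarrow> (\<forall>x. \<bar>u s x - u t x\<bar> \<le> e)" if t: "0 \<le> t" "0 < e" for t e
    proof -
      obtain \<alpha> L where aL: "0 < \<alpha>" "0 \<le> L" "\<forall>r\<in>{0..t+1}. \<forall>s\<in>{0..t+1}. \<forall>x y. \<bar>u r x - u s y\<bar> \<le> L * dist (r, x) (s, y) powr \<alpha>"
        using H[of "t + 1"] t by auto
      obtain d where d: "d > 0" "\<And>r. \<bar>r\<bar> < d \<Longrightarrow> L * \<bar>r\<bar> powr \<alpha> < e" using small[OF aL(1) t(2)] by blast
      have "\<bar>u s x - u t x\<bar> \<le> e" if "0 \<le> s" "\<bar>s - t\<bar> < min d 1" for s x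
      proof -
        have "\<bar>u s x - u t x\<bar> \<le> L * dist (s, x) (t, x) powr \<alpha>" using aL(3) t that by auto
        also have "dist (s, x) (t, x) = \<bar>s - t\<bar>" by (simp add: dist_Pair_Pair dist_real_def)
        also have "L * \<bar>s - t\<bar> powr \<alpha> < e" using that by (intro d) simp
        finally show ?thesis by simp
      qed
      then show ?thesis using d(1) by (intro exI[of _ "min d 1"]) auto
    qed
    show "\<exists>M\<ge>0. \<forall>t\<in>{0..T}. \<forall>x. \<bar>u t x\<bar> \<le> M" for T
    proof -
      \<comment> \<open>The Hoelder condition is stated for positive end times, the bound is wanted
        for every real \<open>T\<close>.\<close>
      define T' where "T' = max T 1"
      have T': "0 < T'" by (simp add: T'_def)
      obtain \<alpha> L where aL: "0 < \<alpha>" "0 \<le> L" "\<forall>r\<in>{0..T'}. \<forall>s\<in>{0..T'}. \<forall>x y. \<bar>u r x - u s y\<bar> \<le> L * dist (r, x) (s, y) powr \<alpha>"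
        using H[OF T'] by auto
      obtain fb a b where fb: "sq_int fb" "u 0 = (\<lambda>x. fb x + a * \<psi>p x + b * \<psi>m x)"
        using E2 unfolding E2_def H1_def by auto
      define K where "K = L + \<bar>a\<bar> + \<bar>b\<bar>"
      have osc: "\<bar>fb x - fb y\<bar> \<le> K" if "\<bar>x - y\<bar> \<le> 1" for x y
      proof -
        have "\<bar>u 0 x - u 0 y\<bar> \<le> L * dist (0::real, x) (0, y) powr \<alpha>" using aL(3) T' by auto
        also have "dist (0::real, x) (0, y) = \<bar>x - y\<bar>" by (simp add: dist_Pair_Pair dist_real_def)
        also have "L * \<bar>x - y\<bar> powr \<alpha> \<le> L * 1"
          using powr_mono2[of \<alpha> "\<bar>x - y\<bar>" 1] that aL by (intro mult_left_mono) auto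
        finally have 1: "\<bar>u 0 x - u 0 y\<bar> \<le> L" by simp
        have "\<bar>\<psi>p x - \<psi>p y\<bar> \<le> 1" "\<bar>\<psi>m x - \<psi>m y\<bar> \<le> 1"
          using psi_range[of x] psi_range[of y] by (simp_all add: abs_le_iff)
        then have "\<bar>a * (\<psi>p x - \<psi>p y)\<bar> \<le> \<bar>a\<bar>" "\<bar>b * (\<psi>m x - \<psi>m y)\<bar> \<le> \<bar>b\<bar>"
          by (simp_all add: abs_mult mult_left_le)
        moreover have "fb x - fb y = (u 0 x - u 0 y) - a * (\<psi>p x - \<psi>p y) - b * (\<psi>m x - \<psi>m y)"
          by (simp add: fb(2) algebra_simps)
        ultimately show ?thesis using 1 unfolding K_def by linarith
      qed
      define M where "M = K + sqrt (\<integral>y. (fb y)\<^sup>2 \<partial>lborel) + \<bar>a\<bar> + \<bar>b\<bar> + L * T' powr \<alpha>"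
      have "\<bar>u t x\<bar> \<le> M" if t: "t \<in> {0..T}" for t x
      proof -
        have tT: "0 \<le> t" "t \<le> T'" using t by (auto simp: T'_def)
        have "\<bar>u t x - u 0 x\<bar> \<le> L * dist (t, x) (0, x) powr \<alpha>" using aL(3) T' tT by auto
        also have "\<dots> \<le> L * T' powr \<alpha>"
          using aL tT by (intro mult_left_mono powr_mono2) (auto simp: dist_Pair_Pair dist_real_def)
        finally have 1: "\<bar>u t x - u 0 x\<bar> \<le> L * T' powr \<alpha>" .
        have 2: "\<bar>fb x\<bar> \<le> K + sqrt (\<integral>y. (fb y)\<^sup>2 \<partial>lborel)" by (rule sq_int_bounded[OF fb(1) osc])
        have 3: "\<bar>a * \<psi>p x\<bar> \<le> \<bar>a\<bar>" "\<bar>b * \<psi>m x\<bar> \<le> \<bar>b\<bar>"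
          using psi_range[of x] by (simp_all add: abs_mult mult_left_le)
        have "u 0 x = fb x + a * \<psi>p x + b * \<psi>m x" by (simp add: fb(2))
        then show ?thesis using 1 2 3 unfolding M_def by linarith
      qed
      moreover have "0 \<le> M"
      proof -
        have "0 \<le> L * T' powr \<alpha>" "0 \<le> sqrt (\<integral>y. (fb y)\<^sup>2 \<partial>lborel)" using aL by auto
        then show ?thesis using aL(2) unfolding M_def K_def by linarith
      qed
      ultimately show ?thesis by blast
    qed
  qed
  then show ?thesis
    by (intro weak_solution.intro weak_solution_axioms.intro cutoffs_axioms weak)
qed

theorem theorem5p8:
  fixes \<psi>p \<psi>m :: "real \<Rightarrow> real" and u :: "real \<Rightarrow> real \<Rightarrow> real"
    and \<mu> :: "real \<Rightarrow> real measure" and \<gamma> T :: real and n :: nat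
  assumes psi: "cutoff_pair \<psi>p \<psi>m"
    and sol: "HS_weak_conservative \<psi>p \<psi>m u \<mu>"
    and gamma: "\<gamma> > 2" and n_ge: "real n \<ge> \<gamma>"
    and moment: "(\<integral>\<^sup>+x. ennreal (1 + \<bar>x\<bar> powr \<gamma>) \<partial>(\<mu> 0)) < \<infinity>"
    and T: "T > 0"
  shows "(AE t in lborel. t > 0 \<longrightarrow>
            (let D = (\<lambda>\<eta>. RR n u \<mu> t \<eta> - hh n u \<mu> t \<eta> * deriv (PP n \<mu> t) \<eta>)
             in Lp_on {0..BC n \<mu>} \<gamma> D \<and> Linf_on {0..BC n \<mu>} D \<and>
                ((\<lambda>\<tau>. Lp_dist_pow {0..BC n \<mu>} \<gamma>
                         (\<lambda>\<eta>. (PP n \<mu> (t + \<tau>) \<eta> - PP n \<mu> t \<eta>) / \<tau>) D) \<longlongrightarrow> 0) (at 0)))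
       \<and> (\<forall>t\<in>{0..T}. Lp_on {0..BC n \<mu>} \<gamma> (PP n \<mu> t) \<and> Linf_on {0..BC n \<mu>} (PP n \<mu> t))
       \<and> (\<forall>t0\<in>{0..T}. ((\<lambda>t. Lp_dist_pow {0..BC n \<mu>} \<gamma> (PP n \<mu> t) (PP n \<mu> t0)) \<longlongrightarrow> 0)
                          (at t0 within {0..T}))"
proof -
  interpret weak_solution u \<mu> \<psi>p \<psi>m by (rule HS_weak_solution[OF psi sol])
  interpret hs u \<mu> \<psi>p \<psi>m n
    using gamma n_ge by unfold_locales auto
  have \<gamma>: "0 < \<gamma>" using gamma by simp
  \<comment> \<open>Condition (v) provides a density at almost every time; this rules out
    atoms.\<close>
  have "AE t in lborel. t \<ge> 0 \<longrightarrow> (\<exists>g. weak_deriv (u t) g \<and> abs_cont_density (\<mu> t) (\<lambda>x. (g x)\<^sup>2))"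
    using sol unfolding HS_weak_conservative_def by blast
  then have "AE t in lborel. 0 < t \<longrightarrow> (\<forall>x. measure (\<mu> t) {x} = 0)"
    by eventually_elim (auto dest: abs_cont_density_atomless)
  from P_equation_Lp[OF this \<gamma>] show ?thesis
    using P_Lp_Linf[OF _ \<gamma>] P_Lp_continuous[OF _ \<gamma>] by auto
qed

end
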